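(* Let $\pi$ be a Clairaut Lagrangian submersion from a nearly Kaehler manifold $(M,\varphi,g)$ onto a Riemannian manifold $(N,g_n)$ with $r=e^f$. Then either the fibres of $\pi$ are $1$-dimensional or they are totally geodesic.
   Context: An almost Hermitian manifold $(M,\varphi,g)$ is a smooth manifold with a $(1,1)$-tensor field $\varphi$, $\varphi^2=-I$, and a Riemannian metric $g$ with $g(\varphi E,\varphi F)=g(E,F)$. It is nearly Kaehler if $(\nabla_E\varphi)F+(\nabla_F\varphi)E=0$ for all vector fields $E,F$, where $\nabla$ is the Levi-Civita connection of $g$. A Riemannian submersion $\pi:(M,g)\to(N,g_n)$ (with $\dim M>\dim N$) is a smooth surjective map of maximal rank whose differential $\pi_*$ preserves lengths of horizontal vectors; vertical vectors are those in $\ker\pi_*$ (tangent to the fibres), horizontal vectors are those in $(\ker\pi_* )^\perp$. The submersion is anti-invariant if $\varphi(\ker\pi_* )\subseteq(\ker\pi_* )^\perp$. Then $(\ker\pi_* )^\perp=\varphi\ker\pi_*\oplus\mu$ (orthogonal), where $\mu$ is the complementary distribution; the submersion is called Lagrangian if it is anti-invariant and $\mu=0$, i.e. $(\ker\pi_* )^\perp=\varphi\ker\pi_*$. The Riemannian submersion $\pi$ is a Clairaut submersion with $r=e^f$ ($f$ a smooth function on $M$) if for every geodesic $h$ on $M$ the function $(r\circ h)\sin\theta$ is constant, where $\theta(s)$ is the angle between $\dot h(s)$ and the horizontal space at $h(s)$. *)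

theory Defs
  imports "HOL-Analysis.Analysis" "HOL-Library.Function_Algebras"
begin

text \<open>
  Pointwise real vector space structure on functions, so that the library notions
  (\<open>subspace\<close>, \<open>dim\<close>, ...) apply to tangent spaces.
\<close>

instantiation "fun" :: (type, real_vector) real_vector
begin

definition scaleR_fun :: "real \<Rightarrow> ('a \<Rightarrow> 'b) \<Rightarrow> 'a \<Rightarrow> 'b"
  where "scaleR_fun a f = (\<lambda>x. a *\<^sub>R f x)"

instance
  by standard
    (simp_all add: scaleR_fun_def plus_fun_def fun_eq_iff scaleR_add_right scaleR_add_left)

end

section \<open>Smooth maps between Euclidean spaces\<close>

text \<open>\<open>times_differentiable_on n S f\<close> says that \<open>f\<close> is of class \<open>C\<^sup>n\<close> on \<open>S\<close>;
  it is only meaningful, and only used, for open \<open>S\<close>.\<close>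

primrec times_differentiable_on ::
    "nat \<Rightarrow> 'e::euclidean_space set \<Rightarrow> ('e \<Rightarrow> 'f::euclidean_space) \<Rightarrow> bool"
  where
    "times_differentiable_on 0 S f \<longleftrightarrow> continuous_on S f"
  | "times_differentiable_on (Suc n) S f \<longleftrightarrow>
       (\<forall>x\<in>S. f differentiable (at x)) \<and>
       (\<forall>v. times_differentiable_on n S (\<lambda>x. frechet_derivative f (at x) v))"

definition smooth_on :: "'e::euclidean_space set \<Rightarrow> ('e \<Rightarrow> 'f::euclidean_space) \<Rightarrow> bool"
  where "smooth_on S f \<longleftrightarrow> (\<forall>n. times_differentiable_on n S f)"

section \<open>Smooth manifolds\<close>

text \<open>A chart is its domain together with its coordinate map (whose values outside
  the domain are irrelevant). A manifold is given by a smooth atlas; its points are the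
  points covered by the charts, and its dimension is \<open>DIM('e)\<close>.\<close>

type_synonym ('a, 'e) chart = "'a set \<times> ('a \<Rightarrow> 'e)"

definition chart_inv :: "('a, 'e) chart \<Rightarrow> 'e \<Rightarrow> 'a"
  where "chart_inv c = inv_into (fst c) (snd c)"

definition is_chart :: "('a::topological_space, 'e::euclidean_space) chart \<Rightarrow> bool"
  where "is_chart c \<longleftrightarrow> open (fst c) \<and> open (snd c ` fst c) \<and>
    homeomorphism (fst c) (snd c ` fst c) (snd c) (chart_inv c)"

definition carrier :: "('a, 'e) chart set \<Rightarrow> 'a set"
  where "carrier A = (\<Union>c\<in>A. fst c)"

definition charts_at :: "('a, 'e) chart set \<Rightarrow> 'a \<Rightarrow> ('a, 'e) chart set"
  where "charts_at A p = {c \<in> A. p \<in> fst c}"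

definition chart_at :: "('a, 'e) chart set \<Rightarrow> 'a \<Rightarrow> ('a, 'e) chart"
  where "chart_at A p = (SOME c. c \<in> charts_at A p)"

text \<open>Hausdorffness and second countability are provided by the type classes.\<close>

definition smooth_manifold ::
    "('a::{t2_space, second_countable_topology}, 'e::euclidean_space) chart set \<Rightarrow> bool"
  where "smooth_manifold A \<longleftrightarrow> (\<forall>c\<in>A. is_chart c) \<and>
    (\<forall>c\<in>A. \<forall>d\<in>A. smooth_on (snd c ` (fst c \<inter> fst d)) (snd d \<circ> chart_inv c))"

definition open_in_manifold :: "('a::topological_space, 'e) chart set \<Rightarrow> 'a set \<Rightarrow> bool"
  where "open_in_manifold A U \<longleftrightarrow> open U \<and> U \<subseteq> carrier A"

definition smooth_map ::
    "('a::topological_space, 'e::euclidean_space) chart set \<Rightarrow>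
     ('b::topological_space, 'f::euclidean_space) chart set \<Rightarrow> ('a \<Rightarrow> 'b) \<Rightarrow> bool"
  where "smooth_map A B F \<longleftrightarrow> F ` carrier A \<subseteq> carrier B \<and> continuous_on (carrier A) F \<and>
    (\<forall>c\<in>A. \<forall>d\<in>B. smooth_on (snd c ` (fst c \<inter> F -` fst d)) (snd d \<circ> F \<circ> chart_inv c))"

definition smooth_fun ::
    "('a::topological_space, 'e::euclidean_space) chart set \<Rightarrow> 'a set \<Rightarrow> ('a \<Rightarrow> real) \<Rightarrow> bool"
  where "smooth_fun A U f \<longleftrightarrow> (\<forall>c\<in>A. smooth_on (snd c ` (fst c \<inter> U)) (f \<circ> chart_inv c))"

section \<open>Tangent vectors and vector fields\<close>

text \<open>A tangent vector at \<open>p\<close> is the family of its coordinate vectors in all charts around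
  \<open>p\<close>, related by the Jacobians of the coordinate changes (and \<open>0\<close> at all other charts).\<close>

type_synonym ('a, 'e) tvec = "('a, 'e) chart \<Rightarrow> 'e"

definition tangent_space ::
    "('a, 'e::euclidean_space) chart set \<Rightarrow> 'a \<Rightarrow> ('a, 'e) tvec set"
  where "tangent_space A p = {v.
    (\<forall>c\<in>charts_at A p. \<forall>d\<in>charts_at A p.
       v d = frechet_derivative (snd d \<circ> chart_inv c) (at (snd c p)) (v c)) \<and>
    (\<forall>c. c \<notin> charts_at A p \<longrightarrow> v c = 0)}"

text \<open>\<open>coord_field A c u\<close> is the vector field on the domain of \<open>c\<close> whose coordinates
  in the chart \<open>c\<close> are constantly \<open>u\<close>, i.e. \<open>\<Sum>\<^sub>i u\<^sub>i \<partial>\<^sub>i\<close>.\<close>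

definition coord_field ::
    "('a, 'e::euclidean_space) chart set \<Rightarrow> ('a, 'e) chart \<Rightarrow> 'e \<Rightarrow> 'a \<Rightarrow> ('a, 'e) tvec"
  where "coord_field A c u p = (\<lambda>d. if d \<in> charts_at A p
    then frechet_derivative (snd d \<circ> chart_inv c) (at (snd c p)) u else 0)"

text \<open>The derivative \<open>v f\<close> of a function along a tangent vector, and the differential of a
  map; for smooth \<open>f\<close>, \<open>F\<close> the choice of the chart around \<open>p\<close> is immaterial.\<close>

definition dir_deriv ::
    "('a, 'e::euclidean_space) chart set \<Rightarrow> 'a \<Rightarrow> ('a, 'e) tvec \<Rightarrow> ('a \<Rightarrow> real) \<Rightarrow> real"
  where "dir_deriv A p v f = (let c = chart_at A p in
    frechet_derivative (f \<circ> chart_inv c) (at (snd c p)) (v c))"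

definition differential ::
    "('a, 'e::euclidean_space) chart set \<Rightarrow> ('b, 'f::euclidean_space) chart set \<Rightarrow>
     ('a \<Rightarrow> 'b) \<Rightarrow> 'a \<Rightarrow> ('a, 'e) tvec \<Rightarrow> ('b, 'f) tvec"
  where "differential A B F p v = (let c = chart_at A p in (\<lambda>d. if d \<in> charts_at B (F p)
    then frechet_derivative (snd d \<circ> F \<circ> chart_inv c) (at (snd c p)) (v c) else 0))"

definition vector_field ::
    "('a::topological_space, 'e::euclidean_space) chart set \<Rightarrow> 'a set \<Rightarrow>
     ('a \<Rightarrow> ('a, 'e) tvec) \<Rightarrow> bool"
  where "vector_field A U X \<longleftrightarrow> (\<forall>p\<in>U. X p \<in> tangent_space A p) \<and>
    (\<forall>c\<in>A. smooth_on (snd c ` (fst c \<inter> U)) (\<lambda>x. X (chart_inv c x) c))"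

definition lie_bracket ::
    "('a, 'e::euclidean_space) chart set \<Rightarrow> ('a \<Rightarrow> ('a, 'e) tvec) \<Rightarrow>
     ('a \<Rightarrow> ('a, 'e) tvec) \<Rightarrow> 'a \<Rightarrow> ('a, 'e) tvec"
  where "lie_bracket A X Y p = (\<lambda>c. if c \<in> charts_at A p
    then frechet_derivative (\<lambda>x. Y (chart_inv c x) c) (at (snd c p)) (X p c) -
         frechet_derivative (\<lambda>x. X (chart_inv c x) c) (at (snd c p)) (Y p c)
    else 0)"

definition linear_map_on :: "('v::real_vector) set \<Rightarrow> ('v \<Rightarrow> 'w::real_vector) \<Rightarrow> bool"
  where "linear_map_on T L \<longleftrightarrow>
    (\<forall>v\<in>T. \<forall>w\<in>T. L (v + w) = L v + L w) \<and> (\<forall>a. \<forall>v\<in>T. L (a *\<^sub>R v) = a *\<^sub>R L v)"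

section \<open>Riemannian metrics and the Levi-Civita connection\<close>

type_synonym ('a, 'e) metric = "'a \<Rightarrow> ('a, 'e) tvec \<Rightarrow> ('a, 'e) tvec \<Rightarrow> real"

definition riemannian_metric ::
    "('a::topological_space, 'e::euclidean_space) chart set \<Rightarrow> ('a, 'e) metric \<Rightarrow> bool"
  where "riemannian_metric A g \<longleftrightarrow>
    (\<forall>p\<in>carrier A. \<forall>v\<in>tangent_space A p.
       linear_map_on (tangent_space A p) (g p v) \<and>
       (\<forall>w\<in>tangent_space A p. g p v w = g p w v) \<and>
       (v \<noteq> 0 \<longrightarrow> g p v v > 0)) \<and>
    (\<forall>U X Y. open_in_manifold A U \<and> vector_field A U X \<and> vector_field A U Y \<longrightarrow>
       smooth_fun A U (\<lambda>p. g p (X p) (Y p)))"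

definition riemannian_manifold ::
    "('a::{t2_space, second_countable_topology}, 'e::euclidean_space) chart set \<Rightarrow>
     ('a, 'e) metric \<Rightarrow> bool"
  where "riemannian_manifold A g \<longleftrightarrow> smooth_manifold A \<and> riemannian_metric A g"

definition tnorm :: "('a, 'e) metric \<Rightarrow> 'a \<Rightarrow> ('a, 'e) tvec \<Rightarrow> real"
  where "tnorm g p v = sqrt (g p v v)"

text \<open>\<open>nabla p v Y\<close> is \<open>\<nabla>\<^sub>v Y\<close> for \<open>v\<close> tangent at \<open>p\<close> and \<open>Y\<close> a vector field on some open
  neighbourhood of \<open>p\<close>. Vector fields are total functions here, so the connection is required
  to depend only on the field near \<open>p\<close>.\<close>

type_synonym ('a, 'e) connection =
  "'a \<Rightarrow> ('a, 'e) tvec \<Rightarrow> ('a \<Rightarrow> ('a, 'e) tvec) \<Rightarrow> ('a, 'e) tvec"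

definition affine_connection ::
    "('a::topological_space, 'e::euclidean_space) chart set \<Rightarrow> ('a, 'e) connection \<Rightarrow> bool"
  where "affine_connection A nabla \<longleftrightarrow>
    (\<forall>U Y. open_in_manifold A U \<and> vector_field A U Y \<longrightarrow>
       (\<forall>p\<in>U. linear_map_on (tangent_space A p) (\<lambda>v. nabla p v Y)) \<and>
       (\<forall>X. vector_field A U X \<longrightarrow> vector_field A U (\<lambda>p. nabla p (X p) Y)) \<and>
       (\<forall>p\<in>U. \<forall>v\<in>tangent_space A p.
          nabla p v Y \<in> tangent_space A p \<and>
          (\<forall>Z. vector_field A U Z \<longrightarrow> nabla p v (\<lambda>q. Y q + Z q) = nabla p v Y + nabla p v Z) \<and>
          (\<forall>f. smooth_fun A U f \<longrightarrow>
             nabla p v (\<lambda>q. f q *\<^sub>R Y q) = dir_deriv A p v f *\<^sub>R Y p + f p *\<^sub>R nabla p v Y) \<and>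
          (\<forall>Z. (\<forall>q\<in>U. Z q = Y q) \<longrightarrow> nabla p v Z = nabla p v Y)))"

definition levi_civita ::
    "('a::topological_space, 'e::euclidean_space) chart set \<Rightarrow> ('a, 'e) metric \<Rightarrow>
     ('a, 'e) connection \<Rightarrow> bool"
  where "levi_civita A g nabla \<longleftrightarrow> affine_connection A nabla \<and>
    (\<forall>U X Y. open_in_manifold A U \<and> vector_field A U X \<and> vector_field A U Y \<longrightarrow>
       (\<forall>p\<in>U. nabla p (X p) Y - nabla p (Y p) X = lie_bracket A X Y p) \<and>
       (\<forall>p\<in>U. \<forall>v\<in>tangent_space A p. dir_deriv A p v (\<lambda>q. g q (X q) (Y q)) =
          g p (nabla p v X) (Y p) + g p (X p) (nabla p v Y)))"

section \<open>Curves and geodesics\<close>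

definition smooth_curve ::
    "('a::topological_space, 'e::euclidean_space) chart set \<Rightarrow> real set \<Rightarrow> (real \<Rightarrow> 'a) \<Rightarrow> bool"
  where "smooth_curve A I h \<longleftrightarrow> h ` I \<subseteq> carrier A \<and> continuous_on I h \<and>
    (\<forall>c\<in>A. smooth_on (I \<inter> h -` fst c) (snd c \<circ> h))"

definition velocity ::
    "('a, 'e::euclidean_space) chart set \<Rightarrow> (real \<Rightarrow> 'a) \<Rightarrow> real \<Rightarrow> ('a, 'e) tvec"
  where "velocity A h s = (\<lambda>c. if c \<in> charts_at A (h s)
    then vector_derivative (snd c \<circ> h) (at s) else 0)"

text \<open>Covariant derivative of a vector field \<open>W\<close> along a curve \<open>h\<close>: writing
  \<open>W = \<Sum>\<^sub>i W\<^sup>i \<partial>\<^sub>i\<close> in a chart, it is \<open>\<Sum>\<^sub>i (W\<^sup>i)' \<partial>\<^sub>i + W\<^sup>i \<nabla>\<^bsub>h'\<^esub> \<partial>\<^sub>i\<close>.\<close>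

definition covariant_derivative_along ::
    "('a, 'e::euclidean_space) chart set \<Rightarrow> ('a, 'e) connection \<Rightarrow> (real \<Rightarrow> 'a) \<Rightarrow>
     (real \<Rightarrow> ('a, 'e) tvec) \<Rightarrow> real \<Rightarrow> ('a, 'e) tvec"
  where "covariant_derivative_along A nabla h W s = (\<lambda>c. if c \<in> charts_at A (h s)
    then vector_derivative (\<lambda>t. W t c) (at s) +
         nabla (h s) (velocity A h s) (coord_field A c (W s c)) c
    else 0)"

definition geodesic ::
    "('a::topological_space, 'e::euclidean_space) chart set \<Rightarrow> ('a, 'e) connection \<Rightarrow>
     real set \<Rightarrow> (real \<Rightarrow> 'a) \<Rightarrow> bool"
  where "geodesic A nabla I h \<longleftrightarrow> open I \<and> is_interval I \<and> smooth_curve A I h \<and>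
    (\<forall>s\<in>I. covariant_derivative_along A nabla h (velocity A h) s = 0)"

section \<open>Nearly Kaehler manifolds\<close>

definition tensor_field_11 ::
    "('a::topological_space, 'e::euclidean_space) chart set \<Rightarrow>
     ('a \<Rightarrow> ('a, 'e) tvec \<Rightarrow> ('a, 'e) tvec) \<Rightarrow> bool"
  where "tensor_field_11 A \<phi> \<longleftrightarrow>
    (\<forall>p\<in>carrier A. linear_map_on (tangent_space A p) (\<phi> p) \<and>
       \<phi> p ` tangent_space A p \<subseteq> tangent_space A p) \<and>
    (\<forall>U X. open_in_manifold A U \<and> vector_field A U X \<longrightarrow> vector_field A U (\<lambda>p. \<phi> p (X p)))"

definition almost_hermitian ::
    "('a::{t2_space, second_countable_topology}, 'e::euclidean_space) chart set \<Rightarrow>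
     ('a \<Rightarrow> ('a, 'e) tvec \<Rightarrow> ('a, 'e) tvec) \<Rightarrow> ('a, 'e) metric \<Rightarrow> bool"
  where "almost_hermitian A \<phi> g \<longleftrightarrow> riemannian_manifold A g \<and> tensor_field_11 A \<phi> \<and>
    (\<forall>p\<in>carrier A. \<forall>v\<in>tangent_space A p. \<phi> p (\<phi> p v) = - v \<and>
       (\<forall>w\<in>tangent_space A p. g p (\<phi> p v) (\<phi> p w) = g p v w))"

text \<open>\<open>(\<nabla>\<^sub>v \<phi>) F\<close> at \<open>p\<close>.\<close>

definition nabla_tensor ::
    "('a, 'e) connection \<Rightarrow> ('a \<Rightarrow> ('a, 'e) tvec \<Rightarrow> ('a, 'e::real_vector) tvec) \<Rightarrow>
     'a \<Rightarrow> ('a, 'e) tvec \<Rightarrow> ('a \<Rightarrow> ('a, 'e) tvec) \<Rightarrow> ('a, 'e) tvec"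
  where "nabla_tensor nabla \<phi> p v F = nabla p v (\<lambda>q. \<phi> q (F q)) - \<phi> p (nabla p v F)"

text \<open>The vector fields \<open>E\<close>, \<open>F\<close> may be defined on any open set; as
  \<open>(\<nabla>\<^sub>E \<phi>) F\<close> is tensorial, this is the same as asking it for globally defined fields.\<close>

definition nearly_kaehler ::
    "('a::{t2_space, second_countable_topology}, 'e::euclidean_space) chart set \<Rightarrow>
     ('a \<Rightarrow> ('a, 'e) tvec \<Rightarrow> ('a, 'e) tvec) \<Rightarrow> ('a, 'e) metric \<Rightarrow> ('a, 'e) connection \<Rightarrow> bool"
  where "nearly_kaehler A \<phi> g nabla \<longleftrightarrow> almost_hermitian A \<phi> g \<and> levi_civita A g nabla \<and>
    (\<forall>U E F. open_in_manifold A U \<and> vector_field A U E \<and> vector_field A U F \<longrightarrow>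
       (\<forall>p\<in>U. nabla_tensor nabla \<phi> p (E p) F + nabla_tensor nabla \<phi> p (F p) E = 0))"

section \<open>Riemannian submersions\<close>

definition vertical_space ::
    "('a, 'e::euclidean_space) chart set \<Rightarrow> ('b, 'f::euclidean_space) chart set \<Rightarrow>
     ('a \<Rightarrow> 'b) \<Rightarrow> 'a \<Rightarrow> ('a, 'e) tvec set"
  where "vertical_space A B \<pi> p = {v \<in> tangent_space A p. differential A B \<pi> p v = 0}"

definition horizontal_space ::
    "('a, 'e::euclidean_space) chart set \<Rightarrow> ('a, 'e) metric \<Rightarrow>
     ('b, 'f::euclidean_space) chart set \<Rightarrow> ('a \<Rightarrow> 'b) \<Rightarrow> 'a \<Rightarrow> ('a, 'e) tvec set"
  where "horizontal_space A g B \<pi> p =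
    {v \<in> tangent_space A p. \<forall>w\<in>vertical_space A B \<pi> p. g p v w = 0}"

definition riemannian_submersion ::
    "('a::{t2_space, second_countable_topology}, 'e::euclidean_space) chart set \<Rightarrow>
     ('a, 'e) metric \<Rightarrow>
     ('b::{t2_space, second_countable_topology}, 'f::euclidean_space) chart set \<Rightarrow>
     ('b, 'f) metric \<Rightarrow> ('a \<Rightarrow> 'b) \<Rightarrow> bool"
  where "riemannian_submersion A g B gN \<pi> \<longleftrightarrow>
    riemannian_manifold A g \<and> riemannian_manifold B gN \<and> DIM('f) < DIM('e) \<and>
    smooth_map A B \<pi> \<and> \<pi> ` carrier A = carrier B \<and>
    (\<forall>p\<in>carrier A. differential A B \<pi> p ` tangent_space A p = tangent_space B (\<pi> p)) \<and>
    (\<forall>p\<in>carrier A. \<forall>v\<in>horizontal_space A g B \<pi> p.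
       tnorm gN (\<pi> p) (differential A B \<pi> p v) = tnorm g p v)"

definition anti_invariant ::
    "('a, 'e::euclidean_space) chart set \<Rightarrow> ('a \<Rightarrow> ('a, 'e) tvec \<Rightarrow> ('a, 'e) tvec) \<Rightarrow>
     ('a, 'e) metric \<Rightarrow> ('b, 'f::euclidean_space) chart set \<Rightarrow> ('a \<Rightarrow> 'b) \<Rightarrow> bool"
  where "anti_invariant A \<phi> g B \<pi> \<longleftrightarrow>
    (\<forall>p\<in>carrier A. \<phi> p ` vertical_space A B \<pi> p \<subseteq> horizontal_space A g B \<pi> p)"

definition mu_space ::
    "('a, 'e::euclidean_space) chart set \<Rightarrow> ('a \<Rightarrow> ('a, 'e) tvec \<Rightarrow> ('a, 'e) tvec) \<Rightarrow>
     ('a, 'e) metric \<Rightarrow> ('b, 'f::euclidean_space) chart set \<Rightarrow> ('a \<Rightarrow> 'b) \<Rightarrow>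
     'a \<Rightarrow> ('a, 'e) tvec set"
  where "mu_space A \<phi> g B \<pi> p =
    {v \<in> horizontal_space A g B \<pi> p. \<forall>w\<in>\<phi> p ` vertical_space A B \<pi> p. g p v w = 0}"

definition lagrangian ::
    "('a, 'e::euclidean_space) chart set \<Rightarrow> ('a \<Rightarrow> ('a, 'e) tvec \<Rightarrow> ('a, 'e) tvec) \<Rightarrow>
     ('a, 'e) metric \<Rightarrow> ('b, 'f::euclidean_space) chart set \<Rightarrow> ('a \<Rightarrow> 'b) \<Rightarrow> bool"
  where "lagrangian A \<phi> g B \<pi> \<longleftrightarrow>
    anti_invariant A \<phi> g B \<pi> \<and> (\<forall>p\<in>carrier A. mu_space A \<phi> g B \<pi> p = {0})"

definition horizontal_part ::
    "('a, 'e::euclidean_space) chart set \<Rightarrow> ('a, 'e) metric \<Rightarrow>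
     ('b, 'f::euclidean_space) chart set \<Rightarrow> ('a \<Rightarrow> 'b) \<Rightarrow> 'a \<Rightarrow> ('a, 'e) tvec \<Rightarrow> ('a, 'e) tvec"
  where "horizontal_part A g B \<pi> p v =
    (THE w. w \<in> horizontal_space A g B \<pi> p \<and> v - w \<in> vertical_space A B \<pi> p)"

text \<open>The angle in \<open>[0, pi/2]\<close> between \<open>v \<noteq> 0\<close> and its orthogonal projection to the
  horizontal space. For \<open>v = 0\<close> its value is the constant \<open>pi/2\<close>, which makes the
  Clairaut condition below hold trivially along constant geodesics.\<close>

definition horizontal_angle ::
    "('a, 'e::euclidean_space) chart set \<Rightarrow> ('a, 'e) metric \<Rightarrow>
     ('b, 'f::euclidean_space) chart set \<Rightarrow> ('a \<Rightarrow> 'b) \<Rightarrow> 'a \<Rightarrow> ('a, 'e) tvec \<Rightarrow> real"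
  where "horizontal_angle A g B \<pi> p v =
    arccos (tnorm g p (horizontal_part A g B \<pi> p v) / tnorm g p v)"

text \<open>The Clairaut condition with \<open>r = e\<^sup>f\<close>. Geodesics need not be complete, so all open
  intervals are allowed as their domains.\<close>

definition clairaut ::
    "('a::topological_space, 'e::euclidean_space) chart set \<Rightarrow> ('a, 'e) metric \<Rightarrow>
     ('a, 'e) connection \<Rightarrow> ('b, 'f::euclidean_space) chart set \<Rightarrow> ('a \<Rightarrow> 'b) \<Rightarrow>
     ('a \<Rightarrow> real) \<Rightarrow> bool"
  where "clairaut A g nabla B \<pi> f \<longleftrightarrow> smooth_fun A (carrier A) f \<and>
    (\<forall>I h. geodesic A nabla I h \<longrightarrow>
       (\<lambda>s. exp (f (h s)) * sin (horizontal_angle A g B \<pi> (h s) (velocity A h s))) constant_on I)"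

section \<open>Fibres\<close>

definition fibre :: "('a, 'e) chart set \<Rightarrow> ('a \<Rightarrow> 'b) \<Rightarrow> 'b \<Rightarrow> 'a set"
  where "fibre A \<pi> q = {p \<in> carrier A. \<pi> p = q}"

text \<open>The tangent space of a fibre at \<open>p\<close> is the vertical space, and the dimension of the
  fibre is that of its tangent spaces.\<close>

definition fibre_has_dim ::
    "('a, 'e::euclidean_space) chart set \<Rightarrow> ('b, 'f::euclidean_space) chart set \<Rightarrow>
     ('a \<Rightarrow> 'b) \<Rightarrow> 'b \<Rightarrow> nat \<Rightarrow> bool"
  where "fibre_has_dim A B \<pi> q k \<longleftrightarrow> (\<forall>p\<in>fibre A \<pi> q. dim (vertical_space A B \<pi> p) = k)"

text \<open>The second fundamental form of a fibre is the normal part of \<open>\<nabla>\<^sub>X Y\<close>, where \<open>X\<close> and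
  \<open>Y\<close> are fields on an open subset of the total space that are tangent to the given fibre
  along this fibre (arbitrary local extensions of fields on the fibre). The fibre is totally
  geodesic if this form vanishes.\<close>

definition second_fundamental_form ::
    "('a, 'e::euclidean_space) chart set \<Rightarrow> ('a, 'e) metric \<Rightarrow> ('a, 'e) connection \<Rightarrow>
     ('b, 'f::euclidean_space) chart set \<Rightarrow> ('a \<Rightarrow> 'b) \<Rightarrow>
     ('a \<Rightarrow> ('a, 'e) tvec) \<Rightarrow> ('a \<Rightarrow> ('a, 'e) tvec) \<Rightarrow> 'a \<Rightarrow> ('a, 'e) tvec"
  where "second_fundamental_form A g nabla B \<pi> X Y p =
    horizontal_part A g B \<pi> p (nabla p (X p) Y)"

definition totally_geodesic_fibre ::
    "('a::topological_space, 'e::euclidean_space) chart set \<Rightarrow> ('a, 'e) metric \<Rightarrow>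
     ('a, 'e) connection \<Rightarrow> ('b, 'f::euclidean_space) chart set \<Rightarrow> ('a \<Rightarrow> 'b) \<Rightarrow> 'b \<Rightarrow> bool"
  where "totally_geodesic_fibre A g nabla B \<pi> q \<longleftrightarrow>
    (\<forall>U X Y. open_in_manifold A U \<and> vector_field A U X \<and> vector_field A U Y \<and>
       (\<forall>p\<in>U \<inter> fibre A \<pi> q. X p \<in> vertical_space A B \<pi> p \<and> Y p \<in> vertical_space A B \<pi> p) \<longrightarrow>
       (\<forall>p\<in>U \<inter> fibre A \<pi> q. second_fundamental_form A g nabla B \<pi> X Y p = 0))"

end

theory Submission
  imports Defs
begin

text \<open>
  Let \<open>II\<close> be the second fundamental form of the map \<open>\<pi>\<close>; for vertical fields
  \<open>\<pi>\<^sub>* \<nabla>\<^sub>U V = - II(U, V)\<close>, so the fibres are totally geodesic iff \<open>II\<close> vanishes on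
  vertical vectors. Since \<open>\<pi>\<close> is a Riemannian submersion, \<open>|h'|\<^sup>2 sin\<^sup>2 \<theta>\<close> is
  \<open>g(h', h') - g\<^sub>N(\<pi>\<^sub>* h', \<pi>\<^sub>* h')\<close>. Differentiating \<open>e\<^bsup>2f\<^esup>\<close> times this along the geodesics with
  initial velocities \<open>\<xi> + u\<close>, \<open>\<xi> - u\<close> and \<open>\<xi>\<close> (\<open>u\<close> vertical, \<open>\<xi>\<close> horizontal) shows that
  the fibres are umbilical: \<open>g\<^sub>N(II(u, u), \<pi>\<^sub>* \<xi>) = g(u, u) \<xi>(f)\<close>. Differentiating
  \<open>g(\<phi> U, W) = 0\<close> for vertical fields and using \<open>(\<nabla>\<^sub>U \<phi>) U = 0\<close> gives
  \<open>g\<^sub>N(II(u, u), \<pi>\<^sub>* \<phi> w) = g\<^sub>N(II(u, w), \<pi>\<^sub>* \<phi> u)\<close>, that is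
  \<open>g(u, u) (\<phi> w)(f) = g(u, w) (\<phi> u)(f)\<close>. If the fibres have dimension at least two, \<open>u\<close> can be
  chosen orthogonal to \<open>w\<close>, so \<open>(\<phi> w)(f) = 0\<close> for all vertical \<open>w\<close>; as \<open>\<phi>\<close> maps the vertical
  space onto the horizontal one, umbilicity becomes \<open>II = 0\<close>.
\<close>


section \<open>Calculus of smooth maps\<close>

text \<open>The Clairaut hypothesis speaks only of geodesics that exist, so geodesics with every
  initial velocity have to be constructed; hence the part on differential equations. As tangent
  vectors are families over all charts, the geometry is done for one pair of charts, in
  \<open>local_model\<close>, and the manifold part translates into and out of it. In coordinates
  \<open>II\<close> is formed without a connection on the target: the omitted term depends only on
  the images of both arguments under the differential and vanishes if one of them is vertical. The
  three velocities above have the same image, so the derivative of the target metric and the term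
  II(\<xi>, \<xi>) cancel between them. Total geodesy concerns fields that are vertical along a
  single fibre. They can be controlled only along curves inside this fibre, which
  \<open>straightening\<close> supplies; it also extends vertical vectors to vertical fields. All
  fibres have dimension DIM('e) - DIM('f), so the alternative is decided for all of them at
  once.\<close>

lemma frechet_derivative_eqI:
  "(f has_derivative f') (at x) \<Longrightarrow> frechet_derivative f (at x) = f'"
  using frechet_derivative_at by metis

lemma times_differentiable_on_cong:
  fixes f g :: "'e::euclidean_space \<Rightarrow> 'f::euclidean_space"
  assumes "open S" and "times_differentiable_on n S f" and "\<And>x. x \<in> S \<Longrightarrow> f x = g x"
  shows "times_differentiable_on n S g"
  using assms(2,3)
proof (induction n arbitrary: f g)
  case 0
  then show ?case using continuous_on_cong by (metis times_differentiable_on.simps(1))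
next
  case (Suc n)
  have D: "(g has_derivative frechet_derivative f (at x)) (at x)" if "x \<in> S" for x
  proof (rule has_derivative_transform_within_open[OF _ \<open>open S\<close> that])
    show "(f has_derivative frechet_derivative f (at x)) (at x)"
      using Suc.prems(1) that by (simp add: frechet_derivative_works)
  qed (use Suc.prems in auto)
  have "times_differentiable_on n S (\<lambda>x. frechet_derivative g (at x) v)" for v
    by (rule Suc.IH[of "\<lambda>x. frechet_derivative f (at x) v"])
       (use Suc.prems(1) in simp, simp add: frechet_derivative_eqI[OF D])
  then show ?case
    using D by (auto intro: differentiableI)
qed

text \<open>Any explicit family of derivatives may stand for \<open>frechet_derivative\<close>,
  since derivatives are unique and the directional maps have to agree only on the open set
  \<open>S\<close>. The closure proofs below exhibit such a family and apply the induction
  hypothesis to it.\<close>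

lemma times_differentiable_on_Suc_iff:
  fixes f :: "'e::euclidean_space \<Rightarrow> 'f::euclidean_space"
  assumes "open S"
  shows "times_differentiable_on (Suc n) S f \<longleftrightarrow>
    (\<exists>f'. (\<forall>x\<in>S. (f has_derivative f' x) (at x)) \<and> (\<forall>v. times_differentiable_on n S (\<lambda>x. f' x v)))"
    (is "?L \<longleftrightarrow> ?R")
proof
  assume ?L
  then show ?R
    by (intro exI[of _ "\<lambda>x. frechet_derivative f (at x)"]) (auto simp: frechet_derivative_works)
next
  assume ?R
  then obtain f' where D: "\<And>x. x \<in> S \<Longrightarrow> (f has_derivative f' x) (at x)"
    and f': "\<And>v. times_differentiable_on n S (\<lambda>x. f' x v)" by auto
  have "times_differentiable_on n S (\<lambda>x. frechet_derivative f (at x) v)" for v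
    by (rule times_differentiable_on_cong[OF assms f'[of v]]) (simp add: frechet_derivative_eqI[OF D])
  then show ?L
    using D by (auto intro: differentiableI)
qed

lemma times_differentiable_on_subset:
  "times_differentiable_on n S f \<Longrightarrow> T \<subseteq> S \<Longrightarrow> times_differentiable_on n T f"
  by (induction n arbitrary: f) (auto intro: continuous_on_subset)

lemma times_differentiable_on_SucD:
  assumes "open S"
  shows "times_differentiable_on (Suc n) S f \<Longrightarrow> times_differentiable_on n S f"
proof (induction n arbitrary: f)
  case 0
  then show ?case
    by (auto intro!: continuous_at_imp_continuous_on differentiable_imp_continuous_within)
qed simp

lemma times_differentiable_on_const: "times_differentiable_on n S (\<lambda>x. c)"
  by (induction n arbitrary: c) auto

lemma times_differentiable_on_linear:
  fixes f :: "'e::euclidean_space \<Rightarrow> 'f::euclidean_space"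
  assumes "open S" and "bounded_linear f"
  shows "times_differentiable_on n S f"
proof (cases n)
  case 0
  then show ?thesis using assms(2) by (simp add: linear_continuous_on)
next
  case (Suc m)
  show ?thesis
    unfolding Suc times_differentiable_on_Suc_iff[OF assms(1)]
    using assms(2)
    by (intro exI[of _ "\<lambda>x. f"]) (auto intro: bounded_linear_imp_has_derivative times_differentiable_on_const)
qed

lemma times_differentiable_on_add:
  fixes f g :: "'e::euclidean_space \<Rightarrow> 'f::euclidean_space"
  assumes "open S" and "times_differentiable_on n S f" and "times_differentiable_on n S g"
  shows "times_differentiable_on n S (\<lambda>x. f x + g x)"
  using assms(2,3)
proof (induction n arbitrary: f g)
  case 0
  then show ?case by (auto intro: continuous_intros)
next
  case (Suc n)
  obtain f' g' where f: "\<And>x. x \<in> S \<Longrightarrow> (f has_derivative f' x) (at x)"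
    "\<And>v. times_differentiable_on n S (\<lambda>x. f' x v)"
    and g: "\<And>x. x \<in> S \<Longrightarrow> (g has_derivative g' x) (at x)"
    "\<And>v. times_differentiable_on n S (\<lambda>x. g' x v)"
    using Suc.prems unfolding times_differentiable_on_Suc_iff[OF assms(1)] by blast
  show ?case
    unfolding times_differentiable_on_Suc_iff[OF assms(1)]
    by (rule exI[of _ "\<lambda>x v. f' x v + g' x v"]) (auto intro!: derivative_eq_intros f g Suc.IH)
qed

lemma times_differentiable_on_sum:
  fixes f :: "'i \<Rightarrow> 'e::euclidean_space \<Rightarrow> 'f::euclidean_space"
  assumes "open S" and "\<And>i. i \<in> I \<Longrightarrow> times_differentiable_on n S (f i)"
  shows "times_differentiable_on n S (\<lambda>x. \<Sum>i\<in>I. f i x)"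
  using assms(2)
  by (induction I rule: infinite_finite_induct)
     (auto intro: times_differentiable_on_add[OF assms(1)] times_differentiable_on_const)

lemma times_differentiable_on_bilinear:
  fixes f :: "'e::euclidean_space \<Rightarrow> 'f::euclidean_space"
    and g :: "'e \<Rightarrow> 'g::euclidean_space"
    and prod :: "'f \<Rightarrow> 'g \<Rightarrow> 'h::euclidean_space"
  assumes "open S" and "bounded_bilinear prod"
    and "times_differentiable_on n S f" and "times_differentiable_on n S g"
  shows "times_differentiable_on n S (\<lambda>x. prod (f x) (g x))"
  using assms(3,4)
proof (induction n arbitrary: f g)
  case 0
  then show ?case using assms(2) by (auto intro: bounded_bilinear.continuous_on)
next
  case (Suc n)
  obtain f' g' where f: "\<And>x. x \<in> S \<Longrightarrow> (f has_derivative f' x) (at x)"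
    "\<And>v. times_differentiable_on n S (\<lambda>x. f' x v)"
    and g: "\<And>x. x \<in> S \<Longrightarrow> (g has_derivative g' x) (at x)"
    "\<And>v. times_differentiable_on n S (\<lambda>x. g' x v)"
    using Suc.prems unfolding times_differentiable_on_Suc_iff[OF assms(1)] by blast
  \<comment> \<open>Both factors reappear undifferentiated in the product rule, and the induction
    hypothesis takes them at the lower order.\<close>
  note fg = Suc.prems[THEN times_differentiable_on_SucD[OF assms(1)]]
  show ?case
    unfolding times_differentiable_on_Suc_iff[OF assms(1)]
    by (rule exI[of _ "\<lambda>x v. prod (f x) (g' x v) + prod (f' x v) (g x)"])
       (auto intro!: bounded_bilinear.FDERIV[OF assms(2)] f g Suc.IH fg
          times_differentiable_on_add[OF assms(1)])
qed

lemma linear_basis_expansion: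
  fixes f :: "'e::euclidean_space \<Rightarrow> 'f::real_normed_vector"
  assumes "linear f"
  shows "f v = (\<Sum>b\<in>Basis. (v \<bullet> b) *\<^sub>R f b)"
  by (metis (no_types, lifting) assms euclidean_representation linear_scale linear_sum sum.cong)

lemma times_differentiable_on_compose:
  fixes f :: "'f::euclidean_space \<Rightarrow> 'g::euclidean_space"
    and g :: "'e::euclidean_space \<Rightarrow> 'f"
  assumes "open S" and "open T" and "g ` S \<subseteq> T"
    and "times_differentiable_on n T f" and "times_differentiable_on n S g"
  shows "times_differentiable_on n S (\<lambda>x. f (g x))"
  using assms(4,5)
proof (induction n arbitrary: f)
  case 0
  then show ?case using assms(3) by (auto intro: continuous_on_compose2)
next
  case (Suc n)
  obtain f' g' where f: "\<And>y. y \<in> T \<Longrightarrow> (f has_derivative f' y) (at y)"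
    "\<And>v. times_differentiable_on n T (\<lambda>x. f' x v)"
    and g: "\<And>x. x \<in> S \<Longrightarrow> (g has_derivative g' x) (at x)"
    "\<And>v. times_differentiable_on n S (\<lambda>x. g' x v)"
    using Suc.prems unfolding times_differentiable_on_Suc_iff[OF assms(1)]
      times_differentiable_on_Suc_iff[OF assms(2)] by blast
  have gn: "times_differentiable_on n S g"
    using Suc.prems(2) times_differentiable_on_SucD[OF assms(1)] by blast
  show ?case
    unfolding times_differentiable_on_Suc_iff[OF assms(1)]
  proof (intro exI[of _ "\<lambda>x v. f' (g x) (g' x v)"] conjI ballI allI)
    fix x assume "x \<in> S"
    then show "((\<lambda>x. f (g x)) has_derivative (\<lambda>v. f' (g x) (g' x v))) (at x)"
      using f g assms(3) by (intro has_derivative_compose[of g "g' x" x UNIV f "f' (g x)"]) auto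
  next
    fix v
    \<comment> \<open>The induction covers \<open>f'\<close> only in a fixed direction, whereas
      \<open>g' x v\<close> moves with \<open>x\<close>. Expanding it in a basis leaves sums of
      products of functions already under control.\<close>
    have "times_differentiable_on n S (\<lambda>x. \<Sum>b\<in>Basis. (g' x v \<bullet> b) *\<^sub>R f' (g x) b)"
      using Suc.IH[OF f(2) gn]
      by (intro times_differentiable_on_sum assms
            times_differentiable_on_bilinear[OF assms(1) bounded_bilinear_scaleR]
            times_differentiable_on_bilinear[OF assms(1) bounded_bilinear_inner] g
            times_differentiable_on_const) auto
    moreover have "(\<Sum>b\<in>Basis. (g' x v \<bullet> b) *\<^sub>R f' (g x) b) = f' (g x) (g' x v)" if "x \<in> S" for x
      using linear_basis_expansion[OF has_derivative_linear[OF f(1)], of "g x" "g' x v"]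
        that assms(3) by auto
    ultimately show "times_differentiable_on n S (\<lambda>x. f' (g x) (g' x v))"
      by (rule times_differentiable_on_cong[OF assms(1)])
  qed
qed

lemma smooth_on_cong:
  "\<lbrakk>open S; smooth_on S f; \<And>x. x \<in> S \<Longrightarrow> f x = g x\<rbrakk> \<Longrightarrow> smooth_on S g"
  unfolding smooth_on_def using times_differentiable_on_cong by blast

lemma smooth_on_subset: "smooth_on S f \<Longrightarrow> T \<subseteq> S \<Longrightarrow> smooth_on T f"
  unfolding smooth_on_def using times_differentiable_on_subset by blast

lemma smooth_on_const: "smooth_on S (\<lambda>x. c)"
  unfolding smooth_on_def by (simp add: times_differentiable_on_const)

lemma smooth_on_ident: "open S \<Longrightarrow> smooth_on S (\<lambda>x. x)"
  unfolding smooth_on_def by (simp add: times_differentiable_on_linear bounded_linear_ident)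

lemma smooth_on_add:
  "\<lbrakk>open S; smooth_on S f; smooth_on S g\<rbrakk> \<Longrightarrow> smooth_on S (\<lambda>x. f x + g x)"
  unfolding smooth_on_def by (simp add: times_differentiable_on_add)

lemma smooth_on_sum:
  "\<lbrakk>open S; \<And>i. i \<in> I \<Longrightarrow> smooth_on S (f i)\<rbrakk> \<Longrightarrow> smooth_on S (\<lambda>x. \<Sum>i\<in>I. f i x)"
  unfolding smooth_on_def by (simp add: times_differentiable_on_sum)

lemma smooth_on_scaleR:
  "\<lbrakk>open S; smooth_on S f; smooth_on S g\<rbrakk> \<Longrightarrow> smooth_on S (\<lambda>x. f x *\<^sub>R g x)"
  unfolding smooth_on_def
  by (simp add: times_differentiable_on_bilinear[OF _ bounded_bilinear_scaleR])

lemma smooth_on_inner: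
  "\<lbrakk>open S; smooth_on S f; smooth_on S g\<rbrakk> \<Longrightarrow> smooth_on S (\<lambda>x. f x \<bullet> g x)"
  unfolding smooth_on_def
  by (simp add: times_differentiable_on_bilinear[OF _ bounded_bilinear_inner])

lemma smooth_on_compose:
  "\<lbrakk>open S; open T; g ` S \<subseteq> T; smooth_on T f; smooth_on S g\<rbrakk> \<Longrightarrow> smooth_on S (\<lambda>x. f (g x))"
  unfolding smooth_on_def using times_differentiable_on_compose by blast

lemma smooth_on_frechet_derivative:
  "smooth_on S f \<Longrightarrow> smooth_on S (\<lambda>x. frechet_derivative f (at x) v)"
  unfolding smooth_on_def using times_differentiable_on.simps(2) by blast

lemma smooth_on_differentiable: "smooth_on S f \<Longrightarrow> x \<in> S \<Longrightarrow> f differentiable (at x)"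
  unfolding smooth_on_def using times_differentiable_on.simps(2) by blast

lemma smooth_on_has_derivative:
  "smooth_on S f \<Longrightarrow> x \<in> S \<Longrightarrow> (f has_derivative frechet_derivative f (at x)) (at x)"
  using smooth_on_differentiable frechet_derivative_works by blast

lemma smooth_on_linear_derivative:
  "smooth_on S f \<Longrightarrow> x \<in> S \<Longrightarrow> linear (frechet_derivative f (at x))"
  using smooth_on_has_derivative has_derivative_linear by blast

lemma smooth_on_imp_continuous_on: "smooth_on S f \<Longrightarrow> continuous_on S f"
  unfolding smooth_on_def using times_differentiable_on.simps(1) by blast

text \<open>The second difference of \<open>f\<close> over the parallelogram with sides
  \<open>s u\<close> and \<open>s w\<close> is symmetric in \<open>u\<close> and \<open>w\<close>.
  Two uses of the mean value theorem, in either order of the sides, equate it with s squared times a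
  mixed derivative at a nearby point, and continuity of the mixed derivatives lets the parallelogram
  shrink to \<open>x\<close>.\<close>

lemma second_derivative_symmetric_real:
  fixes f :: "'e::euclidean_space \<Rightarrow> real"
  assumes "open S" and "x \<in> S" and f: "times_differentiable_on 2 S f"
  shows "frechet_derivative (\<lambda>y. frechet_derivative f (at y) u) (at x) w =
         frechet_derivative (\<lambda>y. frechet_derivative f (at y) w) (at x) u"
proof -
  define D where "D a y = frechet_derivative f (at y) a" for a y
  define H where "H a b y = frechet_derivative (D a) (at y) b" for a b y
  have df: "(f has_derivative (\<lambda>a. D a y)) (at y)" if "y \<in> S" for y
    using f that by (simp add: numeral_2_eq_2 D_def frechet_derivative_works)
  have dD: "(D a has_derivative (\<lambda>b. H a b y)) (at y)" if "y \<in> S" for a y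
    using f that by (simp add: numeral_2_eq_2 D_def[abs_def] H_def frechet_derivative_works)
  have cH: "continuous_on S (H a b)" for a b
    using f by (simp add: numeral_2_eq_2 D_def[abs_def] H_def[abs_def])
  obtain r where r: "r > 0" "ball x r \<subseteq> S" using assms(1,2) openE by blast
  have key: "\<exists>y\<in>ball x e. f (x + s *\<^sub>R a + s *\<^sub>R b) - f (x + s *\<^sub>R a) - f (x + s *\<^sub>R b) + f x
      = s * s * H a b y"
    if e: "e \<le> r" and s: "0 < s" "s * (norm a + norm b) < e" for e s a b
  proof -
    have inb: "x + \<tau> *\<^sub>R a + \<sigma> *\<^sub>R b \<in> ball x e" if "0 \<le> \<tau>" "\<tau> \<le> s" "0 \<le> \<sigma>" "\<sigma> \<le> s" for \<tau> \<sigma>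
    proof -
      have "norm (\<tau> *\<^sub>R a + \<sigma> *\<^sub>R b) \<le> \<tau> * norm a + \<sigma> * norm b"
        using that by (metis abs_of_nonneg norm_scaleR norm_triangle_ineq)
      also have "\<dots> \<le> s * norm a + s * norm b"
        using that by (intro add_mono mult_right_mono) auto
      finally have "norm (\<tau> *\<^sub>R a + \<sigma> *\<^sub>R b) < e" using s by (simp add: algebra_simps)
      moreover have "dist x (x + \<tau> *\<^sub>R a + \<sigma> *\<^sub>R b) = norm (\<tau> *\<^sub>R a + \<sigma> *\<^sub>R b)"
        by (metis add.assoc add_diff_cancel_left' dist_commute dist_norm)
      ultimately show ?thesis by simp
    qed
    have inS: "x + \<tau> *\<^sub>R a + \<sigma> *\<^sub>R b \<in> S" if "0 \<le> \<tau>" "\<tau> \<le> s" "0 \<le> \<sigma>" "\<sigma> \<le> s" for \<tau> \<sigma>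
      using inb[OF that] r e by auto
    \<comment> \<open>The increment in direction \<open>b\<close> as a function of the displacement
      along \<open>a\<close>; its own increment from 0 to \<open>s\<close> is the second
      difference.\<close>
    define k where "k \<tau> = f (x + \<tau> *\<^sub>R a + s *\<^sub>R b) - f (x + \<tau> *\<^sub>R a)" for \<tau>
    have dk: "(k has_derivative (\<lambda>h. h * (D a (x + \<tau> *\<^sub>R a + s *\<^sub>R b) - D a (x + \<tau> *\<^sub>R a)))) (at \<tau>)"
      if "0 \<le> \<tau>" "\<tau> \<le> s" for \<tau>
    proof -
      have lin: "D (h *\<^sub>R a) y = h * D a y" if "y \<in> S" for h y
        using linear_cmul[OF has_derivative_linear[OF df[OF that]], of h a] by simp
      have in1: "x + \<tau> *\<^sub>R a + s *\<^sub>R b \<in> S" and in2: "x + \<tau> *\<^sub>R a \<in> S"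
        using inS[of \<tau> s] inS[of \<tau> 0] that s by auto
      have 1: "((\<lambda>\<tau>. f (x + \<tau> *\<^sub>R a + s *\<^sub>R b)) has_derivative (\<lambda>h. D (h *\<^sub>R a) (x + \<tau> *\<^sub>R a + s *\<^sub>R b))) (at \<tau>)"
        by (rule has_derivative_compose[where f = "\<lambda>\<tau>. x + \<tau> *\<^sub>R a + s *\<^sub>R b" and f' = "\<lambda>h. h *\<^sub>R a", OF _ df[OF in1]])
           (auto intro!: derivative_eq_intros)
      have 2: "((\<lambda>\<tau>. f (x + \<tau> *\<^sub>R a)) has_derivative (\<lambda>h. D (h *\<^sub>R a) (x + \<tau> *\<^sub>R a))) (at \<tau>)"
        by (rule has_derivative_compose[where f = "\<lambda>\<tau>. x + \<tau> *\<^sub>R a" and f' = "\<lambda>h. h *\<^sub>R a", OF _ df[OF in2]])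
           (auto intro!: derivative_eq_intros)
      show ?thesis
        unfolding k_def[abs_def] right_diff_distrib
        by (rule has_derivative_diff[OF 1[unfolded lin[OF in1]] 2[unfolded lin[OF in2]]])
    qed
    have "\<exists>\<tau>\<in>{0<..<s}. k s - k 0 = (s - 0) * (D a (x + \<tau> *\<^sub>R a + s *\<^sub>R b) - D a (x + \<tau> *\<^sub>R a))"
      by (rule mvt_simple[OF s(1)]) (rule has_derivative_at_withinI[OF dk]; simp)
    then obtain \<tau> where \<tau>: "0 < \<tau>" "\<tau> < s"
      "k s - k 0 = s * (D a (x + \<tau> *\<^sub>R a + s *\<^sub>R b) - D a (x + \<tau> *\<^sub>R a))" by auto
    have dl: "((\<lambda>\<sigma>. D a (x + \<tau> *\<^sub>R a + \<sigma> *\<^sub>R b)) has_derivative (\<lambda>h. h * H a b (x + \<tau> *\<^sub>R a + \<sigma> *\<^sub>R b))) (at \<sigma>)"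
      if "0 \<le> \<sigma>" "\<sigma> \<le> s" for \<sigma>
    proof -
      have in1: "x + \<tau> *\<^sub>R a + \<sigma> *\<^sub>R b \<in> S" using inS that \<tau> by auto
      have lin: "H a (h *\<^sub>R b) y = h * H a b y" if "y \<in> S" for h y
        using linear_cmul[OF has_derivative_linear[OF dD[OF that, of a]], of h b] by simp
      have "((\<lambda>\<sigma>. D a (x + \<tau> *\<^sub>R a + \<sigma> *\<^sub>R b)) has_derivative (\<lambda>h. H a (h *\<^sub>R b) (x + \<tau> *\<^sub>R a + \<sigma> *\<^sub>R b))) (at \<sigma>)"
        by (rule has_derivative_compose[where f = "\<lambda>\<sigma>. x + \<tau> *\<^sub>R a + \<sigma> *\<^sub>R b" and f' = "\<lambda>h. h *\<^sub>R b", OF _ dD[OF in1]])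
           (auto intro!: derivative_eq_intros)
      then show ?thesis by (simp add: lin in1)
    qed
    have "\<exists>\<sigma>\<in>{0<..<s}. D a (x + \<tau> *\<^sub>R a + s *\<^sub>R b) - D a (x + \<tau> *\<^sub>R a + 0 *\<^sub>R b)
        = (s - 0) * H a b (x + \<tau> *\<^sub>R a + \<sigma> *\<^sub>R b)"
      by (rule mvt_simple[OF s(1)]) (rule has_derivative_at_withinI[OF dl], auto)
    then obtain \<sigma> where \<sigma>: "0 < \<sigma>" "\<sigma> < s"
      "D a (x + \<tau> *\<^sub>R a + s *\<^sub>R b) - D a (x + \<tau> *\<^sub>R a) = s * H a b (x + \<tau> *\<^sub>R a + \<sigma> *\<^sub>R b)" by auto
    show ?thesis
      using inb[of \<tau> \<sigma>] \<tau> \<sigma> by (intro bexI[of _ "x + \<tau> *\<^sub>R a + \<sigma> *\<^sub>R b"]) (auto simp: k_def algebra_simps)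
  qed
  have near: "\<bar>H u w x - H w u x\<bar> \<le> 0 + 2 * \<epsilon>" if "\<epsilon> > 0" for \<epsilon>
  proof -
    have "\<exists>d>0. \<forall>y\<in>S. dist y x < d \<longrightarrow> dist (H a b y) (H a b x) < \<epsilon>" for a b
      using cH[of a b] \<open>x \<in> S\<close> \<open>\<epsilon> > 0\<close> by (simp add: continuous_on_iff)
    then obtain d1 d2 where d: "d1 > 0" "\<And>y. y \<in> S \<Longrightarrow> dist y x < d1 \<Longrightarrow> dist (H u w y) (H u w x) < \<epsilon>"
      "d2 > 0" "\<And>y. y \<in> S \<Longrightarrow> dist y x < d2 \<Longrightarrow> dist (H w u y) (H w u x) < \<epsilon>"
      by metis
    define e where "e = min r (min d1 d2)"
    have e: "e > 0" "e \<le> r" "e \<le> d1" "e \<le> d2" using r d by (auto simp: e_def)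
    \<comment> \<open>The summand 1 keeps the quotient meaningful when \<open>u\<close> and
      \<open>w\<close> both vanish and makes the bound on the parallelogram strict.\<close>
    define s where "s = e / (norm u + norm w + 1)"
    have s: "0 < s" using e by (auto simp: s_def intro!: divide_pos_pos add_nonneg_pos)
    have "s * (norm u + norm w) < e"
      using e(1) by (simp add: s_def divide_simps add_nonneg_pos)
    then obtain y z where yz: "y \<in> ball x e" "z \<in> ball x e"
      "f (x + s *\<^sub>R u + s *\<^sub>R w) - f (x + s *\<^sub>R u) - f (x + s *\<^sub>R w) + f x = s * s * H u w y"
      "f (x + s *\<^sub>R w + s *\<^sub>R u) - f (x + s *\<^sub>R w) - f (x + s *\<^sub>R u) + f x = s * s * H w u z"
      using key[OF e(2) s, of u w] key[OF e(2) s, of w u] by (auto simp: add.commute)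
    have "x + s *\<^sub>R w + s *\<^sub>R u = x + s *\<^sub>R u + s *\<^sub>R w" by simp
    with yz(4) have "f (x + s *\<^sub>R u + s *\<^sub>R w) - f (x + s *\<^sub>R w) - f (x + s *\<^sub>R u) + f x
        = s * s * H w u z" by (simp only:)
    then have "s * s * H u w y = s * s * H w u z" using yz(3) by linarith
    then have "H u w y = H w u z" using s by simp
    moreover have "\<bar>H u w y - H u w x\<bar> < \<epsilon>" "\<bar>H w u z - H w u x\<bar> < \<epsilon>"
      using d(2)[of y] d(4)[of z] yz(1,2) e r by (auto simp: dist_real_def dist_commute subset_iff)
    ultimately show ?thesis by linarith
  qed
  have "\<bar>H u w x - H w u x\<bar> \<le> 0"
  proof (rule field_le_epsilon)
    fix e :: real assume "e > 0"
    then show "\<bar>H u w x - H w u x\<bar> \<le> 0 + e" using near[of "e / 2"] by simp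
  qed
  then show ?thesis by (simp add: H_def D_def[abs_def])
qed

lemma frechet_derivative_inner_const:
  assumes "f differentiable (at x)"
  shows "frechet_derivative (\<lambda>y. f y \<bullet> b) (at x) = (\<lambda>v. frechet_derivative f (at x) v \<bullet> b)"
proof -
  have "((\<lambda>y. f y \<bullet> b) has_derivative (\<lambda>v. frechet_derivative f (at x) v \<bullet> b)) (at x)"
    using assms unfolding frechet_derivative_works by (intro has_derivative_inner_left)
  then show ?thesis by (rule frechet_derivative_eqI)
qed

lemma second_derivative_symmetric:
  fixes f :: "'e::euclidean_space \<Rightarrow> 'f::euclidean_space"
  assumes "open S" and "x \<in> S" and f: "smooth_on S f"
  shows "frechet_derivative (\<lambda>y. frechet_derivative f (at y) u) (at x) w =
         frechet_derivative (\<lambda>y. frechet_derivative f (at y) w) (at x) u" (is "?l = ?r")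
proof (rule euclidean_eqI)
  fix b :: 'f
  have D: "frechet_derivative (\<lambda>y. frechet_derivative (\<lambda>z. f z \<bullet> b) (at y) a) (at x) c =
      frechet_derivative (\<lambda>y. frechet_derivative f (at y) a) (at x) c \<bullet> b" for a c
  proof -
    have "((\<lambda>y. frechet_derivative f (at y) a) has_derivative
        frechet_derivative (\<lambda>y. frechet_derivative f (at y) a) (at x)) (at x)"
      by (intro smooth_on_has_derivative[OF _ assms(2)] smooth_on_frechet_derivative f)
    then have "((\<lambda>y. frechet_derivative f (at y) a \<bullet> b) has_derivative
        (\<lambda>c. frechet_derivative (\<lambda>y. frechet_derivative f (at y) a) (at x) c \<bullet> b)) (at x)"
      by (intro has_derivative_inner_left)
    then have "((\<lambda>y. frechet_derivative (\<lambda>z. f z \<bullet> b) (at y) a) has_derivative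
        (\<lambda>c. frechet_derivative (\<lambda>y. frechet_derivative f (at y) a) (at x) c \<bullet> b)) (at x)"
      by (rule has_derivative_transform_within_open[OF _ assms(1,2)])
         (simp add: frechet_derivative_inner_const smooth_on_differentiable[OF f])
    from frechet_derivative_eqI[OF this] show ?thesis by simp
  qed
  have "times_differentiable_on 2 S (\<lambda>z. f z \<bullet> b)"
    using smooth_on_inner[OF assms(1) f smooth_on_const] by (simp add: smooth_on_def)
  from second_derivative_symmetric_real[OF assms(1,2) this, of u w]
  show "?l \<bullet> b = ?r \<bullet> b" by (simp add: D)
qed

section \<open>Ordinary differential equations\<close>

lemma linear_of_linear_family_derivative:
  fixes A :: "'p::real_normed_vector \<Rightarrow> 'v::real_vector \<Rightarrow> 'w::real_normed_vector"
  assumes "open T" "t \<in> T" and lin: "\<And>s. s \<in> T \<Longrightarrow> linear (A s)"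
    and A: "\<And>a. ((\<lambda>s. A s a) has_derivative (\<lambda>h. A' h a)) (at t)"
  shows "linear (A' h)"
proof (rule linearI)
  fix a b :: 'v and c :: real
  \<comment> \<open>Additivity holds for every parameter in the open set \<open>T\<close>, so both
    sides of it have the same derivative at \<open>t\<close>.\<close>
  have "((\<lambda>s. A s (a + b)) has_derivative (\<lambda>h. A' h a + A' h b)) (at t)"
    by (rule has_derivative_transform_within_open[OF has_derivative_add[OF A A] assms(1,2)])
       (simp add: lin linear_add)
  from has_derivative_unique[OF this A] show "A' h (a + b) = A' h a + A' h b" by metis
  have "((\<lambda>s. A s (c *\<^sub>R a)) has_derivative (\<lambda>h. c *\<^sub>R A' h a)) (at t)"
    by (rule has_derivative_transform_within_open[OF has_derivative_scaleR_right[OF A] assms(1,2)])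
       (simp add: lin linear_scale)
  from has_derivative_unique[OF this A] show "A' h (c *\<^sub>R a) = c *\<^sub>R A' h a" by metis
qed

text \<open>Differentiability in the parameter is given only for each fixed argument. In finite
  dimension this is enough: expanding the moving argument in a basis reduces the claim to products
  of scalar functions with such families.\<close>

lemma has_derivative_linear_family:
  fixes A :: "'p::real_normed_vector \<Rightarrow> 'v::euclidean_space \<Rightarrow> 'w::real_normed_vector"
  assumes "open T" "t \<in> T" and lin: "\<And>s. s \<in> T \<Longrightarrow> linear (A s)"
    and A: "\<And>a. ((\<lambda>s. A s a) has_derivative (\<lambda>h. A' h a)) (at t)"
    and V: "(V has_derivative V') (at t)"
  shows "((\<lambda>s. A s (V s)) has_derivative (\<lambda>h. A' h (V t) + A t (V' h))) (at t)"
proof -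
  have linA': "linear (A' h)" for h
    by (rule linear_of_linear_family_derivative[OF assms(1-3) A])
  have "((\<lambda>s. \<Sum>b\<in>Basis. (V s \<bullet> b) *\<^sub>R A s b) has_derivative
      (\<lambda>h. \<Sum>b\<in>Basis. (V t \<bullet> b) *\<^sub>R A' h b + (V' h \<bullet> b) *\<^sub>R A t b)) (at t)"
    by (intro has_derivative_sum has_derivative_scaleR A has_derivative_inner_left V)
  then have "((\<lambda>s. \<Sum>b\<in>Basis. (V s \<bullet> b) *\<^sub>R A s b) has_derivative
      (\<lambda>h. A' h (V t) + A t (V' h))) (at t)"
    by (simp add: sum.distrib linear_basis_expansion[OF linA', symmetric]
          linear_basis_expansion[OF lin[OF assms(2)], symmetric])
  then show ?thesis
    by (rule has_derivative_transform_within_open[OF _ assms(1,2)])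
       (simp add: linear_basis_expansion[OF lin, symmetric])
qed

lemma has_derivative_bilinear_family:
  fixes A :: "'p::real_normed_vector \<Rightarrow> 'v::euclidean_space \<Rightarrow> 'u::euclidean_space \<Rightarrow> 'w::real_normed_vector"
  assumes "open T" "t \<in> T" and bil: "\<And>s. s \<in> T \<Longrightarrow> bilinear (A s)"
    and A: "\<And>a b. ((\<lambda>s. A s a b) has_derivative (\<lambda>h. A' h a b)) (at t)"
    and V: "(V has_derivative V') (at t)" and W: "(W has_derivative W') (at t)"
  shows "((\<lambda>s. A s (V s) (W s)) has_derivative
    (\<lambda>h. A' h (V t) (W t) + A t (V t) (W' h) + A t (V' h) (W t))) (at t)"
proof -
  have lin: "linear (A s a)" "linear (\<lambda>a. A s a b)" if "s \<in> T" for s a b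
    using bil[OF that] by (auto simp: bilinear_def)
  have "((\<lambda>s. A s a (W s)) has_derivative (\<lambda>h. A' h a (W t) + A t a (W' h))) (at t)" for a
    by (rule has_derivative_linear_family[OF assms(1,2) lin(1) A W])
  then have "((\<lambda>s. (\<lambda>a. A s a (W s)) (V s)) has_derivative
      (\<lambda>h. (\<lambda>a. A' h a (W t) + A t a (W' h)) (V t) + (\<lambda>a. A t a (W t)) (V' h))) (at t)"
    by (intro has_derivative_linear_family[OF assms(1,2) _ _ V]) (use lin(2) in auto)
  then show ?thesis by simp
qed

lemma bilinear_basis_expansion:
  fixes A :: "'v::euclidean_space \<Rightarrow> 'u::euclidean_space \<Rightarrow> 'w::real_normed_vector"
  assumes "bilinear A"
  shows "A v w = (\<Sum>i\<in>Basis. \<Sum>j\<in>Basis. ((v \<bullet> i) * (w \<bullet> j)) *\<^sub>R A i j)"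
proof -
  have lin: "linear (A a)" "linear (\<lambda>a. A a b)" for a b
    using assms by (auto simp: bilinear_def)
  have "A v w = (\<Sum>i\<in>Basis. (v \<bullet> i) *\<^sub>R A i w)"
    by (rule linear_basis_expansion[OF lin(2)])
  also have "\<dots> = (\<Sum>i\<in>Basis. (v \<bullet> i) *\<^sub>R (\<Sum>j\<in>Basis. (w \<bullet> j) *\<^sub>R A i j))"
    by (simp add: linear_basis_expansion[OF lin(1), symmetric])
  finally show ?thesis by (simp add: scaleR_sum_right)
qed

section \<open>Existence and smoothness of solutions\<close>

lemma integral_diff_bound:
  fixes h :: "real \<Rightarrow> 'e::euclidean_space"
  assumes h: "continuous_on UNIV h" "\<And>s. norm (h s) \<le> B" and "a \<le> s" "a \<le> t"
  shows "norm (integral {a..t} h - integral {a..s} h) \<le> B * \<bar>t - s\<bar>"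
proof -
  have int: "h integrable_on {c..d}" for c d
    using h(1) by (intro integrable_continuous_real) (auto intro: continuous_on_subset)
  have *: "norm (integral {a..d} h - integral {a..c} h) \<le> B * \<bar>d - c\<bar>" if "a \<le> c" "c \<le> d" for c d
  proof -
    have "integral {a..c} h + integral {c..d} h = integral {a..d} h"
      using that int by (intro Henstock_Kurzweil_Integration.integral_combine) auto
    moreover have "norm (integral {c..d} h) \<le> B * (d - c)"
      using that h by (intro integral_bound) (auto intro: continuous_on_subset)
    ultimately show ?thesis using that by (metis abs_of_nonneg add_diff_cancel_left' diff_ge_0_iff_ge)
  qed
  show ?thesis
    using *[of s t] *[of t s] assms(3,4) by (cases "s \<le> t") (auto simp: norm_minus_commute abs_minus_commute)
qed

text \<open>Banach's fixed point theorem for the integral operator on bounded continuous functions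
  of a real variable. \<open>L * \<delta>\<close> is its contraction factor and
  \<open>K * \<delta>\<close> bounds the distance of the solution from \<open>y0\<close>.\<close>

lemma picard_lindelof_global:
  fixes F :: "'e::euclidean_space \<Rightarrow> 'e"
  assumes lip: "\<And>y z. dist (F y) (F z) \<le> L * dist y z" and bd: "\<And>y. norm (F y) \<le> K"
    and \<delta>: "0 < \<delta>" "L * \<delta> < 1" and "0 \<le> L"
  shows "\<exists>y. y 0 = y0 \<and> (\<forall>t. dist y0 (y t) \<le> K * \<delta>) \<and>
    (\<forall>t\<in>{-\<delta><..<\<delta>}. (y has_vector_derivative F (y t)) (at t))"
proof -
  \<comment> \<open>Clamping time lets the iterates be bounded functions on the whole line, constant
    outside the interval where the equation has to hold.\<close>
  define c where "c t = max (-\<delta>) (min \<delta> t)" for t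
  have c: "- \<delta> \<le> c t" "\<bar>c t\<bar> \<le> \<delta>" for t using \<delta>(1) by (auto simp: c_def)
  have cc: "continuous_on UNIV c" unfolding c_def by (intro continuous_intros)
  have cF: "continuous_on UNIV F"
  proof (rule continuous_onI)
    fix x e :: real and z assume "0 < e"
    \<comment> \<open>The divisor \<open>L + 1\<close> instead of \<open>L\<close> also covers
      \<open>L = 0\<close>.\<close>
    have "dist (F x') (F z) \<le> e" if "dist x' z < e / (L + 1)" for x'
    proof -
      have "dist (F x') (F z) \<le> L * dist x' z" by (rule lip)
      also have "\<dots> \<le> (L + 1) * (e / (L + 1))"
        using that assms(5) by (intro mult_mono) auto
      finally show ?thesis using assms(5) by simp
    qed
    then show "\<exists>d>0. \<forall>x'\<in>UNIV. dist x' z < d \<longrightarrow> dist (F x') (F z) \<le> e"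
      using \<open>0 < e\<close> assms(5) by (intro exI[of _ "e / (L + 1)"]) auto
  qed
  \<comment> \<open>The difference of two integrals starting at \<open>-\<delta>\<close> is the
    oriented integral from 0 to \<open>c t\<close>, so negative times need no case
    distinction.\<close>
  define I where "I h t = y0 + (integral {-\<delta>..c t} h - integral {-\<delta>..0} h)" for h :: "real \<Rightarrow> 'e" and t
  have cFy: "continuous_on UNIV (\<lambda>s. F (apply_bcontfun y s))" for y
    by (rule continuous_on_compose2[OF cF]) auto
  have I_bound: "dist y0 (I h t) \<le> B * \<delta>"
    if "continuous_on UNIV h" "\<And>s. norm (h s) \<le> B" for h B t
  proof -
    have "dist y0 (I h t) = norm (integral {-\<delta>..c t} h - integral {-\<delta>..0} h)"
      by (simp add: I_def dist_norm norm_minus_commute)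
    also have "\<dots> \<le> B * \<bar>c t - 0\<bar>"
      using that c \<delta> by (intro integral_diff_bound) auto
    also have "\<dots> \<le> B * \<delta>"
      using c order_trans[OF norm_ge_zero that(2)[of 0]] by (intro mult_left_mono) auto
    finally show ?thesis .
  qed
  have I_deriv: "(I h has_vector_derivative h t) (at t)"
    if h: "continuous_on UNIV h" and t: "t \<in> {-\<delta><..<\<delta>}" for h t
  proof -
    have "((\<lambda>u. integral {-\<delta>..u} h) has_vector_derivative h t) (at t within {-\<delta>..\<delta>})"
      using t by (intro integral_has_vector_derivative continuous_on_subset[OF h]) auto
    then have "((\<lambda>u. integral {-\<delta>..u} h) has_vector_derivative h t) (at t)"
      using t by (metis at_within_interior has_vector_derivative_at_within interior_atLeastAtMost_real)
    then have "((\<lambda>u. y0 + (integral {-\<delta>..u} h - integral {-\<delta>..0} h)) has_vector_derivative h t) (at t)"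
      by (auto intro!: derivative_eq_intros)
    then show ?thesis
      by (rule has_vector_derivative_transform_within_open[OF _ open_greaterThanLessThan t])
         (auto simp: I_def c_def)
  qed
  have I_cont: "continuous_on UNIV (I h)" if h: "continuous_on UNIV h" for h
  proof -
    have "continuous_on {-\<delta>..\<delta>} (\<lambda>u. integral {-\<delta>..u} h)"
      by (intro indefinite_integral_continuous_1 integrable_continuous_real continuous_on_subset[OF h]) auto
    then have "continuous_on UNIV (\<lambda>t. integral {-\<delta>..c t} h)"
      by (rule continuous_on_compose2[OF _ cc]) (use c in \<open>auto simp: abs_le_iff\<close>)
    then show ?thesis unfolding I_def[abs_def] by (intro continuous_intros)
  qed
  have I_bc: "I (\<lambda>s. F (apply_bcontfun y s)) \<in> bcontfun" for y
  proof -
    have "bounded (range (I (\<lambda>s. F (apply_bcontfun y s))))"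
      unfolding bounded_def using I_bound[OF cFy bd] by (intro exI[of _ y0] exI[of _ "K * \<delta>"]) auto
    then show ?thesis using I_cont[OF cFy] by (auto simp: bcontfun_def)
  qed
  define T where "T y = Bcontfun (I (\<lambda>s. F (apply_bcontfun y s)))" for y
  have T: "apply_bcontfun (T y) = I (\<lambda>s. F (apply_bcontfun y s))" for y
    unfolding T_def by (rule Bcontfun_inverse[OF I_bc])
  have "\<exists>!y. T y = y"
  proof (rule banach_fix_type)
    show "\<forall>y z. dist (T y) (T z) \<le> (L * \<delta>) * dist y z"
    proof (intro allI dist_bound)
      fix y z :: "real \<Rightarrow>\<^sub>C 'e" and t
      define k where "k s = F (apply_bcontfun y s) - F (apply_bcontfun z s)" for s
      have k: "continuous_on UNIV k" unfolding k_def[abs_def] by (intro continuous_intros cFy)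
      have kb: "norm (k s) \<le> L * dist y z" for s
      proof -
        have "norm (k s) \<le> L * dist (apply_bcontfun y s) (apply_bcontfun z s)"
          using lip unfolding k_def dist_norm by simp
        also have "\<dots> \<le> L * dist y z" using assms(5) dist_bounded by (intro mult_left_mono)
        finally show ?thesis .
      qed
      have int: "(\<lambda>s. F (apply_bcontfun y s)) integrable_on {a..b}" for y :: "real \<Rightarrow>\<^sub>C 'e" and a b
        by (intro integrable_continuous_real continuous_on_subset[OF cFy]) auto
      have "I (\<lambda>s. F (apply_bcontfun y s)) t - I (\<lambda>s. F (apply_bcontfun z s)) t = I k t - y0"
        unfolding I_def k_def by (simp add: Henstock_Kurzweil_Integration.integral_diff int)
      then have "dist (T y t) (T z t) = dist y0 (I k t)"
        unfolding T by (simp add: dist_norm norm_minus_commute)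
      also have "\<dots> \<le> (L * dist y z) * \<delta>" by (rule I_bound[OF k kb])
      finally show "dist (T y t) (T z t) \<le> (L * \<delta>) * dist y z" by (simp add: mult_ac)
    qed
  qed (use \<delta> assms(5) in auto)
  then obtain y where y: "T y = y" by auto
  then have yI: "apply_bcontfun y = I (\<lambda>s. F (apply_bcontfun y s))" using T by metis
  show ?thesis
  proof (intro exI[of _ "apply_bcontfun y"] conjI allI ballI)
    show "apply_bcontfun y 0 = y0" using \<delta>(1) by (subst yI) (simp add: I_def c_def)
    show "dist y0 (apply_bcontfun y t) \<le> K * \<delta>" for t by (subst yI) (rule I_bound[OF cFy bd])
    show "(apply_bcontfun y has_vector_derivative F (apply_bcontfun y t)) (at t)" if "t \<in> {-\<delta><..<\<delta>}" for t
      using I_deriv[OF cFy that, of y] yI by simp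
  qed
qed

text \<open>Composing \<open>F\<close> with the nearest point map onto a closed ball around
  \<open>y0\<close> gives a globally bounded Lipschitz field. For small \<open>\<delta>\<close> its
  solution stays inside the ball, where the nearest point map is the identity, so it solves the
  original equation.\<close>

lemma picard_lindelof:
  fixes F :: "'e::euclidean_space \<Rightarrow> 'e"
  assumes "open S" "y0 \<in> S" and F: "times_differentiable_on 1 S F"
  shows "\<exists>\<delta>>0. \<exists>y. y 0 = y0 \<and>
    (\<forall>t\<in>{-\<delta><..<\<delta>}. y t \<in> S \<and> (y has_vector_derivative F (y t)) (at t))"
proof -
  obtain r where r: "r > 0" "cball y0 r \<subseteq> S"
    using assms(1,2) open_contains_cball by blast
  let ?C = "cball y0 r"
  have DF: "(F has_derivative frechet_derivative F (at x)) (at x)" if "x \<in> S" for x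
    using F that by (simp add: frechet_derivative_works)
  have cDF: "continuous_on ?C (\<lambda>x. frechet_derivative F (at x) v)" for v
    using F by (intro continuous_on_subset[OF _ r(2)]) simp
  have cF: "continuous_on ?C F"
    using r(2) by (intro continuous_at_imp_continuous_on ballI has_derivative_continuous[OF DF]) auto
  have "\<exists>K. \<forall>x\<in>?C. norm (F x) \<le> K"
    using compact_imp_bounded[OF compact_continuous_image[OF cF compact_cball]] by (auto simp: bounded_iff)
  then obtain K where K: "\<And>x. x \<in> ?C \<Longrightarrow> norm (F x) \<le> K" by blast
  \<comment> \<open>The sum of the norms of the partial derivatives dominates the operator norm of
    the derivative, so a bound for it on the compact ball is a Lipschitz constant.\<close>
  have "continuous_on ?C (\<lambda>x. \<Sum>b\<in>Basis. norm (frechet_derivative F (at x) b))"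
    by (intro continuous_intros cDF)
  from compact_imp_bounded[OF compact_continuous_image[OF this compact_cball]]
  have "\<exists>L. \<forall>x\<in>?C. \<bar>\<Sum>b\<in>Basis. norm (frechet_derivative F (at x) b)\<bar> \<le> L"
    by (auto simp: bounded_iff)
  then obtain L where L: "\<And>x. x \<in> ?C \<Longrightarrow> \<bar>\<Sum>b\<in>Basis. norm (frechet_derivative F (at x) b)\<bar> \<le> L"
    by blast
  have on: "onorm (frechet_derivative F (at x)) \<le> L" if x: "x \<in> ?C" for x
  proof (rule onorm_le)
    fix v
    have lin: "linear (frechet_derivative F (at x))"
      using DF x r(2) has_derivative_linear by blast
    have "norm (frechet_derivative F (at x) v) = norm (\<Sum>b\<in>Basis. (v \<bullet> b) *\<^sub>R frechet_derivative F (at x) b)"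
      using linear_basis_expansion[OF lin] by metis
    also have "\<dots> \<le> (\<Sum>b\<in>Basis. \<bar>v \<bullet> b\<bar> * norm (frechet_derivative F (at x) b))"
      by (rule sum_norm_le) simp
    also have "\<dots> \<le> (\<Sum>b\<in>Basis. norm v * norm (frechet_derivative F (at x) b))"
      by (intro sum_mono mult_right_mono Basis_le_norm) auto
    also have "\<dots> \<le> L * norm v"
      using mult_right_mono[OF order_trans[OF abs_ge_self L[OF x]] norm_ge_zero[of v]]
      by (simp add: sum_distrib_left[symmetric] mult.commute)
    finally show "norm (frechet_derivative F (at x) v) \<le> L * norm v" .
  qed
  define R where "R = closest_point ?C"
  have R: "R x \<in> ?C" for x using r(1) by (auto simp: R_def intro!: closest_point_in_set simp del: mem_cball)
  have RL: "dist (R x) (R z) \<le> dist x z" for x z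
    unfolding R_def using r(1) by (intro closest_point_lipschitz) auto
  have L0: "0 \<le> L" using L[of y0] r(1) by force
  have K0: "0 \<le> K" using K[of y0] r(1) norm_ge_zero order_trans by (metis centre_in_cball less_imp_le)
  \<comment> \<open>The first term keeps the solution in the ball, the second makes the operator a
    contraction; adding 1 allows \<open>K\<close> or \<open>L\<close> to be 0.\<close>
  define \<delta> where "\<delta> = min (r / (K + 1)) (1 / (L + 1))"
  have \<delta>: "0 < \<delta>" using r(1) L0 K0 by (auto simp: \<delta>_def)
  have L\<delta>: "L * \<delta> < 1"
  proof -
    have "L * \<delta> \<le> L * (1 / (L + 1))" using L0 by (intro mult_left_mono) (auto simp: \<delta>_def)
    also have "\<dots> < 1" using L0 by simp
    finally show ?thesis .
  qed
  have K\<delta>: "K * \<delta> \<le> r"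
  proof -
    have "K * \<delta> \<le> K * (r / (K + 1))" using K0 by (intro mult_left_mono) (auto simp: \<delta>_def)
    also have "\<dots> \<le> r" using K0 r(1) by (simp add: divide_simps algebra_simps)
    finally show ?thesis .
  qed
  have lipF: "dist (F (R y)) (F (R z)) \<le> L * dist y z" for y z
  proof -
    have "norm (F (R y) - F (R z)) \<le> L * norm (R y - R z)"
    proof (rule differentiable_bound[where S = ?C])
      fix x assume "x \<in> ?C"
      then have "x \<in> S" using r(2) by auto
      then show "(F has_derivative frechet_derivative F (at x)) (at x within ?C)"
        by (rule has_derivative_at_withinI[OF DF])
    qed (use on R in auto)
    also have "\<dots> \<le> L * dist y z" using L0 RL by (auto simp: dist_norm intro!: mult_left_mono)
    finally show ?thesis by (simp add: dist_norm)
  qed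
  obtain y where y: "y 0 = y0" "\<And>t. dist y0 (y t) \<le> K * \<delta>"
    "\<And>t. t \<in> {-\<delta><..<\<delta>} \<Longrightarrow> (y has_vector_derivative F (R (y t))) (at t)"
    using picard_lindelof_global[of "\<lambda>x. F (R x)" L K \<delta> y0] lipF K[OF R] \<delta> L\<delta> L0 by blast
  have yC: "y t \<in> ?C" for t using y(2)[of t] K\<delta> by simp
  then have "R (y t) = y t" for t unfolding R_def by (rule closest_point_self)
  then show ?thesis using y \<delta> yC r(2) by (intro exI[of _ \<delta>] conjI exI[of _ y]) auto
qed

text \<open>Bootstrapping: if \<open>y\<close> is n times continuously differentiable, so is its
  derivative \<open>F (y t)\<close>, and \<open>y\<close> gains one order.\<close>

lemma smooth_on_solution:
  fixes F :: "'e::euclidean_space \<Rightarrow> 'e"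
  assumes "open S" "open I" and F: "smooth_on S F"
    and y: "\<And>t. t \<in> I \<Longrightarrow> y t \<in> S" "\<And>t. t \<in> I \<Longrightarrow> (y has_vector_derivative F (y t)) (at t)"
  shows "smooth_on I y"
proof -
  have "times_differentiable_on n I y" for n
  proof (induction n)
    case 0
    then show ?case
      by (simp, intro continuous_at_imp_continuous_on ballI)
         (rule has_vector_derivative_continuous[OF y(2)])
  next
    case (Suc n)
    have "times_differentiable_on n I (\<lambda>t. F (y t))"
      using F Suc y(1) assms(1,2)
      by (intro times_differentiable_on_compose[OF assms(2,1) _ _ Suc])
         (simp_all add: smooth_on_def image_subsetI)
    then have "times_differentiable_on n I (\<lambda>t. v *\<^sub>R F (y t))" for v :: real
      by (intro times_differentiable_on_bilinear[OF assms(2) bounded_bilinear_scaleR]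
            times_differentiable_on_const)
    then show ?case
      unfolding times_differentiable_on_Suc_iff[OF assms(2)]
      using y(2) by (intro exI[of _ "\<lambda>t v. v *\<^sub>R F (y t)"]) (auto simp: has_vector_derivative_def)
  qed
  then show ?thesis by (simp add: smooth_on_def)
qed

lemma smooth_on_linear_compose:
  fixes f :: "'e::euclidean_space \<Rightarrow> 'f::euclidean_space" and l :: "'f \<Rightarrow> 'g::euclidean_space"
  assumes "open S" "bounded_linear l" "smooth_on S f"
  shows "smooth_on S (\<lambda>x. l (f x))"
  by (rule smooth_on_compose[OF assms(1) open_UNIV _ _ assms(3)])
     (auto simp: smooth_on_def assms(2) times_differentiable_on_linear)

lemma smooth_on_Pair:
  fixes f :: "'e::euclidean_space \<Rightarrow> 'f::euclidean_space" and g :: "'e \<Rightarrow> 'g::euclidean_space"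
  assumes "open S" "smooth_on S f" "smooth_on S g"
  shows "smooth_on S (\<lambda>x. (f x, g x))"
proof -
  have "smooth_on S (\<lambda>x. (f x, 0 :: 'g) + (0, g x))"
    using assms by (intro smooth_on_add smooth_on_linear_compose[where l = "\<lambda>a. (a, 0)"]
        smooth_on_linear_compose[where l = "\<lambda>a. (0, a)"] bounded_linear_Pair
        bounded_linear_ident bounded_linear_zero)
  then show ?thesis by simp
qed

lemma smooth_on_bilinear_family:
  fixes A :: "'e::euclidean_space \<Rightarrow> 'v::euclidean_space \<Rightarrow> 'u::euclidean_space \<Rightarrow> 'w::euclidean_space"
  assumes "open S" "open T" and bil: "\<And>x. x \<in> T \<Longrightarrow> bilinear (A x)" and A: "\<And>a b. smooth_on T (\<lambda>x. A x a b)"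
    and x: "smooth_on S x" "x ` S \<subseteq> T" and V: "smooth_on S V" and W: "smooth_on S W"
  shows "smooth_on S (\<lambda>t. A (x t) (V t) (W t))"
proof -
  have "smooth_on S (\<lambda>t. \<Sum>i\<in>Basis. \<Sum>j\<in>Basis. ((V t \<bullet> i) *\<^sub>R (W t \<bullet> j)) *\<^sub>R A (x t) i j)"
    by (intro smooth_on_sum smooth_on_scaleR smooth_on_inner smooth_on_const assms
          smooth_on_compose[OF assms(1,2) x(2) A x(1)])
  then show ?thesis
    by (rule smooth_on_cong[OF assms(1)]) (use x(2) in \<open>simp add: bilinear_basis_expansion[OF bil, symmetric] image_subset_iff\<close>)
qed

text \<open>Position and velocity together satisfy a first order autonomous system. The velocity is
  unrestricted, hence the phase space \<open>S \<times> UNIV\<close>.\<close>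

lemma second_order_ode:
  fixes \<Gamma> :: "'e::euclidean_space \<Rightarrow> 'e \<Rightarrow> 'e \<Rightarrow> 'e"
  assumes S: "open S" "x0 \<in> S"
    and bil: "\<And>x. x \<in> S \<Longrightarrow> bilinear (\<Gamma> x)" and \<Gamma>: "\<And>a b. smooth_on S (\<lambda>x. \<Gamma> x a b)"
  shows "\<exists>\<delta>>0. \<exists>x v. x 0 = x0 \<and> v 0 = v0 \<and> smooth_on {-\<delta><..<\<delta>} x \<and>
    (\<forall>t\<in>{-\<delta><..<\<delta>}. x t \<in> S \<and> (x has_vector_derivative v t) (at t) \<and>
       (v has_vector_derivative - \<Gamma> (x t) (v t) (v t)) (at t))"
proof -
  define F where "F z = (snd z, (-1) *\<^sub>R \<Gamma> (fst z) (snd z) (snd z))" for z :: "'e \<times> 'e"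
  have O: "open (S \<times> (UNIV :: 'e set))" using S(1) by (intro open_Times) auto
  have F: "smooth_on (S \<times> UNIV) F"
    unfolding F_def[abs_def]
    by (intro smooth_on_Pair smooth_on_scaleR smooth_on_const smooth_on_bilinear_family[OF O S(1) bil \<Gamma>]
          smooth_on_linear_compose[where l = fst] smooth_on_linear_compose[where l = snd]
          smooth_on_ident O bounded_linear_fst bounded_linear_snd) auto
  obtain \<delta> y where y: "\<delta> > 0" "y 0 = (x0, v0)"
    "\<And>t. t \<in> {-\<delta><..<\<delta>} \<Longrightarrow> y t \<in> S \<times> UNIV"
    "\<And>t. t \<in> {-\<delta><..<\<delta>} \<Longrightarrow> (y has_vector_derivative F (y t)) (at t)"
  proof -
    have "times_differentiable_on 1 (S \<times> UNIV) F" using F unfolding smooth_on_def by (rule spec)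
    moreover have "(x0, v0) \<in> S \<times> UNIV" using S(2) by simp
    ultimately have "\<exists>\<delta>>0. \<exists>y. y 0 = (x0, v0) \<and> (\<forall>t\<in>{-\<delta><..<\<delta>}. y t \<in> S \<times> UNIV \<and>
        (y has_vector_derivative F (y t)) (at t))"
      by (intro picard_lindelof[OF O])
    then show ?thesis using that by (elim exE conjE) blast
  qed
  have "smooth_on {-\<delta><..<\<delta>} y"
    by (rule smooth_on_solution[OF O open_greaterThanLessThan F y(3,4)])
  then have "smooth_on {-\<delta><..<\<delta>} (\<lambda>t. fst (y t))"
    by (rule smooth_on_linear_compose[OF open_greaterThanLessThan bounded_linear_fst])
  moreover have "((\<lambda>t. fst (y t)) has_vector_derivative snd (y t)) (at t)"
    "((\<lambda>t. snd (y t)) has_vector_derivative - \<Gamma> (fst (y t)) (snd (y t)) (snd (y t))) (at t)"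
    if "t \<in> {-\<delta><..<\<delta>}" for t
    using bounded_linear.has_vector_derivative[OF bounded_linear_fst y(4)[OF that]]
      bounded_linear.has_vector_derivative[OF bounded_linear_snd y(4)[OF that]]
    by (simp_all add: F_def)
  ultimately show ?thesis
    using y by (intro exI[of _ \<delta>] conjI exI[of _ "\<lambda>t. fst (y t)"] exI[of _ "\<lambda>t. snd (y t)"])
      (auto simp: mem_Times_iff)
qed

section \<open>Orthogonal projections and inverses of linear families\<close>

lemma bilinear_linear:
  assumes "bilinear A"
  shows "linear (A a)" "linear (\<lambda>a. A a b)"
  using assms by (auto simp: bilinear_def)

lemma bilinear_expand:
  assumes "bilinear A"
  shows "A (a + b) c = A a c + A b c" "A a (b + c) = A a b + A a c"
    "A (a - b) c = A a c - A b c" "A a (b - c) = A a b - A a c"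
    "A (- a) c = - A a c" "A a (- c) = - A a c"
    "A (r *\<^sub>R a) c = r *\<^sub>R A a c" "A a (r *\<^sub>R c) = r *\<^sub>R A a c"
    "A 0 c = 0" "A a 0 = 0"
  using bilinear_linear[OF assms] 
  by (auto simp: linear_add linear_diff linear_neg linear_scale linear_0
      dest: linear_add[where f = "\<lambda>a. A a c"] linear_diff[where f = "\<lambda>a. A a c"] linear_neg[where f = "\<lambda>a. A a c"]
        linear_scale[where f = "\<lambda>a. A a c"] linear_0[where f = "\<lambda>a. A a c"])

text \<open>Gram-Schmidt with respect to \<open>G\<close>: subtract from the new vector
  \<open>b\<close> its projection to the old span, then correct the projection of \<open>v\<close>
  along the remainder. \<open>G\<close> will be the metric at a point, which differs from the
  ambient inner product.\<close>

lemma exists_orthogonal_projection_span: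
  fixes B :: "'v::real_vector set" and G :: "'v \<Rightarrow> 'v \<Rightarrow> real"
  assumes bil: "bilinear G" and pos: "\<And>a. a \<noteq> 0 \<Longrightarrow> G a a > 0"
    and "finite B"
  shows "\<exists>k\<in>span B. \<forall>l\<in>span B. G (v - k) l = 0"
  using \<open>finite B\<close>
proof (induction B arbitrary: v)
  case empty
  then show ?case by (simp add: bilinear_expand[OF bil])
next
  case (insert b B)
  note exp = bilinear_expand[OF bil]
  obtain k0 where k0: "k0 \<in> span B" "\<And>l. l \<in> span B \<Longrightarrow> G (b - k0) l = 0" using insert.IH by blast
  obtain k1 where k1: "k1 \<in> span B" "\<And>l. l \<in> span B \<Longrightarrow> G (v - k1) l = 0" using insert.IH by blast
  define b' where "b' = b - k0"
  \<comment> \<open>If \<open>b' = 0\<close>, the quotient is 0 and the identity for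
    \<open>c\<close> below still holds, both sides being 0.\<close>
  define c where "c = G (v - k1) b' / G b' b'"
  have c: "G (v - k1) b' = c * G b' b'"
    using pos[of b'] by (cases "b' = 0") (auto simp: c_def exp)
  have sub: "span B \<subseteq> span (insert b B)" by (intro span_mono) auto
  have "b' \<in> span (insert b B)"
    unfolding b'_def using k0(1) sub by (intro span_diff) (auto intro: span_base)
  then have "k1 + c *\<^sub>R b' \<in> span (insert b B)"
    using k1(1) sub by (intro span_add span_scale) auto
  moreover have "G (v - (k1 + c *\<^sub>R b')) l = 0" if l: "l \<in> span (insert b B)" for l
  proof -
    obtain \<alpha> where "l - \<alpha> *\<^sub>R b \<in> span B" using l by (auto simp: span_insert)
    then have l': "l - \<alpha> *\<^sub>R b' \<in> span B" (is "?l \<in> _")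
      using span_add[OF _ span_scale[OF k0(1), of \<alpha>]]
      by (force simp: b'_def algebra_simps)
    have "G (v - k1 - c *\<^sub>R b') l = G (v - k1 - c *\<^sub>R b') (?l + \<alpha> *\<^sub>R b')" by simp
    also have "\<dots> = G (v - k1) ?l - c * G b' ?l + \<alpha> * (G (v - k1) b' - c * G b' b')"
      by (simp only: exp) (simp add: algebra_simps)
    also have "\<dots> = 0" using c k0(2)[OF l'] k1(2)[OF l'] by (simp add: b'_def)
    finally show ?thesis by (simp add: diff_diff_eq)
  qed
  ultimately show ?case by blast
qed

lemma exists_orthogonal_projection:
  fixes K :: "'v::euclidean_space set" and G :: "'v \<Rightarrow> 'v \<Rightarrow> real"
  assumes "bilinear G" and "\<And>a. a \<noteq> 0 \<Longrightarrow> G a a > 0"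
    and "subspace K"
  shows "\<exists>k\<in>K. \<forall>l\<in>K. G (v - k) l = 0"
proof -
  obtain B where "B \<subseteq> K" "independent B" "K = span B"
    using basis_exists[of K] assms(3) by (metis span_eq_iff span_mono subset_antisym)
  then show ?thesis
    using exists_orthogonal_projection_span[OF assms(1,2), of B v] independent_imp_finite by blast
qed

text \<open>Implicit differentiation of \<open>A x (V x) = u\<close> where \<open>A x0\<close> is
  the identity. Regularity of \<open>V\<close> comes out of the estimate: the deviation of
  \<open>A x\<close> from the identity is of first order in \<open>x - x0\<close>, so
  \<open>V x - u\<close> is too, and the remainder \<open>E\<close> is of second order.\<close>

lemma has_derivative_linear_family_inverse:
  fixes A :: "'e::euclidean_space \<Rightarrow> 'v::euclidean_space \<Rightarrow> 'v"
  assumes "open S" "x0 \<in> S" and lin: "\<And>x. x \<in> S \<Longrightarrow> linear (A x)" and id: "\<And>v. A x0 v = v"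
    and A: "\<And>v. ((\<lambda>x. A x v) has_derivative (\<lambda>h. A' h v)) (at x0)"
    and V: "\<And>x. x \<in> S \<Longrightarrow> A x (V x) = u"
  shows "(V has_derivative (\<lambda>h. - A' h u)) (at x0)"
proof -
  have V0: "V x0 = u" using V[OF assms(2)] id by simp
  \<comment> \<open>A computable stand-in for the operator norm of \<open>A x\<close> minus the
    identity.\<close>
  define \<rho> where "\<rho> x = (\<Sum>b\<in>Basis. norm (A x b - b))" for x
  have \<rho>: "norm (A x w - w) \<le> \<rho> x * norm w" if "x \<in> S" for x w
  proof -
    have "linear (\<lambda>w. A x w - w)" using lin[OF that] by (intro linear_compose_sub linear_ident)
    from linear_basis_expansion[OF this, of w]
    have "norm (A x w - w) = norm (\<Sum>b\<in>Basis. (w \<bullet> b) *\<^sub>R (A x b - b))" by simp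
    also have "\<dots> \<le> (\<Sum>b\<in>Basis. \<bar>w \<bullet> b\<bar> * norm (A x b - b))" by (rule sum_norm_le) simp
    also have "\<dots> \<le> (\<Sum>b\<in>Basis. norm w * norm (A x b - b))"
      by (intro sum_mono mult_right_mono Basis_le_norm) auto
    finally show ?thesis by (simp add: \<rho>_def sum_distrib_left[symmetric] mult.commute)
  qed
  have \<rho>0: "\<rho> x \<ge> 0" for x unfolding \<rho>_def by (intro sum_nonneg) auto
  have \<rho>lim: "(\<rho> \<longlongrightarrow> 0) (at x0)"
  proof -
    have "((\<lambda>x. A x b) \<longlongrightarrow> b) (at x0)" for b
      using has_derivative_continuous[OF A[of b]] by (simp add: isCont_def id)
    then have "(\<rho> \<longlongrightarrow> (\<Sum>b\<in>(Basis::'v set). norm (b - b))) (at x0)"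
      unfolding \<rho>_def[abs_def] by (intro tendsto_intros)
    then show ?thesis by simp
  qed
  have evS: "\<forall>\<^sub>F x in at x0. x \<in> S" using assms(1,2) eventually_at_topological by blast
  have ev\<rho>: "\<forall>\<^sub>F x in at x0. \<rho> x < 1 / 2"
    using \<rho>lim by (rule order_tendstoD) simp
  have Vb: "norm (V x - u) \<le> 2 * \<rho> x * norm u" if "x \<in> S" "\<rho> x < 1 / 2" for x
  proof -
    have "norm (V x) \<le> norm (V x - u) + norm u" by (metis diff_add_cancel norm_triangle_ineq)
    moreover have "norm (V x - u) \<le> \<rho> x * norm (V x)"
      using \<rho>[OF that(1), of "V x"] V[OF that(1)] by (simp add: norm_minus_commute)
    moreover have "\<rho> x * norm (V x) \<le> 1 / 2 * norm (V x)" using that(2) by (intro mult_right_mono) auto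
    ultimately have "norm (V x) \<le> 2 * norm u" by simp
    then have "\<rho> x * norm (V x) \<le> \<rho> x * (2 * norm u)" by (intro mult_left_mono \<rho>0)
    with \<open>norm (V x - u) \<le> \<rho> x * norm (V x)\<close> show ?thesis by simp
  qed
  define E where "E x = V x - u + (A x u - u)" for x
  have Eb: "norm (E x) \<le> \<rho> x * (2 * \<rho> x * norm u)" if "x \<in> S" "\<rho> x < 1 / 2" for x
  proof -
    \<comment> \<open>By \<open>A x (V x) = u\<close>, the remainder is the deviation of
      \<open>A x\<close> from the identity applied to \<open>V x - u\<close>, a product of two small
      quantities.\<close>
    have "E x = - (A x (V x - u) - (V x - u))"
      using V[OF that(1)] lin[OF that(1)] by (simp add: E_def linear_diff)
    then have "norm (E x) \<le> \<rho> x * norm (V x - u)" using \<rho>[OF that(1)] by (metis norm_minus_cancel)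
    also have "\<dots> \<le> \<rho> x * (2 * \<rho> x * norm u)" by (intro mult_left_mono Vb that \<rho>0)
    finally show ?thesis .
  qed
  obtain K where K: "\<forall>\<^sub>F x in at x0. \<rho> x \<le> K * norm (x - x0)"
  proof -
    have "\<exists>k. \<forall>\<^sub>F x in at x0. norm (A x b - b) \<le> k * norm (x - x0)" for b
    proof -
      obtain k where k: "\<And>h. norm (A' h b) \<le> norm h * k"
        using has_derivative_bounded_linear[OF A[of b]] bounded_linear.bounded by blast
      have "((\<lambda>x. norm (A x b - A x0 b - A' (x - x0) b) / norm (x - x0)) \<longlongrightarrow> 0) (at x0)"
        using A[of b] by (simp add: has_derivative_iff_norm)
      then have "\<forall>\<^sub>F x in at x0. norm (A x b - A x0 b - A' (x - x0) b) / norm (x - x0) < 1"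
        by (rule order_tendstoD) simp
      moreover have "\<forall>\<^sub>F x in at x0. x \<noteq> x0" by (simp add: eventually_at_filter)
      ultimately have "\<forall>\<^sub>F x in at x0. norm (A x b - b) \<le> (k + 1) * norm (x - x0)"
      proof eventually_elim
        case (elim x)
        then have "norm (A x b - b - A' (x - x0) b) \<le> norm (x - x0)" by (simp add: id)
        moreover have "norm (A x b - b) \<le> norm (A x b - b - A' (x - x0) b) + norm (A' (x - x0) b)"
          by (metis diff_add_cancel norm_triangle_ineq)
        ultimately show ?case using k[of "x - x0"] by (simp add: algebra_simps)
      qed
      then show ?thesis by blast
    qed
    then obtain k where k: "\<And>b. \<forall>\<^sub>F x in at x0. norm (A x b - b) \<le> k b * norm (x - x0)" by metis
    have "\<forall>\<^sub>F x in at x0. \<forall>b\<in>(Basis::'v set). norm (A x b - b) \<le> k b * norm (x - x0)"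
      by (intro eventually_ball_finite ballI k) auto
    then have "\<forall>\<^sub>F x in at x0. \<rho> x \<le> (\<Sum>b\<in>(Basis::'v set). k b) * norm (x - x0)"
      by eventually_elim (auto simp: \<rho>_def sum_distrib_right intro!: sum_mono)
    then show ?thesis by (rule that)
  qed
  have "((\<lambda>x. norm (E x) / norm (x - x0)) \<longlongrightarrow> 0) (at x0)"
  proof (rule Lim_null_comparison)
    show "\<forall>\<^sub>F x in at x0. norm (norm (E x) / norm (x - x0)) \<le> K * (2 * \<rho> x * norm u)"
      using evS ev\<rho> K
    proof eventually_elim
      case (elim x)
      have "norm (E x) \<le> \<rho> x * (2 * \<rho> x * norm u)" using Eb elim by blast
      also have "\<dots> \<le> (K * norm (x - x0)) * (2 * \<rho> x * norm u)"
        using elim \<rho>0 by (intro mult_right_mono) auto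
      finally have *: "norm (E x) \<le> (K * (2 * \<rho> x * norm u)) * norm (x - x0)" by (simp add: mult_ac)
      show ?case
      proof (cases "x = x0")
        case True
        then show ?thesis using V0 id by (simp add: \<rho>_def)
      next
        case False
        then show ?thesis using * by (simp add: divide_le_eq)
      qed
    qed
    show "((\<lambda>x. K * (2 * \<rho> x * norm u)) \<longlongrightarrow> 0) (at x0)"
      using \<rho>lim by (auto intro!: tendsto_eq_intros)
  qed
  then have "(E has_derivative (\<lambda>h. 0)) (at x0)"
    by (simp add: has_derivative_iff_norm) (simp add: E_def V0 id)
  from has_derivative_diff[OF this A[of u]]
  have "((\<lambda>x. E x - A x u) has_derivative (\<lambda>h. 0 - A' h u)) (at x0)" .
  from has_derivative_add[OF this has_derivative_const[of "u + u"]]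
  show ?thesis by (simp add: E_def)
qed

section \<open>The theorem in local coordinates\<close>

text \<open>All that the geometric argument uses about one pair of charts. The target carries a
  metric but no connection. In \<open>clair\<close> the sine is expressed through lengths, and the
  intervals are symmetric about 0 as the existence theorem delivers them. \<open>nearly_k\<close> is
  the product rule for \<open>G x (J x a) b\<close> in the direction \<open>a\<close> with
  (\<nabla>_a J) a = 0 inserted.\<close>

locale local_model =
  fixes S :: "'e::euclidean_space set" and T :: "'f::euclidean_space set"
    and G :: "'e \<Rightarrow> 'e \<Rightarrow> 'e \<Rightarrow> real" and H :: "'f \<Rightarrow> 'f \<Rightarrow> 'f \<Rightarrow> real"
    and \<Gamma> :: "'e \<Rightarrow> 'e \<Rightarrow> 'e \<Rightarrow> 'e" and J :: "'e \<Rightarrow> 'e \<Rightarrow> 'e"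
    and p :: "'e \<Rightarrow> 'f" and f :: "'e \<Rightarrow> real"
  assumes open_S: "open S"
    and smooth_p: "smooth_on S p" and p_in: "x \<in> S \<Longrightarrow> p x \<in> T"
    and smooth_f: "smooth_on S f"
    and G_bil: "x \<in> S \<Longrightarrow> bilinear (G x)" and G_sym: "x \<in> S \<Longrightarrow> G x a b = G x b a"
    and G_pos: "x \<in> S \<Longrightarrow> a \<noteq> 0 \<Longrightarrow> G x a a > 0" and G_smooth: "smooth_on S (\<lambda>x. G x a b)"
    and H_bil: "y \<in> T \<Longrightarrow> bilinear (H y)" and H_sym: "y \<in> T \<Longrightarrow> H y c' d' = H y d' c'"
    and H_pos: "y \<in> T \<Longrightarrow> c' \<noteq> 0 \<Longrightarrow> H y c' c' > 0" and H_smooth: "smooth_on T (\<lambda>y. H y c' d')"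
    and \<Gamma>_bil: "x \<in> S \<Longrightarrow> bilinear (\<Gamma> x)" and \<Gamma>_sym: "x \<in> S \<Longrightarrow> \<Gamma> x a b = \<Gamma> x b a"
    and \<Gamma>_smooth: "smooth_on S (\<lambda>x. \<Gamma> x a b)"
    and metric_compatible: "x \<in> S \<Longrightarrow>
      frechet_derivative (\<lambda>x. G x a b) (at x) c = G x (\<Gamma> x c a) b + G x a (\<Gamma> x c b)"
    and surj_p: "x \<in> S \<Longrightarrow> surj (frechet_derivative p (at x))"
    and submersion: "\<lbrakk>x \<in> S; \<And>k. frechet_derivative p (at x) k = 0 \<Longrightarrow> G x a k = 0\<rbrakk> \<Longrightarrow>
      H (p x) (frechet_derivative p (at x) a) (frechet_derivative p (at x) a) = G x a a"
    and J_lin: "x \<in> S \<Longrightarrow> linear (J x)" and J_smooth: "smooth_on S (\<lambda>x. J x a)"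
    and J_J: "x \<in> S \<Longrightarrow> J x (J x a) = - a" and J_isometry: "x \<in> S \<Longrightarrow> G x (J x a) (J x b) = G x a b"
    and anti_inv: "\<lbrakk>x \<in> S; frechet_derivative p (at x) a = 0; frechet_derivative p (at x) b = 0\<rbrakk> \<Longrightarrow>
      G x (J x a) b = 0"
    and lagr: "\<lbrakk>x \<in> S; \<And>k. frechet_derivative p (at x) k = 0 \<Longrightarrow> G x a k = 0;
      \<And>k. frechet_derivative p (at x) k = 0 \<Longrightarrow> G x a (J x k) = 0\<rbrakk> \<Longrightarrow> a = 0"
    and nearly_k: "x \<in> S \<Longrightarrow> frechet_derivative (\<lambda>x. G x (J x a) b) (at x) a =
      G x (J x (\<Gamma> x a a)) b + G x (J x a) (\<Gamma> x a b)"
    and clair: "\<lbrakk>\<delta> > 0; smooth_on {-\<delta><..<\<delta>} X; \<And>t. t \<in> {-\<delta><..<\<delta>} \<Longrightarrow> X t \<in> S;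
      \<And>t. t \<in> {-\<delta><..<\<delta>} \<Longrightarrow> (X has_vector_derivative V t) (at t);
      \<And>t. t \<in> {-\<delta><..<\<delta>} \<Longrightarrow> (V has_vector_derivative - \<Gamma> (X t) (V t) (V t)) (at t)\<rbrakk> \<Longrightarrow>
      (\<lambda>t. exp (f (X t)) * sqrt (1 - H (p (X t)) (frechet_derivative p (at (X t)) (V t))
         (frechet_derivative p (at (X t)) (V t)) / G (X t) (V t) (V t))) constant_on {-\<delta><..<\<delta>}"
begin

abbreviation P :: "'e \<Rightarrow> 'e \<Rightarrow> 'f" where "P x \<equiv> frechet_derivative p (at x)"

definition D2 :: "'e \<Rightarrow> 'e \<Rightarrow> 'e \<Rightarrow> 'f"
  where "D2 x u w = frechet_derivative (\<lambda>y. P y u) (at x) w"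

text \<open>The Hessian of the map \<open>p\<close> for the connection \<open>\<Gamma>\<close> on
  the source and the flat connection of the coordinates on the target. The Christoffel term of the
  target would depend on \<open>P x u\<close> and \<open>P x w\<close> only; the derivative of
  \<open>H\<close> in \<open>clairaut_infinitesimal\<close> takes its place.\<close>

definition II :: "'e \<Rightarrow> 'e \<Rightarrow> 'e \<Rightarrow> 'f"
  where "II x u w = D2 x u w - P x (\<Gamma> x u w)"

lemma P_linear: "x \<in> S \<Longrightarrow> linear (P x)"
  using smooth_on_linear_derivative[OF smooth_p] .

lemma P_has_derivative: "x \<in> S \<Longrightarrow> ((\<lambda>y. P y u) has_derivative (\<lambda>w. D2 x u w)) (at x)"
  unfolding D2_def by (rule smooth_on_has_derivative[OF smooth_on_frechet_derivative[OF smooth_p]])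

lemma D2_sym: "x \<in> S \<Longrightarrow> D2 x u w = D2 x w u"
  unfolding D2_def by (rule second_derivative_symmetric[OF open_S _ smooth_p])

lemma II_sym: "x \<in> S \<Longrightarrow> II x u w = II x w u"
  by (simp add: II_def D2_sym[of x u w] \<Gamma>_sym[of x u w])

lemma II_linear: assumes "x \<in> S" shows "linear (II x u)"
proof -
  have "linear (D2 x u)" using P_has_derivative[OF assms] by (rule has_derivative_linear)
  moreover have "linear (\<lambda>w. P x (\<Gamma> x u w))"
    using linear_compose[OF bilinear_linear(1)[OF \<Gamma>_bil[OF assms], of u] P_linear[OF assms]] by (simp add: o_def)
  ultimately show ?thesis unfolding II_def[abs_def] by (rule linear_compose_sub)
qed

lemma II_bilinear: assumes "x \<in> S" shows "bilinear (II x)"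
  unfolding bilinear_def using II_linear[OF assms] II_sym[OF assms] by presburger

lemma decompose:
  assumes "x \<in> S"
  obtains k where "P x k = 0" "\<And>l. P x l = 0 \<Longrightarrow> G x (v - k) l = 0"
proof -
  have "subspace {k. P x k = 0}" using linear_subspace_kernel[OF P_linear[OF assms]] .
  from exists_orthogonal_projection[OF G_bil[OF assms] G_pos[OF assms] this, of v]
  show ?thesis using that by auto
qed

text \<open>\<open>submersion\<close> compares lengths of horizontal vectors only. Polarization
  extends this to products of the horizontal part of \<open>a\<close> with \<open>h\<close>, and the
  vertical part of \<open>a\<close> contributes to neither side.\<close>

lemma horizontal_metric:
  assumes x: "x \<in> S" and h: "\<And>l. P x l = 0 \<Longrightarrow> G x h l = 0"
  shows "H (p x) (P x a) (P x h) = G x a h"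
proof -
  note Ge = bilinear_expand[OF G_bil[OF x]] and He = bilinear_expand[OF H_bil[OF p_in[OF x]]]
  obtain k where k: "P x k = 0" "\<And>l. P x l = 0 \<Longrightarrow> G x (a - k) l = 0" using decompose[OF x] by metis
  define b where "b = a - k"
  have Pb: "P x b = P x a" using k(1) by (simp add: b_def linear_diff[OF P_linear[OF x]])
  have b: "G x b l = 0" if "P x l = 0" for l using k(2)[OF that] by (simp add: b_def)
  have "H (p x) (P x (b + h)) (P x (b + h)) = G x (b + h) (b + h)"
    by (rule submersion[OF x]) (simp add: Ge h b)
  moreover have "H (p x) (P x b) (P x b) = G x b b" by (rule submersion[OF x]) (rule b)
  moreover have "H (p x) (P x h) (P x h) = G x h h" by (rule submersion[OF x]) (rule h)
  ultimately have "H (p x) (P x b) (P x h) = G x b h"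
    using G_sym[OF x, of b h] H_sym[OF p_in[OF x], of "P x b" "P x h"]
    by (simp add: Ge He linear_add[OF P_linear[OF x]])
  moreover have "G x b h = G x a h"
    using h[OF k(1)] G_sym[OF x, of k h] by (simp add: b_def Ge)
  ultimately show ?thesis by (simp add: Pb)
qed

section \<open>Geodesics, the infinitesimal Clairaut condition and umbilicity\<close>

lemma geodesic_exists:
  assumes "x0 \<in> S"
  obtains \<delta> X V where "\<delta> > 0" "X 0 = x0" "V 0 = v" "smooth_on {-\<delta><..<\<delta>} X"
    "\<And>t. t \<in> {-\<delta><..<\<delta>} \<Longrightarrow> X t \<in> S"
    "\<And>t. t \<in> {-\<delta><..<\<delta>} \<Longrightarrow> (X has_vector_derivative V t) (at t)"
    "\<And>t. t \<in> {-\<delta><..<\<delta>} \<Longrightarrow> (V has_vector_derivative - \<Gamma> (X t) (V t) (V t)) (at t)"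
  using second_order_ode[OF open_S assms \<Gamma>_bil \<Gamma>_smooth, of v] that by blast

text \<open>Metric compatibility turns the derivative of \<open>G\<close> along the curve into
  exactly the terms that the acceleration \<open>- \<Gamma>\<close> cancels.\<close>

lemma speed_squared_deriv:
  assumes X: "(X has_vector_derivative V t) (at t)" "X t \<in> S"
    and V: "(V has_vector_derivative - \<Gamma> (X t) (V t) (V t)) (at t)"
  shows "((\<lambda>s. G (X s) (V s) (V s)) has_derivative (\<lambda>h. 0)) (at t)"
proof -
  note Ge = bilinear_expand[OF G_bil[OF X(2)]]
  \<comment> \<open>The derivative is computed for independent position and velocity first; the
    curve \<open>(X s, V s)\<close> is substituted afterwards.\<close>
  have "((\<lambda>s. G (fst s) (snd s) (snd s)) has_derivative (\<lambda>h. frechet_derivative (\<lambda>x. G x (V t) (V t)) (at (X t)) (fst h)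
       + G (X t) (V t) (snd h) + G (X t) (snd h) (V t))) (at (X t, V t))"
  proof -
    have D: "((\<lambda>s. G (fst s) a b) has_derivative (\<lambda>h. frechet_derivative (\<lambda>x. G x a b) (at (X t)) (fst h))) (at (X t, V t))" for a b
      using has_derivative_compose[OF has_derivative_fst[OF has_derivative_ident], of "\<lambda>x. G x a b" _ "(X t, V t)"]
        smooth_on_has_derivative[OF G_smooth X(2)] by simp
    show ?thesis
      using has_derivative_bilinear_family[where T = "S \<times> UNIV" and t = "(X t, V t)" and A = "\<lambda>s. G (fst s)", OF _ _ _ D
          has_derivative_snd[OF has_derivative_ident] has_derivative_snd[OF has_derivative_ident]]
      using open_S X(2) G_bil by (auto simp: open_Times)
  qed
  moreover have "((\<lambda>s. (X s, V s)) has_derivative (\<lambda>h. (h *\<^sub>R V t, h *\<^sub>R (- \<Gamma> (X t) (V t) (V t))))) (at t)"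
    using X(1) V unfolding has_vector_derivative_def by (rule has_derivative_Pair)
  ultimately have "((\<lambda>s. G (X s) (V s) (V s)) has_derivative
      (\<lambda>h. frechet_derivative (\<lambda>x. G x (V t) (V t)) (at (X t)) (h *\<^sub>R V t)
       + G (X t) (V t) (h *\<^sub>R (- \<Gamma> (X t) (V t) (V t))) + G (X t) (h *\<^sub>R (- \<Gamma> (X t) (V t) (V t))) (V t))) (at t)"
    using has_derivative_compose[of "\<lambda>s. (X s, V s)" _ t UNIV "\<lambda>s. G (fst s) (snd s) (snd s)"] by fastforce
  then show ?thesis
    by (simp add: metric_compatible[OF X(2)] Ge bilinear_expand[OF \<Gamma>_bil[OF X(2)]])
qed

text \<open>The second derivative of the image curve has a Hessian term and an acceleration term;
  the geodesic equation merges them into \<open>II\<close>.\<close>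

lemma image_velocity_deriv:
  assumes X: "(X has_vector_derivative V t) (at t)" "X t \<in> S"
    and V: "(V has_vector_derivative - \<Gamma> (X t) (V t) (V t)) (at t)"
  shows "((\<lambda>s. P (X s) (V s)) has_derivative (\<lambda>h. h *\<^sub>R II (X t) (V t) (V t))) (at t)"
proof -
  have "((\<lambda>s. P (fst s) (snd s)) has_derivative (\<lambda>h. D2 (X t) (V t) (fst h) + P (X t) (snd h))) (at (X t, V t))"
  proof -
    have D: "((\<lambda>s. P (fst s) a) has_derivative (\<lambda>h. D2 (X t) a (fst h))) (at (X t, V t))" for a
      using has_derivative_compose[OF has_derivative_fst[OF has_derivative_ident], of "\<lambda>x. P x a" _ "(X t, V t)"]
        P_has_derivative[OF X(2)] by simp
    show ?thesis
      using has_derivative_linear_family[where T = "S \<times> UNIV" and t = "(X t, V t)" and A = "\<lambda>s. P (fst s)", OF _ _ _ D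
          has_derivative_snd[OF has_derivative_ident]]
      using open_S X(2) P_linear by (auto simp: open_Times)
  qed
  moreover have "((\<lambda>s. (X s, V s)) has_derivative (\<lambda>h. (h *\<^sub>R V t, h *\<^sub>R (- \<Gamma> (X t) (V t) (V t))))) (at t)"
    using X(1) V unfolding has_vector_derivative_def by (rule has_derivative_Pair)
  ultimately have "((\<lambda>s. P (X s) (V s)) has_derivative
      (\<lambda>h. D2 (X t) (V t) (h *\<^sub>R V t) + P (X t) (h *\<^sub>R (- \<Gamma> (X t) (V t) (V t))))) (at t)"
    using has_derivative_compose[of "\<lambda>s. (X s, V s)" _ t UNIV "\<lambda>s. P (fst s) (snd s)"] by fastforce
  then show ?thesis
    using linear_cmul[OF has_derivative_linear[OF P_has_derivative[OF X(2)]]]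
    by (simp add: linear_cmul[OF P_linear[OF X(2)]] linear_neg[OF P_linear[OF X(2)]] II_def scaleR_diff_right)
qed

text \<open>The right side is the derivative at time 0 of the squared length of the image velocity
  along the geodesic with initial velocity \<open>v\<close>. Conservation of exp(2 f) times the
  squared vertical speed ties it to the derivative of \<open>f\<close>.\<close>

lemma clairaut_infinitesimal:
  assumes x: "x \<in> S"
  shows "2 * frechet_derivative f (at x) v * (G x v v - H (p x) (P x v) (P x v)) =
    frechet_derivative (\<lambda>y. H y (P x v) (P x v)) (at (p x)) (P x v) + 2 * H (p x) (II x v v) (P x v)"
\<comment> \<open>The zero vector has to be split off because the Clairaut quotient divides by the
  squared speed.\<close>
proof (cases "v = 0")
  case True
  then show ?thesis
    using linear_0[OF P_linear[OF x]] linear_0[OF smooth_on_linear_derivative[OF smooth_f x]]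
      linear_0[OF smooth_on_linear_derivative[OF H_smooth p_in[OF x]]]
    by (simp add: bilinear_expand[OF H_bil[OF p_in[OF x]]])
next
  case False
  obtain \<delta> X V where \<delta>: "\<delta> > 0" and X0: "X 0 = x" and V0: "V 0 = v" and sm: "smooth_on {-\<delta><..<\<delta>} X"
    and XS: "\<And>t. t \<in> {-\<delta><..<\<delta>} \<Longrightarrow> X t \<in> S"
    and X: "\<And>t. t \<in> {-\<delta><..<\<delta>} \<Longrightarrow> (X has_vector_derivative V t) (at t)"
    and V: "\<And>t. t \<in> {-\<delta><..<\<delta>} \<Longrightarrow> (V has_vector_derivative - \<Gamma> (X t) (V t) (V t)) (at t)"
    using geodesic_exists[OF x] by metis
  let ?I = "{-\<delta><..<\<delta>}"
  have I0: "0 \<in> ?I" using \<delta> by simp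
  define E where "E t = G (X t) (V t) (V t)" for t
  define q where "q t = H (p (X t)) (P (X t) (V t)) (P (X t) (V t))" for t
  have "\<exists>c. \<forall>t\<in>?I. E t = c"
  proof (rule has_derivative_zero_constant)
    fix t assume t: "t \<in> ?I"
    show "(E has_derivative (\<lambda>h. 0)) (at t within ?I)"
      unfolding E_def[abs_def] by (rule has_derivative_at_withinI[OF speed_squared_deriv[OF X[OF t] XS[OF t] V[OF t]]])
  qed (rule convex_real_interval)
  then have E: "E t = G x v v" if "t \<in> ?I" for t using that I0 X0 V0 by (auto simp: E_def)
  define g0 where "g0 = G x v v"
  have g0: "g0 > 0" unfolding g0_def by (rule G_pos[OF x False])
  \<comment> \<open>The horizontal part is no longer than the vector; hence the radicand is
    nonnegative and squaring undoes the root.\<close>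
  have q_le: "q t \<le> g0" if t: "t \<in> ?I" for t
  proof -
    note xt = XS[OF t]
    note Ge = bilinear_expand[OF G_bil[OF xt]]
    obtain k where k: "P (X t) k = 0" "\<And>l. P (X t) l = 0 \<Longrightarrow> G (X t) (V t - k) l = 0" using decompose[OF xt] by metis
    define b where "b = V t - k"
    have "P (X t) b = P (X t) (V t)" using k(1) by (simp add: b_def linear_diff[OF P_linear[OF xt]])
    then have "q t = G (X t) b b" using submersion[OF xt, of b] k(2) by (simp add: q_def b_def)
    moreover have "E t = G (X t) b b + G (X t) k k"
    proof -
      have "V t = b + k" by (simp add: b_def)
      then have "E t = G (X t) b b + G (X t) b k + (G (X t) k b + G (X t) k k)" by (simp add: E_def Ge)
      then show ?thesis using k(2)[OF k(1)] G_sym[OF xt, of k b] by (simp add: b_def)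
    qed
    moreover have "G (X t) k k \<ge> 0" using G_pos[OF xt, of k] by (cases "k = 0") (auto simp: Ge)
    ultimately show ?thesis using E[OF t] by (simp add: g0_def)
  qed
  have "(\<lambda>t. exp (f (X t)) * sqrt (1 - q t / E t)) constant_on ?I"
    using clair[OF \<delta> sm XS X V] by (simp add: E_def q_def)
  then obtain c where c: "\<And>t. t \<in> ?I \<Longrightarrow> exp (f (X t)) * sqrt (1 - q t / E t) = c"
    by (auto simp: constant_on_def)
  \<comment> \<open>Squaring avoids differentiating the root, which fails where the geodesic is
    horizontal and the radicand vanishes.\<close>
  have conserved: "exp (2 * f (X t)) * (g0 - q t) = c\<^sup>2 * g0" if t: "t \<in> ?I" for t
  proof -
    have "0 \<le> 1 - q t / g0" using q_le[OF t] g0 by simp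
    then have "(exp (f (X t)) * sqrt (1 - q t / g0))\<^sup>2 = exp (2 * f (X t)) * (1 - q t / g0)"
      by (simp add: power_mult_distrib exp_double)
    then have "c\<^sup>2 = exp (2 * f (X t)) * (1 - q t / g0)" using c[OF t] E[OF t] by (simp add: g0_def)
    moreover have "1 - q t / g0 = (g0 - q t) / g0" using g0 by (simp add: diff_divide_distrib)
    ultimately show ?thesis using g0 by simp
  qed
  note X1 = X[OF I0, unfolded has_vector_derivative_def X0 V0]
  have dp: "((\<lambda>s. p (X s)) has_derivative (\<lambda>h. P x (h *\<^sub>R v))) (at 0)"
    using has_derivative_compose[OF X1, of p "P x"] smooth_on_has_derivative[OF smooth_p x] X0 by simp
  have dq: "(q has_derivative (\<lambda>h. h * (frechet_derivative (\<lambda>y. H y (P x v) (P x v)) (at (p x)) (P x v)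
      + 2 * H (p x) (II x v v) (P x v)))) (at 0)"
  proof -
    have A: "((\<lambda>s. H (p (X s)) a b) has_derivative
        (\<lambda>h. frechet_derivative (\<lambda>y. H y a b) (at (p x)) (P x (h *\<^sub>R v)))) (at 0)" for a b
      using has_derivative_compose[OF dp, of "\<lambda>y. H y a b"]
        smooth_on_has_derivative[OF H_smooth p_in[OF x], of a b] X0 by simp
    note W = image_velocity_deriv[OF X[OF I0] XS[OF I0] V[OF I0], unfolded X0 V0]
    have "(q has_derivative (\<lambda>h. frechet_derivative (\<lambda>y. H y (P x v) (P x v)) (at (p x)) (P x (h *\<^sub>R v))
        + H (p x) (P x v) (h *\<^sub>R II x v v) + H (p x) (h *\<^sub>R II x v v) (P x v))) (at 0)"
      unfolding q_def[abs_def]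
      using has_derivative_bilinear_family[OF open_greaterThanLessThan I0 H_bil[OF p_in[OF XS]] A W W]
      by (simp add: X0 V0)
    then show ?thesis
      using H_sym[OF p_in[OF x], of "P x v" "II x v v"]
      by (simp add: bilinear_expand[OF H_bil[OF p_in[OF x]]] linear_cmul[OF P_linear[OF x]]
            linear_cmul[OF smooth_on_linear_derivative[OF H_smooth p_in[OF x]]] algebra_simps)
  qed
  have df: "((\<lambda>s. f (X s)) has_derivative (\<lambda>h. h * frechet_derivative f (at x) v)) (at 0)"
    using has_derivative_compose[OF X1, of f "frechet_derivative f (at x)"]
      smooth_on_has_derivative[OF smooth_f x] X0
    by (simp add: linear_cmul[OF smooth_on_linear_derivative[OF smooth_f x]])
  define Q where "Q = frechet_derivative (\<lambda>y. H y (P x v) (P x v)) (at (p x)) (P x v)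
      + 2 * H (p x) (II x v v) (P x v)"
  have "((\<lambda>t. exp (2 * f (X t)) * (g0 - q t)) has_derivative
      (\<lambda>h. exp (2 * f x) * (h * (2 * frechet_derivative f (at x) v * (g0 - q 0) - Q)))) (at 0)"
    using df dq[folded Q_def] by (auto intro!: derivative_eq_intros simp: X0 algebra_simps)
  moreover have "((\<lambda>t. exp (2 * f (X t)) * (g0 - q t)) has_derivative (\<lambda>h. 0)) (at 0)"
    by (rule has_derivative_transform_within_open[OF has_derivative_const[of "c\<^sup>2 * g0"] open_greaterThanLessThan I0])
       (simp add: conserved)
  ultimately have "(\<lambda>h. exp (2 * f x) * (h * (2 * frechet_derivative f (at x) v * (g0 - q 0) - Q))) = (\<lambda>h::real. 0)"
    by (rule has_derivative_unique)
  from fun_cong[OF this, of 1] show ?thesis by (simp add: Q_def g0_def q_def X0 V0)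
qed

text \<open>The vectors \<open>u + h\<close>, \<open>h - u\<close> and \<open>h\<close> have the
  same image, so the derivative of \<open>H\<close> is the same in all three identities. Adding the
  first two removes the mixed term \<open>II x u h\<close> and the derivative of \<open>f\<close>
  along \<open>u\<close>; subtracting twice the third removes the derivative of \<open>H\<close> and
  \<open>II x h h\<close>.\<close>

lemma umbilical:
  assumes x: "x \<in> S" and u: "P x u = 0" and h: "\<And>l. P x l = 0 \<Longrightarrow> G x h l = 0"
  shows "H (p x) (II x u u) (P x h) = G x u u * frechet_derivative f (at x) h"
proof -
  note Ge = bilinear_expand[OF G_bil[OF x]] and He = bilinear_expand[OF H_bil[OF p_in[OF x]]]
    and IIe = bilinear_expand[OF II_bilinear[OF x]]
    and lP = P_linear[OF x] and lf = smooth_on_linear_derivative[OF smooth_f x]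
  have Gu: "G x u h = 0" "G x h u = 0" using h[OF u] G_sym[OF x] by auto
  have Hh: "H (p x) (P x h) (P x h) = G x h h" by (rule horizontal_metric[OF x h])
  have 1: "P x (u + h) = P x h" "P x (h - u) = P x h" using u by (simp_all add: linear_add[OF lP] linear_diff[OF lP])
  show ?thesis
    using clairaut_infinitesimal[OF x, of "u + h"] clairaut_infinitesimal[OF x, of "h - u"]
      clairaut_infinitesimal[OF x, of h] II_sym[OF x, of u h]
    by (simp add: 1 Hh Ge Gu IIe He linear_add[OF lf] linear_diff[OF lf]) (simp add: algebra_simps)
qed

lemma umbilical_polarized:
  assumes x: "x \<in> S" and u: "P x u = 0" and w: "P x w = 0" and h: "\<And>l. P x l = 0 \<Longrightarrow> G x h l = 0"
  shows "H (p x) (II x u w) (P x h) = G x u w * frechet_derivative f (at x) h"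
proof -
  note Ge = bilinear_expand[OF G_bil[OF x]] and He = bilinear_expand[OF H_bil[OF p_in[OF x]]]
    and IIe = bilinear_expand[OF II_bilinear[OF x]]
  have uw: "P x (u + w) = 0" using u w by (simp add: linear_add[OF P_linear[OF x]])
  show ?thesis
    using umbilical[OF x u h] umbilical[OF x w h] umbilical[OF x uw h] II_sym[OF x, of u w] G_sym[OF x, of u w]
    by (simp add: Ge He IIe algebra_simps)
qed

text \<open>The map \<open>\<Psi> y = y + L (p y - p x - P x (y - x))\<close>, with \<open>L\<close> a right inverse of
  \<open>P x\<close>, has the identity as derivative at \<open>x\<close> and turns \<open>p\<close> into an affine map:
  \<open>P x (\<Psi> y) = P x x + p y - p x\<close>.\<close>

lemma straightening:
  assumes x: "x \<in> S"
  obtains U A W \<gamma> where "open U" "x \<in> U" "U \<subseteq> S"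
    "\<And>y. y \<in> U \<Longrightarrow> linear (A y)" "\<And>v. A x v = v"
    "\<And>y v. y \<in> U \<Longrightarrow> P x (A y v) = P y v"
    "\<And>y. y \<in> U \<Longrightarrow> bij (A y)"
    "\<And>v. (\<lambda>y. A y v) differentiable (at x)"
    "open W" "x \<in> W" "\<And>z. z \<in> W \<Longrightarrow> \<gamma> z \<in> U" "\<gamma> x = x" "(\<gamma> has_derivative (\<lambda>h. h)) (at x)"
    "\<And>z. z \<in> W \<Longrightarrow> p (\<gamma> z) = p x + P x (z - x)"
proof -
  note lP = P_linear[OF x]
  obtain L where L: "linear L" "P x \<circ> L = id"
    using linear_surjective_right_inverse[OF lP surj_p[OF x]] by blast
  have PL: "P x (L c) = c" for c using L(2) by (metis comp_apply id_apply)
  define \<Psi> where "\<Psi> y = y + L (p y - p x - P x (y - x))" for y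
  define A where "A y v = v + L (P y v - P x v)" for y v
  have lA: "linear (A y)" if "y \<in> S" for y
    unfolding A_def[abs_def] using linear_compose[OF linear_compose_sub[OF P_linear[OF that] lP] L(1)]
    by (intro linear_compose_add linear_ident) (simp add: o_def)
  have bL: "bounded_linear L" using L(1) by (simp add: linear_conv_bounded_linear)
  have d\<Psi>: "(\<Psi> has_derivative A y) (at y)" if "y \<in> S" for y
  proof -
    have bP: "bounded_linear (P x)" using lP by (simp add: linear_conv_bounded_linear)
    have "((\<lambda>y. p y - p x - P x (y - x)) has_derivative (\<lambda>v. P y v - 0 - P x (v - 0))) (at y)"
      by (intro has_derivative_diff smooth_on_has_derivative[OF smooth_p that] has_derivative_const
            bounded_linear.has_derivative[OF bP] has_derivative_ident)
    then show ?thesis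
      unfolding \<Psi>_def[abs_def] A_def[abs_def]
      using has_derivative_add[OF has_derivative_ident bounded_linear.has_derivative[OF bL]] by force
  qed
  have cP: "continuous_on S (\<lambda>y. P y v)" for v
    by (intro smooth_on_imp_continuous_on smooth_on_frechet_derivative smooth_p)
  \<comment> \<open>The inverse function theorem wants the derivative as a continuous map into the
    bounded linear maps. Outside \<open>S\<close>, where \<open>A y\<close> need not be linear, the
    value is irrelevant.\<close>
  define A' where "A' y = Blinfun (A y)" for y
  have A': "blinfun_apply (A' y) = A y" if "y \<in> S" for y
    unfolding A'_def using lA[OF that] by (simp add: bounded_linear_Blinfun_apply linear_conv_bounded_linear)
  have cA: "continuous_on S A'"
  proof (rule continuous_on_blinfun_componentwise)
    fix i :: 'e
    have "continuous_on S (\<lambda>y. A y i)"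
      unfolding A_def by (intro continuous_intros cP linear_continuous_on_compose[OF _ L(1)])
    then show "continuous_on S (\<lambda>y. blinfun_apply (A' y) i)"
      using A' by (simp cong: continuous_on_cong)
  qed
  have Ax: "A x v = v" for v by (simp add: A_def linear_0[OF L(1)])
  have inv: "id_blinfun o\<^sub>L A' x = id_blinfun"
    by (rule blinfun_eqI) (simp add: A'[OF x] Ax)
  obtain U W g g' where U: "open U" "U \<subseteq> S" "x \<in> U" "open W" "\<Psi> x \<in> W" "homeomorphism U W \<Psi> g"
    "\<And>y. y \<in> W \<Longrightarrow> (g has_derivative (g' y)) (at y)"
    "\<And>y. y \<in> W \<Longrightarrow> g' y = Hilbert_Choice.inv (blinfun_apply (A' (g y)))"
    "\<And>y. y \<in> W \<Longrightarrow> bij (blinfun_apply (A' (g y)))"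
    by (rule inverse_function_theorem[OF open_S _ cA x inv, of \<Psi>]) (use d\<Psi> A' in auto)
  have \<Psi>x: "\<Psi> x = x" by (simp add: \<Psi>_def linear_0[OF L(1)] linear_0[OF lP])
  have gW: "g z \<in> U" "\<Psi> (g z) = z" if "z \<in> W" for z
    using U(6) that by (auto simp: homeomorphism_def)
  have gU: "g (\<Psi> y) = y" "\<Psi> y \<in> W" if "y \<in> U" for y
    using U(6) that by (auto simp: homeomorphism_def)
  have gx: "g x = x" using gU(1)[OF U(3)] \<Psi>x by simp
  show thesis
  proof (rule that[of U A W g])
    show "P x (A y v) = P y v" if "y \<in> U" for y v
      by (simp add: A_def linear_add[OF lP] PL)
    show "bij (A y)" if "y \<in> U" for y
      using U(9)[OF gU(2)[OF that]] gU(1)[OF that] A' U(2) that by auto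
    show "(\<lambda>y. A y v) differentiable (at x)" for v
    proof (rule differentiableI)
      show "((\<lambda>y. A y v) has_derivative (\<lambda>h. 0 + L (D2 x v h - 0))) (at x)"
        unfolding A_def
        by (rule has_derivative_add[OF has_derivative_const bounded_linear.has_derivative[OF bL
              has_derivative_diff[OF P_has_derivative[OF x] has_derivative_const]]])
    qed
    have "(g has_derivative Hilbert_Choice.inv (A x)) (at x)"
      using U(7)[OF U(5)] U(8)[OF U(5)] \<Psi>x gx A'[OF x] by simp
    moreover have "Hilbert_Choice.inv (A x) = (\<lambda>h. h)"
      using Ax by (intro inv_equality) auto
    ultimately show "(g has_derivative (\<lambda>h. h)) (at x)" by simp
    show "p (g z) = p x + P x (z - x)" if "z \<in> W" for z
    proof -
      have "P x (\<Psi> (g z)) = P x (g z) + (p (g z) - p x - P x (g z - x))"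
        unfolding \<Psi>_def by (simp add: linear_add[OF lP] PL)
      then show ?thesis using gW(2)[OF that] by (simp add: linear_diff[OF lP] algebra_simps)
    qed
  qed (use U lA Ax gW gx \<Psi>x in auto)
qed

text \<open>The field \<open>inv (A y) u\<close> is the pullback of the constant field
  \<open>u\<close> under the straightening map, whose derivative is \<open>A y\<close>. It is
  vertical because \<open>P y\<close> equals \<open>P x\<close> after \<open>A y\<close> and
  \<open>u\<close> is vertical at \<open>x\<close>.\<close>

lemma vertical_extension:
  assumes x: "x \<in> S" and u: "P x u = 0"
  obtains U V DV where "open U" "x \<in> U" "U \<subseteq> S" "V x = u" "(V has_derivative DV) (at x)"
    "\<And>y. y \<in> U \<Longrightarrow> P y (V y) = 0"
proof -
  obtain U A W \<gamma> where U: "open U" "x \<in> U" "U \<subseteq> S"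
    "\<And>y. y \<in> U \<Longrightarrow> linear (A y)" "\<And>v. A x v = v"
    "\<And>y v. y \<in> U \<Longrightarrow> P x (A y v) = P y v"
    "\<And>y. y \<in> U \<Longrightarrow> bij (A y)"
    and dA: "\<And>v. (\<lambda>y. A y v) differentiable (at x)"
    "open W" "x \<in> W" "\<And>z. z \<in> W \<Longrightarrow> \<gamma> z \<in> U" "\<gamma> x = x" "(\<gamma> has_derivative (\<lambda>h. h)) (at x)"
    "\<And>z. z \<in> W \<Longrightarrow> p (\<gamma> z) = p x + P x (z - x)"
    by (rule straightening[OF x], rule that)
  define V where "V y = inv (A y) u" for y
  have V: "A y (V y) = u" if "y \<in> U" for y
    unfolding V_def using U(7)[OF that] by (simp add: bij_is_surj surj_f_inv_f)
  have dA': "((\<lambda>y. A y v) has_derivative (\<lambda>h. frechet_derivative (\<lambda>y. A y v) (at x) h)) (at x)" for v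
    using dA by (simp add: frechet_derivative_works)
  have "(V has_derivative (\<lambda>h. - frechet_derivative (\<lambda>y. A y u) (at x) h)) (at x)"
    by (rule has_derivative_linear_family_inverse[OF U(1,2,4,5) dA' V])
  moreover have "P y (V y) = 0" if "y \<in> U" for y
    using U(6)[OF that, of "V y"] V[OF that] u by simp
  moreover have "V x = u" using V[OF U(2)] U(5) by simp
  ultimately show thesis using that U(1-3) by blast
qed

text \<open>\<open>\<Gamma> x h (V x) + DV h\<close> is the covariant derivative of \<open>V\<close>
  along \<open>h\<close>. Differentiating \<open>P y (V y) = 0\<close> trades
  \<open>P x (DV h)\<close> for a second derivative of \<open>p\<close>.\<close>

lemma vertical_extension_derivative:
  assumes x: "x \<in> S" and U: "open U" "x \<in> U" "U \<subseteq> S" and V: "(V has_derivative DV) (at x)"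
    and vert: "\<And>y. y \<in> U \<Longrightarrow> P y (V y) = 0"
  shows "P x (\<Gamma> x h (V x) + DV h) = - II x h (V x)"
proof -
  have "((\<lambda>y. P y (V y)) has_derivative (\<lambda>h. D2 x (V x) h + P x (DV h))) (at x)"
    by (rule has_derivative_linear_family[OF U(1,2) _ P_has_derivative[OF x] V]) (use P_linear U(3) in auto)
  moreover have "((\<lambda>y. P y (V y)) has_derivative (\<lambda>h. 0)) (at x)"
    by (rule has_derivative_transform_within_open[OF has_derivative_const U(1,2)]) (simp add: vert)
  ultimately have "(\<lambda>h. D2 x (V x) h + P x (DV h)) = (\<lambda>h. 0)" by (rule has_derivative_unique)
  from fun_cong[OF this, of h] show ?thesis
    by (simp add: II_def linear_add[OF P_linear[OF x]] D2_sym[OF x, of h] algebra_simps eq_neg_iff_add_eq_0)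
qed

lemma nearly_kaehler_identity:
  assumes x: "x \<in> S" and u: "P x u = 0" and w: "P x w = 0"
  shows "H (p x) (II x u u) (P x (J x w)) = H (p x) (II x u w) (P x (J x u))"
proof -
  obtain U1 V1 E1 where 1: "open U1" "x \<in> U1" "U1 \<subseteq> S" "V1 x = u" "(V1 has_derivative E1) (at x)"
    "\<And>y. y \<in> U1 \<Longrightarrow> P y (V1 y) = 0" using vertical_extension[OF x u] by metis
  obtain U2 V2 E2 where 2: "open U2" "x \<in> U2" "U2 \<subseteq> S" "V2 x = w" "(V2 has_derivative E2) (at x)"
    "\<And>y. y \<in> U2 \<Longrightarrow> P y (V2 y) = 0" using vertical_extension[OF x w] by metis
  note Ge = bilinear_expand[OF G_bil[OF x]] and He = bilinear_expand[OF H_bil[OF p_in[OF x]]]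
  \<comment> \<open>The fundamental 2-form of the almost Hermitian structure; anti-invariance says
    that it vanishes on pairs of vertical vectors.\<close>
  define \<omega> where "\<omega> y a b = G y (J y a) b" for y a b
  have bil: "bilinear (\<omega> y)" if "y \<in> S" for y
    unfolding bilinear_def \<omega>_def
    using bilinear_linear[OF G_bil[OF that]] linear_compose[OF J_lin[OF that] bilinear_linear(2)[OF G_bil[OF that]]]
    by (simp add: o_def)
  have sm: "smooth_on S (\<lambda>y. \<omega> y a b)" for a b
    unfolding \<omega>_def
    by (rule smooth_on_bilinear_family[OF open_S open_S G_bil G_smooth smooth_on_ident[OF open_S] _ J_smooth smooth_on_const])
       auto
  have "((\<lambda>y. \<omega> y (V1 y) (V2 y)) has_derivative (\<lambda>h. frechet_derivative (\<lambda>y. \<omega> y (V1 x) (V2 x)) (at x) h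
      + \<omega> x (V1 x) (E2 h) + \<omega> x (E1 h) (V2 x))) (at x)"
    by (rule has_derivative_bilinear_family[OF open_S x bil smooth_on_has_derivative[OF sm x] 1(5) 2(5)])
  moreover have "((\<lambda>y. \<omega> y (V1 y) (V2 y)) has_derivative (\<lambda>h. 0)) (at x)"
  proof (rule has_derivative_transform_within_open[OF has_derivative_const])
    show "open (U1 \<inter> U2)" "x \<in> U1 \<inter> U2" using 1 2 by auto
    show "0 = \<omega> y (V1 y) (V2 y)" if "y \<in> U1 \<inter> U2" for y
      using that 1(3) anti_inv[of y "V1 y" "V2 y"] 1(6) 2(6) by (auto simp: \<omega>_def)
  qed
  ultimately have "(\<lambda>h. frechet_derivative (\<lambda>y. \<omega> y (V1 x) (V2 x)) (at x) h
      + \<omega> x (V1 x) (E2 h) + \<omega> x (E1 h) (V2 x)) = (\<lambda>h. 0)" by (rule has_derivative_unique)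
  \<comment> \<open>The direction has to be \<open>u\<close>, since \<open>nearly_k\<close> controls
    the derivative of \<open>J\<close> only when it is applied to the direction of
    differentiation.\<close>
  from fun_cong[OF this, of u]
  have "G x (J x (\<Gamma> x u u)) w + G x (J x u) (\<Gamma> x u w) + G x (J x u) (E2 u) + G x (J x (E1 u)) w = 0"
    using nearly_k[OF x, of u w] by (simp add: 1 2 \<omega>_def)
  then have eq: "G x (J x (\<Gamma> x u u + E1 u)) w + G x (J x u) (\<Gamma> x u w + E2 u) = 0"
    by (simp add: linear_add[OF J_lin[OF x]] Ge)
  \<comment> \<open>\<open>J\<close> is skew because it is an isometry whose square is minus the
    identity; this moves it onto the vertical vector \<open>w\<close>, whose image is
    horizontal.\<close>
  have GJ: "G x (J x a) b = - G x a (J x b)" for a b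
    using J_isometry[OF x, of "J x a" b] J_J[OF x] by (simp add: Ge)
  have hor: "G x (J x k) l = 0" if "P x k = 0" "P x l = 0" for k l
    by (rule anti_inv[OF x that])
  have "G x (J x (\<Gamma> x u u + E1 u)) w = - H (p x) (P x (\<Gamma> x u u + E1 u)) (P x (J x w))"
    unfolding GJ using horizontal_metric[OF x hor[OF w]] by simp
  also have "\<dots> = H (p x) (II x u u) (P x (J x w))"
    using vertical_extension_derivative[OF x 1(1-3,5,6), of u] by (simp add: 1(4) He)
  finally have e1: "G x (J x (\<Gamma> x u u + E1 u)) w = H (p x) (II x u u) (P x (J x w))" .
  have "G x (J x u) (\<Gamma> x u w + E2 u) = H (p x) (P x (\<Gamma> x u w + E2 u)) (P x (J x u))"
    using horizontal_metric[OF x hor[OF u]] G_sym[OF x] by simp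
  also have "\<dots> = - H (p x) (II x u w) (P x (J x u))"
    using vertical_extension_derivative[OF x 2(1-3,5,6), of u] by (simp add: 2(4) He)
  finally show ?thesis using e1 eq by simp
qed

section \<open>Vanishing of the second fundamental form on fibres\<close>

lemma gradient_vanishes:
  assumes x: "x \<in> S" and w: "P x w = 0" and u: "P x u = 0" "u \<noteq> 0" "G x u w = 0"
  shows "frechet_derivative f (at x) (J x w) = 0"
proof -
  have "G x u u * frechet_derivative f (at x) (J x w) = G x u w * frechet_derivative f (at x) (J x u)"
    using nearly_kaehler_identity[OF x u(1) w] umbilical_polarized[OF x u(1) u(1), of "J x w"]
      umbilical_polarized[OF x u(1) w, of "J x u"] anti_inv[OF x] w u(1) by simp
  then show ?thesis using G_pos[OF x u(2)] u(3) by simp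
qed

lemma exists_vertical_orthogonal:
  assumes x: "x \<in> S" and dim: "dim {k. P x k = 0} \<ge> 2"
  obtains u where "P x u = 0" "u \<noteq> 0" "G x u w = 0"
proof -
  note Ge = bilinear_expand[OF G_bil[OF x]]
  have sub: "subspace {k. P x k = 0}" using linear_subspace_kernel[OF P_linear[OF x]] .
  obtain B where B: "B \<subseteq> {k. P x k = 0}" "independent B" "card B = dim {k. P x k = 0}"
    using basis_exists by metis
  have "\<not> B \<subseteq> {b}" for b using B(3) dim card_mono[of "{b}" B] by force
  then obtain a b where ab: "a \<in> B" "b \<in> B" "a \<noteq> b" by blast
  show thesis
  proof (cases "G x a w = 0")
    case True
    then show ?thesis using that[of a] ab B(1,2) dependent_zero by blast
  next
    case False
    \<comment> \<open>The combination of \<open>a\<close> and \<open>b\<close> whose pairing with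
      \<open>w\<close> cancels. Its coefficient at \<open>b\<close> is nonzero in this case, so
      independence gives \<open>u \<noteq> 0\<close>.\<close>
    define u where "u = G x a w *\<^sub>R b - G x b w *\<^sub>R a"
    have "u \<noteq> 0"
    proof
      assume "u = 0"
      then have "b = (G x b w / G x a w) *\<^sub>R a" using False by (simp add: u_def field_simps)
         (metis divide_inverse mult.commute scaleR_scaleR scaleR_one left_inverse)
      moreover have "a \<in> span (B - {b})" using ab by (intro span_base) auto
      ultimately have "b \<in> span (B - {b})" by (metis span_scale)
      then show False using B(2) ab(2) by (auto simp: dependent_def)
    qed
    moreover have "P x u = 0"
    proof -
      have "P x a = 0" "P x b = 0" using ab B(1) by blast+
      then show ?thesis by (simp add: u_def linear_diff[OF P_linear[OF x]] linear_cmul[OF P_linear[OF x]])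
    qed
    moreover have "G x u w = 0" by (simp add: u_def Ge)
    ultimately show ?thesis using that by blast
  qed
qed

text \<open>Let \<open>b\<close> be the horizontal lift of \<open>II x u w\<close>. Its product with
  \<open>J x l\<close>, for vertical \<open>l\<close>, is \<open>G x u w\<close> times the
  derivative of \<open>f\<close> along \<open>J x l\<close>, hence 0. So \<open>b\<close> lies in
  the complement \<open>\<mu>\<close> of the \<open>J\<close>-image of the vertical space, which is
  trivial for a Lagrangian submersion.\<close>

lemma II_vertical_eq_0:
  assumes x: "x \<in> S" and dim: "dim {k. P x k = 0} \<ge> 2" and u: "P x u = 0" and w: "P x w = 0"
  shows "II x u w = 0"
proof -
  obtain a where a: "P x a = II x u w" using surj_p[OF x] by (metis surjD)
  obtain k where k: "P x k = 0" "\<And>l. P x l = 0 \<Longrightarrow> G x (a - k) l = 0" using decompose[OF x] by metis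
  define b where "b = a - k"
  have Pb: "P x b = II x u w" using k(1) a by (simp add: b_def linear_diff[OF P_linear[OF x]])
  have "b = 0"
  proof (rule lagr[OF x])
    show "G x b l = 0" if "P x l = 0" for l using k(2)[OF that] by (simp add: b_def)
    show "G x b (J x l) = 0" if l: "P x l = 0" for l
    proof -
      obtain u' where u': "P x u' = 0" "u' \<noteq> 0" "G x u' l = 0" using exists_vertical_orthogonal[OF x dim] by metis
      have "frechet_derivative f (at x) (J x l) = 0" by (rule gradient_vanishes[OF x l u'])
      then have "H (p x) (II x u w) (P x (J x l)) = 0"
        using umbilical_polarized[OF x u w, of "J x l"] anti_inv[OF x l] by simp
      then show ?thesis using horizontal_metric[OF x anti_inv[OF x l], of b] Pb by simp
    qed
  qed
  then show ?thesis using Pb linear_0[OF P_linear[OF x]] by simp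
qed

text \<open>\<open>Y\<close> is vertical only on the fibre through \<open>x\<close>, so
  \<open>P y (Y y)\<close> is known to vanish only there. The curve
  \<open>\<gamma> (x + t *\<^sub>R u)\<close> starts at \<open>x\<close> with velocity
  \<open>u\<close> and stays in the fibre because \<open>P x u = 0\<close>; differentiating along it
  gives the claim up to \<open>II x u (Y x)\<close>, which is 0.\<close>

lemma totally_geodesic:
  assumes x: "x \<in> S" and dim: "dim {k. P x k = 0} \<ge> 2" and u: "P x u = 0"
    and U: "open U" "x \<in> U" and Y: "(Y has_derivative DY) (at x)"
    and vert: "\<And>y. \<lbrakk>y \<in> U; y \<in> S; p y = p x\<rbrakk> \<Longrightarrow> P y (Y y) = 0"
  shows "P x (DY u + \<Gamma> x u (Y x)) = 0"
proof -
  obtain U' A W \<gamma> where U': "open U'" "x \<in> U'" "U' \<subseteq> S"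
    "\<And>y. y \<in> U' \<Longrightarrow> linear (A y)" "\<And>v. A x v = v"
    "\<And>y v. y \<in> U' \<Longrightarrow> P x (A y v) = P y v"
    "\<And>y. y \<in> U' \<Longrightarrow> bij (A y)"
    "\<And>v. (\<lambda>y. A y v) differentiable (at x)"
    and W: "open W" "x \<in> W" "\<And>z. z \<in> W \<Longrightarrow> \<gamma> z \<in> U'" "\<gamma> x = x" "(\<gamma> has_derivative (\<lambda>h. h)) (at x)"
    "\<And>z. z \<in> W \<Longrightarrow> p (\<gamma> z) = p x + P x (z - x)"
    by (rule straightening[OF x], rule that)
  have \<gamma>S: "\<gamma> z \<in> S" if "z \<in> W" for z using U'(3) W(3)[OF that] by blast
  have "((\<lambda>t::real. x + t *\<^sub>R u) has_derivative (\<lambda>h. h *\<^sub>R u)) (at 0)"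
    by (auto intro!: derivative_eq_intros)
  then have dc: "((\<lambda>t::real. \<gamma> (x + t *\<^sub>R u)) has_derivative (\<lambda>h. h *\<^sub>R u)) (at 0)"
    using has_derivative_compose[of "\<lambda>t. x + t *\<^sub>R u" "\<lambda>h. h *\<^sub>R u" 0 UNIV \<gamma> "\<lambda>h. h"] W(5) by simp
  have "((\<lambda>y. P y (Y y)) has_derivative (\<lambda>h. D2 x (Y x) h + P x (DY h))) (at x)"
    by (rule has_derivative_linear_family[OF open_S x P_linear P_has_derivative[OF x] Y])
  with dc have 1: "((\<lambda>t::real. P (\<gamma> (x + t *\<^sub>R u)) (Y (\<gamma> (x + t *\<^sub>R u)))) has_derivative
      (\<lambda>h. D2 x (Y x) (h *\<^sub>R u) + P x (DY (h *\<^sub>R u)))) (at 0)"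
    using has_derivative_compose[of "\<lambda>t. \<gamma> (x + t *\<^sub>R u)" "\<lambda>h. h *\<^sub>R u" 0 UNIV "\<lambda>y. P y (Y y)"] W(4) by simp
  have "continuous (at x) \<gamma>" using W(5) by (rule has_derivative_continuous)
  then obtain W' where W': "open W'" "x \<in> W'" "\<And>z. z \<in> W' \<Longrightarrow> \<gamma> z \<in> U"
    using U W(4) by (metis continuous_at_open)
  \<comment> \<open>Times at which the curve is defined and inside \<open>U\<close>, so that
    \<open>vert\<close> applies to its points.\<close>
  define N where "N = (\<lambda>t::real. x + t *\<^sub>R u) -` (W \<inter> W')"
  have N: "open N" "0 \<in> N"
    unfolding N_def using W W' by (auto intro!: open_vimage continuous_intros)
  have "((\<lambda>t::real. P (\<gamma> (x + t *\<^sub>R u)) (Y (\<gamma> (x + t *\<^sub>R u)))) has_derivative (\<lambda>h. 0)) (at 0)"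
  proof (rule has_derivative_transform_within_open[OF has_derivative_const N])
    fix t assume "t \<in> N"
    then have z: "x + t *\<^sub>R u \<in> W" "x + t *\<^sub>R u \<in> W'" by (auto simp: N_def)
    have "p (\<gamma> (x + t *\<^sub>R u)) = p x"
      using W(6)[OF z(1)] u by (simp add: linear_cmul[OF P_linear[OF x]])
    then show "0 = P (\<gamma> (x + t *\<^sub>R u)) (Y (\<gamma> (x + t *\<^sub>R u)))"
      using vert \<gamma>S[OF z(1)] W'(3)[OF z(2)] by simp
  qed
  from has_derivative_unique[OF 1 this] have "D2 x (Y x) (1 *\<^sub>R u) + P x (DY (1 *\<^sub>R u)) = 0" by metis
  moreover have "P x (Y x) = 0" by (rule vert[OF U(2) x refl])
  then have "D2 x u (Y x) = P x (\<Gamma> x u (Y x))"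
    using II_vertical_eq_0[OF x dim u] by (simp add: II_def)
  ultimately show ?thesis
    using D2_sym[OF x, of u "Y x"] by (simp add: linear_add[OF P_linear[OF x]] add.commute)
qed

end

section \<open>Charts, connections and geodesics\<close>

lemma chart_inv_snd: "\<lbrakk>is_chart c; q \<in> fst c\<rbrakk> \<Longrightarrow> chart_inv c (snd c q) = q"
  unfolding is_chart_def homeomorphism_def by blast

lemma chart_inv_in: "x \<in> snd c ` fst c \<Longrightarrow> chart_inv c x \<in> fst c"
  unfolding chart_inv_def by (rule inv_into_into)

lemma snd_chart_inv: "x \<in> snd c ` fst c \<Longrightarrow> snd c (chart_inv c x) = x"
  unfolding chart_inv_def by (rule f_inv_into_f)

lemma continuous_on_chart_inv: "is_chart c \<Longrightarrow> continuous_on (snd c ` fst c) (chart_inv c)"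
  unfolding is_chart_def homeomorphism_def by blast

lemma open_chart_domain: "is_chart c \<Longrightarrow> open (fst c)" and open_chart_range: "is_chart c \<Longrightarrow> open (snd c ` fst c)"
  unfolding is_chart_def by blast+

lemma chart_image_Int:
  assumes "is_chart c"
  shows "snd c ` (fst c \<inter> U) = snd c ` fst c \<inter> chart_inv c -` U"
proof (intro set_eqI iffI)
  fix x assume "x \<in> snd c ` (fst c \<inter> U)"
  then show "x \<in> snd c ` fst c \<inter> chart_inv c -` U" using chart_inv_snd[OF assms] by auto
next
  fix x assume x: "x \<in> snd c ` fst c \<inter> chart_inv c -` U"
  then have "x = snd c (chart_inv c x)" "chart_inv c x \<in> fst c \<inter> U"
    using snd_chart_inv[of x c] chart_inv_in[of x c] by auto
  then show "x \<in> snd c ` (fst c \<inter> U)" by blast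
qed

lemma open_chart_image:
  assumes "is_chart c" and "open U"
  shows "open (snd c ` (fst c \<inter> U))"
  unfolding chart_image_Int[OF assms(1)]
  by (rule continuous_open_preimage[OF continuous_on_chart_inv open_chart_range]) (use assms in auto)

definition jacobian :: "('a, 'e::euclidean_space) chart \<Rightarrow> ('a, 'e) chart \<Rightarrow> 'a \<Rightarrow> 'e \<Rightarrow> 'e"
  where "jacobian c d q = frechet_derivative (snd d \<circ> chart_inv c) (at (snd c q))"

lemma coord_field_apply:
  "coord_field A c u q d = (if d \<in> charts_at A q then jacobian c d q u else 0)"
  by (simp add: coord_field_def jacobian_def)

locale atlas =
  fixes A :: "('a::{t2_space, second_countable_topology}, 'e::euclidean_space) chart set"
  assumes smooth_manifold: "smooth_manifold A"
begin

lemma is_chart: "c \<in> A \<Longrightarrow> is_chart c"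
  using smooth_manifold by (simp add: smooth_manifold_def)

lemma charts_atD: "c \<in> charts_at A q \<Longrightarrow> c \<in> A" "c \<in> charts_at A q \<Longrightarrow> q \<in> fst c"
  by (simp_all add: charts_at_def)

lemma charts_at_is_chart: "c \<in> charts_at A q \<Longrightarrow> is_chart c"
  using is_chart charts_atD by blast

lemma charts_at_carrier: "c \<in> charts_at A q \<Longrightarrow> q \<in> carrier A"
  by (auto simp: charts_at_def carrier_def)

lemma chart_at_in: "q \<in> carrier A \<Longrightarrow> chart_at A q \<in> charts_at A q"
  unfolding chart_at_def by (rule someI_ex) (auto simp: charts_at_def carrier_def)

lemma transition_smooth:
  "\<lbrakk>c \<in> A; d \<in> A\<rbrakk> \<Longrightarrow> smooth_on (snd c ` (fst c \<inter> fst d)) (snd d \<circ> chart_inv c)"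
  using smooth_manifold by (simp add: smooth_manifold_def)

lemma transition_has_derivative:
  assumes "c \<in> charts_at A q" "d \<in> charts_at A q"
  shows "((snd d \<circ> chart_inv c) has_derivative jacobian c d q) (at (snd c q))"
  unfolding jacobian_def
  by (rule smooth_on_has_derivative[OF transition_smooth]) (use assms in \<open>auto simp: charts_at_def\<close>)

lemma jacobian_linear:
  "\<lbrakk>c \<in> charts_at A q; d \<in> charts_at A q\<rbrakk> \<Longrightarrow> linear (jacobian c d q)"
  using transition_has_derivative has_derivative_linear by blast

text \<open>Near \<open>snd c q\<close> the two coordinate expressions of \<open>K\<close> differ by
  the transition map. Taking for \<open>K\<close> a function, a coordinate of a map into another
  manifold, or a chart gives the chart independence of \<open>dir_deriv\<close> and
  \<open>differential\<close> and the chain rule for Jacobians.\<close>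

lemma chart_change_derivative:
  fixes K :: "'a \<Rightarrow> 'g::real_normed_vector"
  assumes c: "c \<in> charts_at A q" and d: "d \<in> charts_at A q"
    and K: "((K \<circ> chart_inv d) has_derivative K') (at (snd d q))"
  shows "((K \<circ> chart_inv c) has_derivative (\<lambda>v. K' (jacobian c d q v))) (at (snd c q))"
proof -
  have q: "chart_inv c (snd c q) = q" by (rule chart_inv_snd[OF charts_at_is_chart[OF c] charts_atD(2)[OF c]])
  have "((\<lambda>x. (K \<circ> chart_inv d) ((snd d \<circ> chart_inv c) x)) has_derivative
      (\<lambda>v. K' (jacobian c d q v))) (at (snd c q))"
    by (rule has_derivative_compose[OF transition_has_derivative[OF c d]]) (use K q in \<open>simp add: o_def\<close>)
  then show ?thesis
  proof (rule has_derivative_transform_within_open)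
    show "open (snd c ` (fst c \<inter> fst d))"
      using c d by (intro open_chart_image open_chart_domain charts_at_is_chart)
    show "snd c q \<in> snd c ` (fst c \<inter> fst d)" using charts_atD[OF c] charts_atD[OF d] by blast
    show "(K \<circ> chart_inv d) ((snd d \<circ> chart_inv c) x) = (K \<circ> chart_inv c) x"
      if "x \<in> snd c ` (fst c \<inter> fst d)" for x
      using that chart_inv_snd[OF charts_at_is_chart[OF c]] chart_inv_snd[OF charts_at_is_chart[OF d]] by auto
  qed
qed

lemma jacobian_chain:
  assumes "c \<in> charts_at A q" "d \<in> charts_at A q" "e \<in> charts_at A q"
  shows "jacobian d e q (jacobian c d q u) = jacobian c e q u"
  using has_derivative_unique[OF chart_change_derivative[OF assms(1,2) transition_has_derivative[OF assms(2,3)]]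
      transition_has_derivative[OF assms(1,3)]] by metis

lemma jacobian_self:
  assumes "c \<in> charts_at A q"
  shows "jacobian c c q u = u"
proof -
  have "((snd c \<circ> chart_inv c) has_derivative (\<lambda>h. h)) (at (snd c q))"
  proof (rule has_derivative_transform_within_open[OF has_derivative_ident])
    show "open (snd c ` fst c)" using assms by (intro open_chart_range charts_at_is_chart)
    show "snd c q \<in> snd c ` fst c" using charts_atD[OF assms] by blast
  qed (simp add: snd_chart_inv)
  from has_derivative_unique[OF this transition_has_derivative[OF assms assms]] show ?thesis by metis
qed

lemma coord_field_self: "c \<in> charts_at A q \<Longrightarrow> coord_field A c u q c = u"
  by (simp add: coord_field_apply jacobian_self)

lemma coord_field_in_tangent_space:
  assumes "c \<in> charts_at A q"
  shows "coord_field A c u q \<in> tangent_space A q"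
  unfolding tangent_space_def jacobian_def[symmetric]
  by (simp add: coord_field_apply jacobian_chain[OF assms])

lemma tangent_component:
  "\<lbrakk>v \<in> tangent_space A q; c \<in> charts_at A q; d \<in> charts_at A q\<rbrakk> \<Longrightarrow> v d = jacobian c d q (v c)"
  unfolding tangent_space_def jacobian_def by blast

lemma tangent_outside: "\<lbrakk>v \<in> tangent_space A q; d \<notin> charts_at A q\<rbrakk> \<Longrightarrow> v d = 0"
  unfolding tangent_space_def by blast

lemma tangent_spaceI:
  "\<lbrakk>\<And>c d. \<lbrakk>c \<in> charts_at A q; d \<in> charts_at A q\<rbrakk> \<Longrightarrow> v d = jacobian c d q (v c);
    \<And>d. d \<notin> charts_at A q \<Longrightarrow> v d = 0\<rbrakk> \<Longrightarrow> v \<in> tangent_space A q"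
  unfolding tangent_space_def jacobian_def by blast

lemma tangent_eq_coord_field:
  assumes "v \<in> tangent_space A q" "c \<in> charts_at A q"
  shows "coord_field A c (v c) q = v"
proof
  fix d show "coord_field A c (v c) q d = v d"
    using tangent_component[OF assms, of d] tangent_outside[OF assms(1), of d]
    by (simp add: coord_field_apply)
qed

lemma tangent_eqI:
  "\<lbrakk>v \<in> tangent_space A q; w \<in> tangent_space A q; c \<in> charts_at A q; v c = w c\<rbrakk> \<Longrightarrow> v = w"
  using tangent_eq_coord_field by metis

lemma coord_field_linear:
  assumes "c \<in> charts_at A q"
  shows "linear (\<lambda>u. coord_field A c u q)"
  by (rule linearI; rule ext)
     (auto simp: coord_field_apply scaleR_fun_def jacobian_linear[OF assms] linear_add linear_cmul)

lemma tangent_space_subspace: "subspace (tangent_space A q)"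
proof (rule subspaceI)
  show "0 \<in> tangent_space A q"
    by (rule tangent_spaceI) (simp_all add: linear_0[OF jacobian_linear])
next
  fix v w assume v: "v \<in> tangent_space A q" and w: "w \<in> tangent_space A q"
  show "v + w \<in> tangent_space A q"
  proof (rule tangent_spaceI)
    fix c d assume cd: "c \<in> charts_at A q" "d \<in> charts_at A q"
    show "(v + w) d = jacobian c d q ((v + w) c)"
      using tangent_component[OF v cd] tangent_component[OF w cd]
      by (simp only: plus_fun_apply linear_add[OF jacobian_linear[OF cd]])
  qed (simp add: tangent_outside[OF v] tangent_outside[OF w])
next
  fix k v assume v: "v \<in> tangent_space A q"
  show "k *\<^sub>R v \<in> tangent_space A q"
  proof (rule tangent_spaceI)
    fix c d assume cd: "c \<in> charts_at A q" "d \<in> charts_at A q"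
    show "(k *\<^sub>R v) d = jacobian c d q ((k *\<^sub>R v) c)"
      using tangent_component[OF v cd]
      by (simp only: scaleR_fun_def linear_cmul[OF jacobian_linear[OF cd]])
  qed (simp add: scaleR_fun_def tangent_outside[OF v])
qed

section \<open>Vector fields and smooth functions\<close>

lemma chart_domain_in_manifold: "\<lbrakk>c \<in> A; open U\<rbrakk> \<Longrightarrow> open_in_manifold A (fst c \<inter> U)"
  unfolding open_in_manifold_def carrier_def using open_chart_domain[OF is_chart] by blast

lemma vector_field_subset: "\<lbrakk>vector_field A U X; V \<subseteq> U\<rbrakk> \<Longrightarrow> vector_field A V X"
  unfolding vector_field_def by (meson image_mono inf_mono order_refl smooth_on_subset subsetD)

lemma vector_field_add:
  assumes "open U" "vector_field A U X" "vector_field A U Y"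
  shows "vector_field A U (\<lambda>q. X q + Y q)"
  using assms subspace_add[OF tangent_space_subspace]
  by (auto simp: vector_field_def intro!: smooth_on_add open_chart_image is_chart)

lemma vector_field_scale:
  assumes "open U" "smooth_fun A U F" "vector_field A U Y"
  shows "vector_field A U (\<lambda>q. F q *\<^sub>R Y q)"
  using assms subspace_scale[OF tangent_space_subspace]
  by (auto simp: vector_field_def smooth_fun_def scaleR_fun_def o_def intro!: smooth_on_scaleR open_chart_image is_chart)

lemma vector_field_zero: "vector_field A U (\<lambda>q. 0)"
  using subspace_0[OF tangent_space_subspace] by (auto simp: vector_field_def smooth_on_const)

lemma smooth_fun_const: "smooth_fun A U (\<lambda>q. k)"
  by (simp add: smooth_fun_def o_def smooth_on_const)

text \<open>For \<open>U\<close> inside one chart domain, smoothness has to be checked in that chart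
  only; composition with the transition maps carries it to all others.\<close>

lemma smooth_in_chart:
  fixes K :: "'a \<Rightarrow> 'g::euclidean_space"
  assumes c: "c \<in> A" and d: "d \<in> A" and U: "open U" "U \<subseteq> fst c"
    and K: "smooth_on (snd c ` U) (K \<circ> chart_inv c)"
  shows "smooth_on (snd d ` (fst d \<inter> U)) (K \<circ> chart_inv d)"
proof -
  have o: "open (snd d ` (fst d \<inter> U))" by (rule open_chart_image[OF is_chart[OF d] U(1)])
  have oc: "open (snd c ` U)" using open_chart_image[OF is_chart[OF c] U(1)] U(2) by (simp add: Int_absorb1)
  have "smooth_on (snd d ` (fst d \<inter> U)) (snd c \<circ> chart_inv d)"
    by (rule smooth_on_subset[OF transition_smooth[OF d c]]) (use U(2) in auto)
  moreover have "(snd c \<circ> chart_inv d) ` (snd d ` (fst d \<inter> U)) \<subseteq> snd c ` U"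
    using chart_inv_snd[OF is_chart[OF d]] by auto
  ultimately have "smooth_on (snd d ` (fst d \<inter> U)) (\<lambda>x. (K \<circ> chart_inv c) ((snd c \<circ> chart_inv d) x))"
    by (intro smooth_on_compose[OF o oc _ K])
  then show ?thesis
  proof (rule smooth_on_cong[OF o])
    fix x assume "x \<in> snd d ` (fst d \<inter> U)"
    then obtain q where "q \<in> fst d" "q \<in> fst c" "x = snd d q" using U(2) by auto
    then show "(K \<circ> chart_inv c) ((snd c \<circ> chart_inv d) x) = (K \<circ> chart_inv d) x"
      using chart_inv_snd[OF is_chart[OF c]] chart_inv_snd[OF is_chart[OF d]] by simp
  qed
qed

lemma smooth_funI:
  "\<lbrakk>c \<in> A; open U; U \<subseteq> fst c; smooth_on (snd c ` U) (F \<circ> chart_inv c)\<rbrakk> \<Longrightarrow> smooth_fun A U F"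
  unfolding smooth_fun_def using smooth_in_chart by blast

text \<open>Seen from the coordinates of \<open>c\<close>, the component in \<open>d\<close> is a
  directional derivative of the transition map and hence smooth; \<open>smooth_in_chart\<close> then
  passes to the coordinates of \<open>d\<close>.\<close>

lemma coord_field_vector_field:
  assumes c: "c \<in> A" and U: "open U" "U \<subseteq> fst c"
  shows "vector_field A U (coord_field A c u)"
  unfolding vector_field_def
proof (intro conjI ballI)
  fix q assume "q \<in> U"
  then show "coord_field A c u q \<in> tangent_space A q"
    using c U(2) by (intro coord_field_in_tangent_space) (auto simp: charts_at_def)
next
  fix d assume d: "d \<in> A"
  have oUd: "open (U \<inter> fst d)" using U(1) open_chart_domain[OF is_chart[OF d]] by auto
  have Uc: "U \<inter> fst d \<subseteq> fst c" using U by auto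
  have sm: "smooth_on (snd c ` (U \<inter> fst d)) (\<lambda>x. frechet_derivative (snd d \<circ> chart_inv c) (at x) u)"
    by (rule smooth_on_subset[OF smooth_on_frechet_derivative[OF transition_smooth[OF c d]]]) (use U in auto)
  have "smooth_on (snd c ` (U \<inter> fst d)) ((\<lambda>q. jacobian c d q u) \<circ> chart_inv c)"
  proof (rule smooth_on_cong[OF _ sm])
    show "open (snd c ` (U \<inter> fst d))"
      using open_chart_image[OF is_chart[OF c] oUd] Uc by (simp add: Int_absorb1)
  next
    fix x assume "x \<in> snd c ` (U \<inter> fst d)"
    then show "frechet_derivative (snd d \<circ> chart_inv c) (at x) u = ((\<lambda>q. jacobian c d q u) \<circ> chart_inv c) x"
      using snd_chart_inv[of x c] U(2) by (auto simp: jacobian_def)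
  qed
  from smooth_in_chart[OF c d oUd Uc this]
  have "smooth_on (snd d ` (fst d \<inter> U)) ((\<lambda>q. jacobian c d q u) \<circ> chart_inv d)"
    by (simp add: Int_ac)
  then show "smooth_on (snd d ` (fst d \<inter> U)) (\<lambda>x. coord_field A c u (chart_inv d x) d)"
  proof (rule smooth_on_cong[OF open_chart_image[OF is_chart[OF d] U(1)]])
    fix x assume "x \<in> snd d ` (fst d \<inter> U)"
    then show "((\<lambda>q. jacobian c d q u) \<circ> chart_inv d) x = coord_field A c u (chart_inv d x) d"
      using chart_inv_snd[OF is_chart[OF d]] d by (auto simp: coord_field_apply charts_at_def)
  qed
qed

lemma dir_deriv_chart:
  assumes v: "v \<in> tangent_space A q" and c: "c \<in> charts_at A q"
    and F: "((F \<circ> chart_inv c) has_derivative F') (at (snd c q))"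
  shows "dir_deriv A q v F = F' (v c)"
proof -
  let ?d = "chart_at A q"
  have d: "?d \<in> charts_at A q" by (rule chart_at_in[OF charts_at_carrier[OF c]])
  have "frechet_derivative (F \<circ> chart_inv ?d) (at (snd ?d q)) = (\<lambda>v. F' (jacobian ?d c q v))"
    by (rule frechet_derivative_eqI[OF chart_change_derivative[OF d c F]])
  then show ?thesis using tangent_component[OF v d c] by (simp add: dir_deriv_def Let_def)
qed

lemma differential_chart:
  fixes B :: "('b, 'f::euclidean_space) chart set"
  assumes v: "v \<in> tangent_space A q" and c: "c \<in> charts_at A q" and d: "d \<in> charts_at B (F q)"
    and F: "((snd d \<circ> F \<circ> chart_inv c) has_derivative F') (at (snd c q))"
  shows "differential A B F q v d = F' (v c)"
proof -
  let ?e = "chart_at A q"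
  have e: "?e \<in> charts_at A q" by (rule chart_at_in[OF charts_at_carrier[OF c]])
  have "frechet_derivative ((snd d \<circ> F) \<circ> chart_inv ?e) (at (snd ?e q)) = (\<lambda>v. F' (jacobian ?e c q v))"
    by (rule frechet_derivative_eqI[OF chart_change_derivative[OF e c F]])
  then show ?thesis using tangent_component[OF v e c] d by (simp add: differential_def Let_def)
qed

lemma metric_smooth:
  assumes g: "riemannian_metric A g" and "open_in_manifold A U" "vector_field A U X" "vector_field A U Y"
  shows "smooth_fun A U (\<lambda>q. g q (X q) (Y q))"
proof -
  have "\<forall>U X Y. open_in_manifold A U \<and> vector_field A U X \<and> vector_field A U Y \<longrightarrow>
       smooth_fun A U (\<lambda>p. g p (X p) (Y p))"
    using g unfolding riemannian_metric_def by (rule conjunct2)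
  from this[THEN spec, THEN spec, THEN spec, THEN mp, OF conjI[OF assms(2) conjI[OF assms(3,4)]]]
  show ?thesis .
qed

section \<open>Metric and Christoffel symbols in a chart\<close>

definition coord_metric :: "('a, 'e) metric \<Rightarrow> ('a, 'e) chart \<Rightarrow> 'e \<Rightarrow> 'e \<Rightarrow> 'e \<Rightarrow> real"
  where "coord_metric g c x a b =
    g (chart_inv c x) (coord_field A c a (chart_inv c x)) (coord_field A c b (chart_inv c x))"

definition christoffel :: "('a, 'e) connection \<Rightarrow> ('a, 'e) chart \<Rightarrow> 'e \<Rightarrow> 'e \<Rightarrow> 'e \<Rightarrow> 'e"
  where "christoffel nabla c x a b =
    nabla (chart_inv c x) (coord_field A c a (chart_inv c x)) (coord_field A c b) c"

lemma chart_inv_charts_at: "\<lbrakk>c \<in> A; x \<in> snd c ` fst c\<rbrakk> \<Longrightarrow> c \<in> charts_at A (chart_inv c x)"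
  using chart_inv_in[of x c] by (simp add: charts_at_def)

lemma metric_via_coord:
  assumes "c \<in> charts_at A q" "v \<in> tangent_space A q" "w \<in> tangent_space A q"
  shows "g q v w = coord_metric g c (snd c q) (v c) (w c)"
  using assms by (simp add: coord_metric_def chart_inv_snd[OF charts_at_is_chart charts_atD(2)] tangent_eq_coord_field)

context
  fixes g :: "('a, 'e) metric" and c :: "('a, 'e) chart"
  assumes g: "riemannian_metric A g" and c: "c \<in> A"
begin

lemma g_tangent:
  assumes "q \<in> carrier A" "v \<in> tangent_space A q"
  shows "linear_map_on (tangent_space A q) (g q v)"
    "w \<in> tangent_space A q \<Longrightarrow> g q v w = g q w v" "v \<noteq> 0 \<Longrightarrow> g q v v > 0"
  using g assms unfolding riemannian_metric_def by blast+

lemma coord_metric_sym: "x \<in> snd c ` fst c \<Longrightarrow> coord_metric g c x a b = coord_metric g c x b a"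
  unfolding coord_metric_def using chart_inv_charts_at[OF c]
  by (intro g_tangent(2) charts_at_carrier coord_field_in_tangent_space)

lemma coord_metric_bilinear: assumes x: "x \<in> snd c ` fst c" shows "bilinear (coord_metric g c x)"
proof -
  let ?q = "chart_inv c x"
  have cq: "c \<in> charts_at A ?q" by (rule chart_inv_charts_at[OF c x])
  note L = coord_field_linear[OF cq] and T = coord_field_in_tangent_space[OF cq]
  have l: "linear (coord_metric g c x a)" for a
  proof (rule linearI)
    note lm = g_tangent(1)[OF charts_at_carrier[OF cq] T[of a], unfolded linear_map_on_def]
    show "coord_metric g c x a (b + b') = coord_metric g c x a b + coord_metric g c x a b'" for b b'
      unfolding coord_metric_def linear_add[OF L] by (rule lm[THEN conjunct1, rule_format]) (rule T)+
    show "coord_metric g c x a (k *\<^sub>R b) = k *\<^sub>R coord_metric g c x a b" for k b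
      unfolding coord_metric_def linear_cmul[OF L] by (rule lm[THEN conjunct2, rule_format]) (rule T)
  qed
  \<comment> \<open>The metric axioms give linearity in the second slot; symmetry transfers it to
    the first.\<close>
  moreover have "(\<lambda>a. coord_metric g c x a b) = coord_metric g c x b" for b
    using coord_metric_sym[OF x] by blast
  ultimately show ?thesis unfolding bilinear_def by simp
qed

lemma coord_metric_pos:
  assumes x: "x \<in> snd c ` fst c" and a: "a \<noteq> 0" shows "coord_metric g c x a a > 0"
proof -
  have cq: "c \<in> charts_at A (chart_inv c x)" by (rule chart_inv_charts_at[OF c x])
  have "coord_field A c a (chart_inv c x) \<noteq> 0" using coord_field_self[OF cq, of a] a by (metis zero_fun_apply)
  then show ?thesis unfolding coord_metric_def
    by (intro g_tangent(3) charts_at_carrier[OF cq] coord_field_in_tangent_space[OF cq])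
qed

lemma coord_metric_smooth: "smooth_on (snd c ` fst c) (\<lambda>x. coord_metric g c x a b)"
proof -
  have "vector_field A (fst c) (coord_field A c a)" for a
    by (rule coord_field_vector_field[OF c open_chart_domain[OF is_chart[OF c]] order_refl])
  moreover have "open_in_manifold A (fst c)" using chart_domain_in_manifold[OF c open_UNIV] by simp
  ultimately have "smooth_fun A (fst c) (\<lambda>q. g q (coord_field A c a q) (coord_field A c b q))"
    by (intro metric_smooth[OF g])
  from bspec[OF this[unfolded smooth_fun_def] c] show ?thesis
    by (simp add: coord_metric_def o_def)
qed

end

end

section \<open>Affine connections in coordinates\<close>

context atlas begin

context
  fixes nabla :: "('a, 'e) connection"
  assumes nabla: "affine_connection A nabla"
begin

lemmas nabla_axioms = nabla[unfolded affine_connection_def, THEN spec, THEN spec, THEN mp, OF conjI]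

lemma nabla_linear_direction:
  assumes "open_in_manifold A U" "vector_field A U Y" "q \<in> U"
  shows "linear_map_on (tangent_space A q) (\<lambda>v. nabla q v Y)"
  by (rule nabla_axioms[OF assms(1,2), THEN conjunct1, THEN bspec, OF assms(3)])

lemma nabla_vector_field:
  assumes "open_in_manifold A U" "vector_field A U Y" "vector_field A U X"
  shows "vector_field A U (\<lambda>q. nabla q (X q) Y)"
  by (rule nabla_axioms[OF assms(1,2), THEN conjunct2, THEN conjunct1, THEN spec, THEN mp, OF assms(3)])

context
  fixes U :: "'a set" and Y :: "'a \<Rightarrow> ('a, 'e) tvec" and q :: 'a and v :: "('a, 'e) tvec"
  assumes U: "open_in_manifold A U" and Y: "vector_field A U Y" and q: "q \<in> U" and v: "v \<in> tangent_space A q"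
begin

lemmas nabla_pointwise =
  nabla_axioms[OF U Y, THEN conjunct2, THEN conjunct2, THEN bspec, OF q, THEN bspec, OF v]

lemma nabla_tangent: "nabla q v Y \<in> tangent_space A q"
  by (rule nabla_pointwise[THEN conjunct1])

lemma nabla_add:
  assumes "vector_field A U Z"
  shows "nabla q v (\<lambda>q. Y q + Z q) = nabla q v Y + nabla q v Z"
  by (rule nabla_pointwise[THEN conjunct2, THEN conjunct1, THEN spec, THEN mp, OF assms])

lemma nabla_leibniz:
  assumes "smooth_fun A U F"
  shows "nabla q v (\<lambda>q. F q *\<^sub>R Y q) = dir_deriv A q v F *\<^sub>R Y q + F q *\<^sub>R nabla q v Y"
  by (rule nabla_pointwise[THEN conjunct2, THEN conjunct2, THEN conjunct1, THEN spec, THEN mp, OF assms])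

lemma nabla_local:
  assumes "\<And>q. q \<in> U \<Longrightarrow> Z q = Y q"
  shows "nabla q v Z = nabla q v Y"
  by (rule nabla_pointwise[THEN conjunct2, THEN conjunct2, THEN conjunct2, THEN spec, THEN mp])
     (use assms in blast)

end

lemma nabla_zero:
  assumes "open_in_manifold A U" "q \<in> U" "v \<in> tangent_space A q"
  shows "nabla q v (\<lambda>q. 0) = 0"
  using nabla_add[OF assms(1) vector_field_zero assms(2,3) vector_field_zero] by simp

text \<open>The field property is carried through the same induction because
  \<open>nabla_add\<close> asks it of the partial sums.\<close>

lemma nabla_sum:
  assumes U: "open_in_manifold A U" "q \<in> U" "v \<in> tangent_space A q"
    and "finite I" "\<And>i. i \<in> I \<Longrightarrow> vector_field A U (Y i)"
  shows "vector_field A U (\<lambda>q. \<Sum>i\<in>I. Y i q) \<and> nabla q v (\<lambda>q. \<Sum>i\<in>I. Y i q) = (\<Sum>i\<in>I. nabla q v (Y i))"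
  using assms(4,5)
proof (induction I rule: finite_induct)
  case empty
  show ?case by (simp only: sum.empty vector_field_zero nabla_zero[OF U] simp_thms)
next
  case (insert i I)
  have o: "open U" using U(1) by (simp add: open_in_manifold_def)
  have i: "vector_field A U (Y i)" by (rule insert.prems) simp
  have IH: "vector_field A U (\<lambda>q. \<Sum>i\<in>I. Y i q)"
    "nabla q v (\<lambda>q. \<Sum>i\<in>I. Y i q) = (\<Sum>i\<in>I. nabla q v (Y i))"
    using insert.IH insert.prems by blast+
  show ?case
    by (simp only: sum.insert[OF insert.hyps] vector_field_add[OF o i IH(1)]
        nabla_add[OF U(1) i U(2,3) IH(1)] IH(2) simp_thms)
qed

lemma coord_field_vector_field_domain: "c \<in> A \<Longrightarrow> vector_field A (fst c) (coord_field A c u)"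
  by (rule coord_field_vector_field[OF _ open_chart_domain[OF is_chart]]) auto

lemma chart_domain_open: "c \<in> A \<Longrightarrow> open_in_manifold A (fst c)"
  using chart_domain_in_manifold[OF _ open_UNIV] by simp

lemma nabla_coord_field_linear:
  assumes c: "c \<in> charts_at A q" and v: "v \<in> tangent_space A q"
  shows "linear (\<lambda>u. nabla q v (coord_field A c u))"
proof -
  note cA = charts_atD(1)[OF c] and q = charts_atD(2)[OF c]
  note dom = chart_domain_open[OF cA] and vf = coord_field_vector_field_domain[OF cA]
  have lin: "linear (\<lambda>u. coord_field A c u q')" if "q' \<in> fst c" for q'
    using coord_field_linear that cA by (simp add: charts_at_def)
  show ?thesis
  proof (rule linearI)
    fix a b
    have "nabla q v (coord_field A c (a + b)) = nabla q v (\<lambda>q. coord_field A c a q + coord_field A c b q)"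
      using nabla_local[OF dom vector_field_add[OF open_chart_domain[OF is_chart[OF cA]] vf vf] q v]
        linear_add[OF lin] by blast
    then show "nabla q v (coord_field A c (a + b)) = nabla q v (coord_field A c a) + nabla q v (coord_field A c b)"
      using nabla_add[OF dom vf q v vf] by simp
  next
    fix k :: real and a
    have "nabla q v (coord_field A c (k *\<^sub>R a)) = nabla q v (\<lambda>q. k *\<^sub>R coord_field A c a q)"
      using nabla_local[OF dom vector_field_scale[OF open_chart_domain[OF is_chart[OF cA]] smooth_fun_const vf] q v]
        linear_cmul[OF lin] by blast
    moreover have "dir_deriv A q v (\<lambda>q. k) = 0"
      using dir_deriv_chart[OF v c, of "\<lambda>q. k" "\<lambda>h. 0"] by (simp add: o_def)
    ultimately show "nabla q v (coord_field A c (k *\<^sub>R a)) = k *\<^sub>R nabla q v (coord_field A c a)"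
      using nabla_leibniz[OF dom vf q v smooth_fun_const] by simp
  qed
qed

text \<open>On \<open>W\<close>, where \<open>Y\<close> has smooth components in the chart, it is
  expanded in the coordinate frame and the Leibniz rule is applied. Locality of the connection is
  what permits the replacement, as the expansion agrees with \<open>Y\<close> only on
  \<open>W\<close>.\<close>

lemma nabla_coord:
  assumes U: "open_in_manifold A U" and Y: "vector_field A U Y" and q: "q \<in> U"
    and c: "c \<in> charts_at A q" and v: "v \<in> tangent_space A q"
  shows "nabla q v Y c = frechet_derivative (\<lambda>x. Y (chart_inv c x) c) (at (snd c q)) (v c)
    + nabla q v (coord_field A c (Y q c)) c"
proof -
  note cA = charts_atD(1)[OF c] and qc = charts_atD(2)[OF c]
  define W where "W = fst c \<inter> U"
  have oU: "open U" using U by (simp add: open_in_manifold_def)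
  have W: "open_in_manifold A W" "open W" "W \<subseteq> fst c" "W \<subseteq> U" "q \<in> W"
    using chart_domain_in_manifold[OF cA oU] q qc by (auto simp: W_def open_in_manifold_def)
  have YW: "vector_field A W Y" by (rule vector_field_subset[OF Y W(4)])
  have vf: "vector_field A W (coord_field A c b)" for b by (rule coord_field_vector_field[OF cA W(2,3)])
  define Yc where "Yc x = Y (chart_inv c x) c" for x
  have sW: "snd c q \<in> snd c ` W" using W(5) by blast
  have oW: "open (snd c ` W)" using open_chart_image[OF is_chart[OF cA] oU] by (simp add: W_def)
  have Yc: "smooth_on (snd c ` W) Yc"
    using Y cA by (simp add: vector_field_def W_def Yc_def[abs_def])
  define F where "F b q' = Y q' c \<bullet> b" for b q'
  have Fc: "F b \<circ> chart_inv c = (\<lambda>x. Yc x \<bullet> b)" for b by (auto simp: F_def Yc_def)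
  have F: "smooth_fun A W (F b)" for b
    by (rule smooth_funI[OF cA W(2,3)]) (simp add: Fc smooth_on_inner[OF oW Yc smooth_on_const])
  have dF: "dir_deriv A q v (F b) = frechet_derivative Yc (at (snd c q)) (v c) \<bullet> b" for b
    by (rule dir_deriv_chart[OF v c])
       (simp add: Fc has_derivative_inner_left[OF smooth_on_has_derivative[OF Yc sW]])
  have Fvf: "vector_field A W (\<lambda>q. F b q *\<^sub>R coord_field A c b q)" for b
    by (rule vector_field_scale[OF W(2) F vf])
  have exp: "Y q' = (\<Sum>b\<in>Basis. F b q' *\<^sub>R coord_field A c b q')" if "q' \<in> W" for q'
  proof -
    have cq': "c \<in> charts_at A q'" using that W(3) cA by (auto simp: charts_at_def)
    have "Y q' \<in> tangent_space A q'" using YW that by (simp add: vector_field_def)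
    then have "Y q' = coord_field A c (Y q' c) q'" using tangent_eq_coord_field[OF _ cq'] by simp
    also have "\<dots> = coord_field A c (\<Sum>b\<in>Basis. F b q' *\<^sub>R b) q'" by (simp add: F_def euclidean_representation)
    finally show ?thesis
      by (simp add: linear_sum[OF coord_field_linear[OF cq']] linear_cmul[OF coord_field_linear[OF cq']])
  qed
  note sum = nabla_sum[OF W(1,5) v finite_Basis Fvf]
  note lin = nabla_coord_field_linear[OF c v]
  have "nabla q v Y = nabla q v (\<lambda>q'. \<Sum>b\<in>Basis. F b q' *\<^sub>R coord_field A c b q')"
    by (rule nabla_local[OF W(1) sum[THEN conjunct1] W(5) v exp])
  also have "\<dots> = (\<Sum>b\<in>Basis. nabla q v (\<lambda>q'. F b q' *\<^sub>R coord_field A c b q'))"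
    by (rule sum[THEN conjunct2])
  also have "\<dots> = (\<Sum>b\<in>Basis. dir_deriv A q v (F b) *\<^sub>R coord_field A c b q) + (\<Sum>b\<in>Basis. F b q *\<^sub>R nabla q v (coord_field A c b))"
    by (simp add: nabla_leibniz[OF W(1) vf W(5) v F] sum.distrib)
  also have "(\<Sum>b\<in>Basis. dir_deriv A q v (F b) *\<^sub>R coord_field A c b q)
      = coord_field A c (\<Sum>b\<in>Basis. dir_deriv A q v (F b) *\<^sub>R b) q"
    by (simp add: linear_sum[OF coord_field_linear[OF c]] linear_cmul[OF coord_field_linear[OF c]])
  also have "(\<Sum>b\<in>Basis. dir_deriv A q v (F b) *\<^sub>R b) = frechet_derivative Yc (at (snd c q)) (v c)"
    by (simp add: dF euclidean_representation)
  also have "(\<Sum>b\<in>Basis. F b q *\<^sub>R nabla q v (coord_field A c b)) = nabla q v (coord_field A c (\<Sum>b\<in>Basis. F b q *\<^sub>R b))"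
    by (simp add: linear_sum[OF lin] linear_cmul[OF lin])
  also have "(\<Sum>b\<in>Basis. F b q *\<^sub>R b) = Y q c" by (simp add: F_def euclidean_representation)
  finally show ?thesis by (simp add: coord_field_self[OF c] Yc_def[abs_def])
qed

lemma nabla_coord_field_tangent:
  "\<lbrakk>c \<in> charts_at A q; v \<in> tangent_space A q\<rbrakk> \<Longrightarrow> nabla q v (coord_field A c u) \<in> tangent_space A q"
  by (rule nabla_tangent[OF chart_domain_open coord_field_vector_field_domain]) (auto dest: charts_atD)

lemma nabla_coord_field_christoffel:
  assumes c: "c \<in> charts_at A q" and v: "v \<in> tangent_space A q"
  shows "nabla q v (coord_field A c u) c = christoffel nabla c (snd c q) (v c) u"
  by (simp add: christoffel_def chart_inv_snd[OF charts_at_is_chart[OF c] charts_atD(2)[OF c]]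
      tangent_eq_coord_field[OF v c])

lemma christoffel_bilinear:
  assumes c: "c \<in> A" and x: "x \<in> snd c ` fst c"
  shows "bilinear (christoffel nabla c x)"
proof -
  let ?q = "chart_inv c x"
  have cq: "c \<in> charts_at A ?q" by (rule chart_inv_charts_at[OF c x])
  note L = coord_field_linear[OF cq] and T = coord_field_in_tangent_space[OF cq]
  have "linear (christoffel nabla c x a)" for a
    by (intro linearI)
       (simp_all add: christoffel_def scaleR_fun_def linear_add[OF nabla_coord_field_linear[OF cq T]]
          linear_cmul[OF nabla_coord_field_linear[OF cq T]])
  moreover have "linear (\<lambda>a. christoffel nabla c x a b)" for b
  proof (rule linearI)
    note lm = nabla_linear_direction[OF chart_domain_open[OF c] coord_field_vector_field_domain[OF c] chart_inv_in[OF x],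
        unfolded linear_map_on_def]
    show "christoffel nabla c x (a + a') b = christoffel nabla c x a b + christoffel nabla c x a' b" for a a'
      unfolding christoffel_def linear_add[OF L] using lm[THEN conjunct1, rule_format, OF T T] by simp
    show "christoffel nabla c x (k *\<^sub>R a) b = k *\<^sub>R christoffel nabla c x a b" for k a
      unfolding christoffel_def linear_cmul[OF L] using lm[THEN conjunct2, rule_format, OF T]
      by (simp add: scaleR_fun_def)
  qed
  ultimately show ?thesis by (simp add: bilinear_def)
qed

lemma christoffel_smooth:
  assumes c: "c \<in> A"
  shows "smooth_on (snd c ` fst c) (\<lambda>x. christoffel nabla c x a b)"
proof -
  have "vector_field A (fst c) (\<lambda>q. nabla q (coord_field A c a q) (coord_field A c b))"
    by (intro nabla_vector_field chart_domain_open coord_field_vector_field_domain c)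
  then have "smooth_on (snd c ` (fst c \<inter> fst c)) (\<lambda>x. nabla (chart_inv c x) (coord_field A c a (chart_inv c x)) (coord_field A c b) c)"
    using c unfolding vector_field_def by blast
  then show ?thesis by (simp add: christoffel_def)
qed

text \<open>This makes the Lie bracket of coordinate fields vanish in their own chart, which turns
  absence of torsion into symmetry of \<open>christoffel\<close>.\<close>

lemma coord_field_const_derivative:
  assumes c: "c \<in> charts_at A q"
  shows "frechet_derivative (\<lambda>x. coord_field A c u (chart_inv c x) c) (at (snd c q)) = (\<lambda>h. 0)"
proof (rule frechet_derivative_eqI, rule has_derivative_transform_within_open[OF has_derivative_const])
  show "open (snd c ` fst c)" using c by (intro open_chart_range charts_at_is_chart)
  show "snd c q \<in> snd c ` fst c" using charts_atD[OF c] by blast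
  show "u = coord_field A c u (chart_inv c x) c" if "x \<in> snd c ` fst c" for x
    using coord_field_self[OF chart_inv_charts_at[OF charts_atD(1)[OF c] that]] by simp
qed

text \<open>The reason why a solution of the coordinate geodesic equation in the chart \<open>c\<close> also solves
  it in every other chart \<open>d\<close>.\<close>

lemma christoffel_transformation:
  assumes c: "c \<in> charts_at A q" and d: "d \<in> charts_at A q" and v: "v \<in> tangent_space A q"
  shows "frechet_derivative (\<lambda>x. frechet_derivative (snd d \<circ> chart_inv c) (at x) (v c)) (at (snd c q)) (v c)
    - jacobian c d q (christoffel nabla c (snd c q) (v c) (v c)) + nabla q v (coord_field A d (v d)) d = 0"
proof -
  note cA = charts_atD(1)[OF c] and dA = charts_atD(1)[OF d]
  \<comment> \<open>A field through \<open>v\<close> at \<open>q\<close>. The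
    \<open>d\<close>-component of its covariant derivative is computed twice: by the coordinate
    formula in \<open>d\<close>, and by mapping its \<open>c\<close>-component with the
    Jacobian.\<close>
  let ?Y = "coord_field A c (v c)"
  have Yq: "?Y q = v" by (rule tangent_eq_coord_field[OF v c])
  have "nabla q v ?Y d = frechet_derivative (\<lambda>x. ?Y (chart_inv d x) d) (at (snd d q)) (v d)
      + nabla q v (coord_field A d (v d)) d"
    using nabla_coord[OF chart_domain_open[OF cA] coord_field_vector_field_domain[OF cA] charts_atD(2)[OF c] d v, of "v c"]
    by (simp add: Yq)
  moreover have "nabla q v ?Y d = jacobian c d q (christoffel nabla c (snd c q) (v c) (v c))"
    using tangent_component[OF nabla_coord_field_tangent[OF c v] c d] nabla_coord_field_christoffel[OF c v] by simp
  moreover have "frechet_derivative (\<lambda>x. ?Y (chart_inv d x) d) (at (snd d q)) (v d)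
      = frechet_derivative (\<lambda>x. frechet_derivative (snd d \<circ> chart_inv c) (at x) (v c)) (at (snd c q)) (v c)"
  proof -
    let ?K = "\<lambda>q. ?Y q d"
    let ?W = "snd d ` (fst d \<inter> fst c)"
    have "smooth_on ?W (?K \<circ> chart_inv d)"
      using coord_field_vector_field_domain[OF cA, of "v c"] dA by (simp add: vector_field_def o_def)
    then have D: "((?K \<circ> chart_inv d) has_derivative frechet_derivative (?K \<circ> chart_inv d) (at (snd d q))) (at (snd d q))"
      using charts_atD(2)[OF c] charts_atD(2)[OF d] by (intro smooth_on_has_derivative) auto
    have "((?K \<circ> chart_inv c) has_derivative (\<lambda>h. frechet_derivative (?K \<circ> chart_inv d) (at (snd d q)) (jacobian c d q h))) (at (snd c q))"
      by (rule chart_change_derivative[OF c d D])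
    then have "((\<lambda>x. frechet_derivative (snd d \<circ> chart_inv c) (at x) (v c)) has_derivative
        (\<lambda>h. frechet_derivative (?K \<circ> chart_inv d) (at (snd d q)) (jacobian c d q h))) (at (snd c q))"
    proof (rule has_derivative_transform_within_open)
      show "open (snd c ` (fst c \<inter> fst d))" using c d by (intro open_chart_image open_chart_domain charts_at_is_chart)
      show "snd c q \<in> snd c ` (fst c \<inter> fst d)" using charts_atD(2)[OF c] charts_atD(2)[OF d] by blast
      fix x assume "x \<in> snd c ` (fst c \<inter> fst d)"
      then have "x \<in> snd c ` fst c" "chart_inv c x \<in> fst d"
        by (auto simp: chart_inv_snd[OF is_chart[OF cA]])
      then show "(?K \<circ> chart_inv c) x = frechet_derivative (snd d \<circ> chart_inv c) (at x) (v c)"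
        using snd_chart_inv[of x c] dA by (simp add: coord_field_apply charts_at_def jacobian_def)
    qed
    from frechet_derivative_eqI[OF this] show ?thesis
      using tangent_component[OF v c d] by (simp add: o_def)
  qed
  ultimately show ?thesis by simp
qed

text \<open>The equation is solved in the chart \<open>c\<close>, but \<open>geodesic\<close>
  demands a vanishing covariant derivative in every chart around each point. In another chart the
  derivative of the velocity is exactly what \<open>christoffel_transformation\<close>
  cancels.\<close>

lemma geodesic_from_chart:
  assumes c: "c \<in> A" and I: "open I" "is_interval I" and smX: "smooth_on I X" and X: "\<And>t. t \<in> I \<Longrightarrow> X t \<in> snd c ` fst c"
    and dX: "\<And>t. t \<in> I \<Longrightarrow> (X has_vector_derivative V t) (at t)"
    and dV: "\<And>t. t \<in> I \<Longrightarrow> (V has_vector_derivative - christoffel nabla c (X t) (V t) (V t)) (at t)"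
  defines "h \<equiv> \<lambda>t. chart_inv c (X t)"
  shows "geodesic A nabla I h" and "\<And>t. t \<in> I \<Longrightarrow> velocity A h t = coord_field A c (V t) (h t)"
proof -
  have ch: "c \<in> charts_at A (h t)" and sch: "snd c (h t) = X t" if "t \<in> I" for t
    unfolding h_def using chart_inv_charts_at[OF c X[OF that]] snd_chart_inv[OF X[OF that]] by auto
  have conth: "continuous_on I h"
    unfolding h_def
    by (rule continuous_on_compose2[OF continuous_on_chart_inv[OF is_chart[OF c]] smooth_on_imp_continuous_on[OF smX]])
       (use X in blast)
  have der: "((\<lambda>s. (snd d \<circ> h) s) has_derivative (\<lambda>k. k *\<^sub>R jacobian c d (h t) (V t))) (at t)"
    if t: "t \<in> I" and d: "d \<in> charts_at A (h t)" for t d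
  proof -
    have "((\<lambda>s. (snd d \<circ> chart_inv c) (X s)) has_derivative (\<lambda>k. jacobian c d (h t) (k *\<^sub>R V t))) (at t)"
      by (rule has_derivative_compose[OF dX[OF t, unfolded has_vector_derivative_def]])
         (use transition_has_derivative[OF ch[OF t] d] sch[OF t] in \<open>simp add: o_def\<close>)
    then show ?thesis by (simp add: h_def linear_cmul[OF jacobian_linear[OF ch[OF t] d], unfolded h_def])
  qed
  show vel: "velocity A h t = coord_field A c (V t) (h t)" if t: "t \<in> I" for t
  proof
    fix d
    show "velocity A h t d = coord_field A c (V t) (h t) d"
      using vector_derivative_at[OF der[OF t, of d, folded has_vector_derivative_def]]
      by (simp add: velocity_def coord_field_apply o_def)
  qed
  have oN: "open (I \<inter> h -` fst d)" if "d \<in> A" for d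
    by (rule continuous_open_preimage[OF conth I(1) open_chart_domain[OF is_chart[OF that]]])
  have Xin: "X s \<in> snd c ` (fst c \<inter> fst d)" if "s \<in> I \<inter> h -` fst d" for s d
    using that sch[of s] ch[of s] by (force simp: charts_at_def)
  have "smooth_curve A I h"
    unfolding smooth_curve_def
  proof (intro conjI ballI)
    show "h ` I \<subseteq> carrier A" using charts_at_carrier[OF ch] by blast
    show "continuous_on I h" by (rule conth)
    fix d assume d: "d \<in> A"
    have "smooth_on (I \<inter> h -` fst d) (\<lambda>s. (snd d \<circ> chart_inv c) (X s))"
    proof (rule smooth_on_compose[OF oN[OF d] _ _ transition_smooth[OF c d] smooth_on_subset[OF smX]])
      show "open (snd c ` (fst c \<inter> fst d))" by (intro open_chart_image open_chart_domain is_chart c d)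
    qed (use Xin in auto)
    then show "smooth_on (I \<inter> h -` fst d) (snd d \<circ> h)" by (simp add: h_def o_def)
  qed
  moreover have "covariant_derivative_along A nabla h (velocity A h) t = 0" if t: "t \<in> I" for t
  proof
    fix d
    show "covariant_derivative_along A nabla h (velocity A h) t d = 0 d"
    proof (cases "d \<in> charts_at A (h t)")
      case False
      then show ?thesis by (simp add: covariant_derivative_along_def)
    next
      case True
      note cd = ch[OF t] True and dA = charts_atD(1)[OF True]
      let ?D = "\<lambda>x. frechet_derivative (snd d \<circ> chart_inv c) (at x)"
      let ?N = "I \<inter> h -` fst d"
      have tN: "t \<in> ?N" using t charts_atD(2)[OF True] by blast
      have sm: "smooth_on (snd c ` (fst c \<inter> fst d)) (\<lambda>x. ?D x u)" for u
        by (rule smooth_on_frechet_derivative[OF transition_smooth[OF c dA]])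
      have dD: "((\<lambda>s. ?D (X s) u) has_derivative (\<lambda>k. frechet_derivative (\<lambda>x. ?D x u) (at (X t)) (k *\<^sub>R V t))) (at t)" for u
        by (rule has_derivative_compose[OF dX[OF t, unfolded has_vector_derivative_def]
              smooth_on_has_derivative[OF sm Xin[OF tN]]])
      \<comment> \<open>The \<open>d\<close>-component of the velocity is the Jacobian along the
        curve applied to \<open>V\<close>. Its derivative has a part from the second derivative of
        the transition map and a part from the acceleration.\<close>
      have "((\<lambda>s. ?D (X s) (V s)) has_derivative (\<lambda>k. frechet_derivative (\<lambda>x. ?D x (V t)) (at (X t)) (k *\<^sub>R V t)
          + ?D (X t) (k *\<^sub>R - christoffel nabla c (X t) (V t) (V t)))) (at t)"
        by (rule has_derivative_linear_family[where A = "\<lambda>s. ?D (X s)", OF oN[OF dA] tN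
              smooth_on_linear_derivative[OF transition_smooth[OF c dA] Xin] dD
              dV[OF t, unfolded has_vector_derivative_def]])
      moreover have "?D (X s) (V s) = velocity A h s d" if "s \<in> ?N" for s
        using that vel[of s] sch[of s] dA by (simp add: coord_field_apply charts_at_def jacobian_def)
      ultimately have "((\<lambda>s. velocity A h s d) has_derivative (\<lambda>k. frechet_derivative (\<lambda>x. ?D x (V t)) (at (X t)) (k *\<^sub>R V t)
          + ?D (X t) (k *\<^sub>R - christoffel nabla c (X t) (V t) (V t)))) (at t)"
        by (rule has_derivative_transform_within_open[OF _ oN[OF dA] tN])
      then have "((\<lambda>s. velocity A h s d) has_vector_derivative (frechet_derivative (\<lambda>x. ?D x (V t)) (at (X t)) (V t)
          - ?D (X t) (christoffel nabla c (X t) (V t) (V t)))) (at t)"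
        unfolding has_vector_derivative_def
        using linear_cmul[OF smooth_on_linear_derivative[OF sm Xin[OF tN]]]
          smooth_on_linear_derivative[OF transition_smooth[OF c dA] Xin[OF tN]]
        by (simp add: linear_cmul linear_neg scaleR_diff_right)
      from vector_derivative_at[OF this]
      have e: "vector_derivative (\<lambda>s. velocity A h s d) (at t) = frechet_derivative (\<lambda>x. ?D x (V t)) (at (X t)) (V t)
          - ?D (X t) (christoffel nabla c (X t) (V t) (V t))" .
      have T: "velocity A h t \<in> tangent_space A (h t)"
        unfolding vel[OF t] by (rule coord_field_in_tangent_space[OF ch[OF t]])
      have "velocity A h t c = V t" by (simp add: vel[OF t] coord_field_self[OF ch[OF t]])
      with christoffel_transformation[OF cd T] e True show ?thesis
        by (simp add: covariant_derivative_along_def sch[OF t] jacobian_def)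
    qed
  qed
  ultimately show "geodesic A nabla I h" unfolding geodesic_def using I by blast
qed

end

section \<open>The Levi-Civita connection in a chart\<close>

context
  fixes nabla :: "('a, 'e) connection" and g :: "('a, 'e) metric" and c :: "('a, 'e) chart"
  assumes lc: "levi_civita A g nabla" and c: "c \<in> A" and g: "riemannian_metric A g"
begin

lemma levi_civita_affine: "affine_connection A nabla"
  using lc by (simp add: levi_civita_def)

lemmas levi_civita_axioms = lc[unfolded levi_civita_def, THEN conjunct2, THEN spec, THEN spec, THEN spec, THEN mp, OF conjI[OF _ conjI]]

lemma christoffel_sym:
  assumes x: "x \<in> snd c ` fst c"
  shows "christoffel nabla c x a b = christoffel nabla c x b a"
proof -
  let ?q = "chart_inv c x"
  have cq: "c \<in> charts_at A ?q" by (rule chart_inv_charts_at[OF c x])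
  note vf = coord_field_vector_field_domain[OF levi_civita_affine c]
  have "nabla ?q (coord_field A c a ?q) (coord_field A c b) - nabla ?q (coord_field A c b ?q) (coord_field A c a)
      = lie_bracket A (coord_field A c a) (coord_field A c b) ?q"
    by (rule levi_civita_axioms[OF chart_domain_open[OF levi_civita_affine c] vf vf, THEN conjunct1, THEN bspec, OF chart_inv_in[OF x]])
  from fun_cong[OF this, of c]
  show ?thesis
    using coord_field_const_derivative[OF levi_civita_affine cq] cq
    by (simp add: christoffel_def lie_bracket_def)
qed

lemma metric_derivative:
  assumes U: "open_in_manifold A U" and X: "vector_field A U X" and Y: "vector_field A U Y" and q: "q \<in> U"
    and cq: "c \<in> charts_at A q" and v: "v \<in> tangent_space A q"
  shows "frechet_derivative (\<lambda>x. g (chart_inv c x) (X (chart_inv c x)) (Y (chart_inv c x))) (at (snd c q)) (v c)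
    = g q (nabla q v X) (Y q) + g q (X q) (nabla q v Y)"
proof -
  have "smooth_fun A U (\<lambda>q. g q (X q) (Y q))"
    by (rule metric_smooth[OF g U X Y])
  then have "smooth_on (snd c ` (fst c \<inter> U)) ((\<lambda>q. g q (X q) (Y q)) \<circ> chart_inv c)"
    unfolding smooth_fun_def using c by (rule bspec)
  then have "dir_deriv A q v (\<lambda>q. g q (X q) (Y q)) =
      frechet_derivative ((\<lambda>q. g q (X q) (Y q)) \<circ> chart_inv c) (at (snd c q)) (v c)"
    by (intro dir_deriv_chart[OF v cq] smooth_on_has_derivative) (use q charts_atD(2)[OF cq] in auto)
  moreover have "dir_deriv A q v (\<lambda>q. g q (X q) (Y q)) = g q (nabla q v X) (Y q) + g q (X q) (nabla q v Y)"
    by (rule levi_civita_axioms[OF U X Y, THEN conjunct2, THEN bspec, OF q, THEN bspec, OF v])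
  ultimately show ?thesis by (simp add: o_def)
qed

lemma coord_metric_compatible:
  assumes x: "x \<in> snd c ` fst c"
  shows "frechet_derivative (\<lambda>x. coord_metric g c x a b) (at x) u =
    coord_metric g c x (christoffel nabla c x u a) b + coord_metric g c x a (christoffel nabla c x u b)"
proof -
  let ?q = "chart_inv c x"
  have cq: "c \<in> charts_at A ?q" by (rule chart_inv_charts_at[OF c x])
  note vf = coord_field_vector_field_domain[OF levi_civita_affine c] and T = coord_field_in_tangent_space[OF cq]
  have e: "coord_field A c (christoffel nabla c x u a) ?q = nabla ?q (coord_field A c u ?q) (coord_field A c a)" for a
    unfolding christoffel_def
    by (rule tangent_eq_coord_field[OF nabla_coord_field_tangent[OF levi_civita_affine cq T] cq])
  show ?thesis
    using metric_derivative[OF chart_domain_open[OF levi_civita_affine c] vf vf chart_inv_in[OF x] cq T, of a b u]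
    by (simp add: coord_metric_def e coord_field_self[OF cq] snd_chart_inv[OF x])
qed

end

end

section \<open>Submersions in charts\<close>

text \<open>\<open>L\<close> is injective on the orthogonal complement of its kernel and maps it
  onto the whole target, so this complement has dimension DIM('f).\<close>

lemma dim_kernel_surj:
  fixes L :: "'e::euclidean_space \<Rightarrow> 'f::euclidean_space"
  assumes L: "linear L" and "surj L"
  shows "dim {k. L k = 0} + DIM('f) = DIM('e)"
proof -
  let ?K = "{k. L k = 0}" and ?C = "{y \<in> UNIV. \<forall>x\<in>{k. L k = 0}. orthogonal x y}"
  have K: "subspace ?K" by (rule linear_subspace_kernel[OF L])
  have C: "subspace ?C"
    by (auto simp: subspace_def orthogonal_def inner_add_right)
  have d: "dim ?C + dim ?K = DIM('e)"
    using dim_subspace_orthogonal_to_vectors[OF K subspace_UNIV] by simp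
  have "inj_on L ?C"
  proof (rule inj_onI)
    fix x y assume xy: "x \<in> ?C" "y \<in> ?C" "L x = L y"
    then have "x - y \<in> ?C" by (auto simp: orthogonal_def inner_diff_right)
    moreover have "x - y \<in> ?K" using xy(3) by (simp add: linear_diff[OF L])
    ultimately have "orthogonal (x - y) (x - y)" by blast
    then show "x = y" by (simp add: orthogonal_def)
  qed
  then have "dim (L ` ?C) = dim ?C" by (intro dim_image_eq L) (simp only: span_eq_iff[THEN iffD2, OF C])
  moreover have "L ` ?C = UNIV"
  proof -
    have "y \<in> L ` ?C" for y
    proof -
      obtain x where x: "y = L x" using assms(2) by (metis surjD)
      obtain a b where ab: "a \<in> span ?K" "\<And>w. w \<in> span ?K \<Longrightarrow> orthogonal b w" "x = a + b"
        using orthogonal_subspace_decomp_exists[of ?K x] by metis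
      have "L a = 0" using ab(1) K by (metis (lifting) mem_Collect_eq span_eq_iff)
      then have "y = L b" using x ab(3) by (simp add: linear_add[OF L])
      moreover have "b \<in> ?C" using ab(2) by (auto simp: orthogonal_commute span_base)
      ultimately show ?thesis by blast
    qed
    then show ?thesis by blast
  qed
  ultimately show ?thesis using d by simp
qed

section \<open>Vertical and horizontal vectors in a pair of charts\<close>

locale submersion_charts =
  fixes M :: "('a::{t2_space, second_countable_topology}, 'e::euclidean_space) chart set"
    and g :: "('a, 'e) metric"
    and N :: "('b::{t2_space, second_countable_topology}, 'f::euclidean_space) chart set"
    and gN :: "('b, 'f) metric" and \<pi> :: "'a \<Rightarrow> 'b"
  assumes submersion: "riemannian_submersion M g N gN \<pi>"
begin

lemma M_metric: "riemannian_metric M g" and N_metric: "riemannian_metric N gN"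
  and pi_smooth: "smooth_map M N \<pi>"
  and pi_range: "\<pi> ` carrier M = carrier N"
  using submersion by (simp_all add: riemannian_submersion_def riemannian_manifold_def)

sublocale M: atlas M
  using submersion by unfold_locales (simp add: riemannian_submersion_def riemannian_manifold_def)

sublocale N: atlas N
  using submersion by unfold_locales (simp add: riemannian_submersion_def riemannian_manifold_def)

definition rep :: "('a, 'e) chart \<Rightarrow> ('b, 'f) chart \<Rightarrow> 'e \<Rightarrow> 'f"
  where "rep c d = snd d \<circ> \<pi> \<circ> chart_inv c"

definition rep_dom :: "('a, 'e) chart \<Rightarrow> ('b, 'f) chart \<Rightarrow> 'e set"
  where "rep_dom c d = snd c ` (fst c \<inter> \<pi> -` fst d)"

lemma rep_smooth: "\<lbrakk>c \<in> M; d \<in> N\<rbrakk> \<Longrightarrow> smooth_on (rep_dom c d) (rep c d)"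
  using pi_smooth unfolding smooth_map_def rep_def rep_dom_def by blast

lemma open_rep_dom:
  assumes "c \<in> M" "d \<in> N"
  shows "open (rep_dom c d)"
proof -
  have "continuous_on (fst c) \<pi>"
  proof (rule continuous_on_subset)
    show "continuous_on (carrier M) \<pi>" using pi_smooth unfolding smooth_map_def by blast
    show "fst c \<subseteq> carrier M" using assms(1) by (auto simp: carrier_def)
  qed
  then have "open (fst c \<inter> \<pi> -` fst d)"
    by (rule continuous_open_preimage) (use assms M.is_chart N.is_chart open_chart_domain in blast)+
  from open_chart_image[OF M.is_chart[OF assms(1)] this] show ?thesis
    by (simp add: rep_dom_def Int_assoc[symmetric])
qed

lemma rep_dom_range: "rep_dom c d \<subseteq> snd c ` fst c"
  by (auto simp: rep_dom_def)

lemma rep_dom_point: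
  assumes "c \<in> M" "d \<in> N" "x \<in> rep_dom c d"
  shows "c \<in> charts_at M (chart_inv c x)" "d \<in> charts_at N (\<pi> (chart_inv c x))"
    "snd c (chart_inv c x) = x" "snd d (\<pi> (chart_inv c x)) = rep c d x"
    "rep c d x \<in> snd d ` fst d" "chart_inv d (rep c d x) = \<pi> (chart_inv c x)"
proof -
  obtain q where q: "q \<in> fst c" "\<pi> q \<in> fst d" "x = snd c q" using assms(3) by (auto simp: rep_dom_def)
  have "chart_inv c x = q" using chart_inv_snd[OF M.is_chart[OF assms(1)] q(1)] q(3) by simp
  then show "c \<in> charts_at M (chart_inv c x)" "d \<in> charts_at N (\<pi> (chart_inv c x))"
    "snd c (chart_inv c x) = x" "snd d (\<pi> (chart_inv c x)) = rep c d x"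
    "rep c d x \<in> snd d ` fst d" "chart_inv d (rep c d x) = \<pi> (chart_inv c x)"
    using q assms chart_inv_snd[OF N.is_chart[OF assms(2)] q(2)] by (simp_all add: charts_at_def rep_def)
qed

lemma point_in_rep_dom:
  "\<lbrakk>c \<in> charts_at M q; d \<in> charts_at N (\<pi> q)\<rbrakk> \<Longrightarrow> snd c q \<in> rep_dom c d"
  unfolding rep_dom_def charts_at_def by blast

lemma differential_in:
  assumes "q \<in> carrier M" "v \<in> tangent_space M q"
  shows "differential M N \<pi> q v \<in> tangent_space N (\<pi> q)"
proof -
  have "differential M N \<pi> q ` tangent_space M q = tangent_space N (\<pi> q)"
    using submersion assms(1) unfolding riemannian_submersion_def by blast
  then show ?thesis using assms(2) by blast
qed

context
  fixes q c d
  assumes c: "c \<in> charts_at M q" and d: "d \<in> charts_at N (\<pi> q)"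
begin

abbreviation (input) "Pq \<equiv> frechet_derivative (rep c d) (at (snd c q))"

lemma q_carrier: "q \<in> carrier M"
  by (rule M.charts_at_carrier[OF c])

lemma rep_has_derivative: "(rep c d has_derivative Pq) (at (snd c q))"
  by (rule smooth_on_has_derivative[OF rep_smooth[OF M.charts_atD(1)[OF c] N.charts_atD(1)[OF d]] point_in_rep_dom[OF c d]])

lemma Pq_linear: "linear Pq"
  using rep_has_derivative by (rule has_derivative_linear)

lemma differential_component: "v \<in> tangent_space M q \<Longrightarrow> differential M N \<pi> q v d = Pq (v c)"
  by (rule M.differential_chart[where F' = Pq and F = \<pi> and c = c and d = d, OF _ c d])
     (use rep_has_derivative in \<open>simp_all add: rep_def\<close>)

lemma vertical_iff: 
  assumes v: "v \<in> tangent_space M q"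
  shows "v \<in> vertical_space M N \<pi> q \<longleftrightarrow> Pq (v c) = 0"
proof
  assume "v \<in> vertical_space M N \<pi> q"
  then have "differential M N \<pi> q v d = 0" by (simp add: vertical_space_def)
  then show "Pq (v c) = 0" by (simp add: differential_component[OF v])
next
  assume 0: "Pq (v c) = 0"
  \<comment> \<open>The image is a tangent vector of the target, so its component in the single
    chart \<open>d\<close> determines it.\<close>
  have "differential M N \<pi> q v = 0"
    by (rule N.tangent_eqI[OF differential_in[OF q_carrier v] subspace_0[OF N.tangent_space_subspace] d])
       (simp add: differential_component[OF v] 0)
  then show "v \<in> vertical_space M N \<pi> q" using v by (simp add: vertical_space_def)
qed

lemma vertical_tangent: "v \<in> vertical_space M N \<pi> q \<Longrightarrow> v \<in> tangent_space M q"
  by (simp add: vertical_space_def)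

lemma Pq_surj: "surj Pq"
proof -
  have "differential M N \<pi> q ` tangent_space M q = tangent_space N (\<pi> q)"
    using submersion q_carrier unfolding riemannian_submersion_def by blast
  then have "\<exists>v\<in>tangent_space M q. differential M N \<pi> q v = coord_field N d y (\<pi> q)" for y
    using N.coord_field_in_tangent_space[OF d, of y] by (metis imageE)
  then have "\<exists>v. Pq (v c) = y" for y
    using differential_component N.coord_field_self[OF d] by metis
  then show ?thesis by (metis surj_def)
qed

lemma horizontal_iff:
  assumes v: "v \<in> tangent_space M q"
  shows "v \<in> horizontal_space M g N \<pi> q \<longleftrightarrow>
    (\<forall>k. Pq k = 0 \<longrightarrow> M.coord_metric g c (snd c q) (v c) k = 0)"
proof
  assume h: "v \<in> horizontal_space M g N \<pi> q"
  show "\<forall>k. Pq k = 0 \<longrightarrow> M.coord_metric g c (snd c q) (v c) k = 0"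
  proof (intro allI impI)
    fix k assume k: "Pq k = 0"
    have t: "coord_field M c k q \<in> tangent_space M q" by (rule M.coord_field_in_tangent_space[OF c])
    have "coord_field M c k q \<in> vertical_space M N \<pi> q"
      using k by (simp add: vertical_iff[OF t] M.coord_field_self[OF c])
    then have "g q v (coord_field M c k q) = 0" using h by (simp add: horizontal_space_def)
    then show "M.coord_metric g c (snd c q) (v c) k = 0"
      by (simp add: M.metric_via_coord[OF c v t] M.coord_field_self[OF c])
  qed
next
  assume k: "\<forall>k. Pq k = 0 \<longrightarrow> M.coord_metric g c (snd c q) (v c) k = 0"
  have "g q v w = 0" if w: "w \<in> vertical_space M N \<pi> q" for w
    using k vertical_iff[OF vertical_tangent[OF w]] w M.metric_via_coord[OF c v vertical_tangent[OF w], of g]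
    by simp
  then show "v \<in> horizontal_space M g N \<pi> q"
    using v by (simp add: horizontal_space_def)
qed

lemma isometry_horizontal:
  assumes "\<And>k. Pq k = 0 \<Longrightarrow> M.coord_metric g c (snd c q) a k = 0"
  shows "N.coord_metric gN d (snd d (\<pi> q)) (Pq a) (Pq a) = M.coord_metric g c (snd c q) a a"
proof -
  let ?v = "coord_field M c a q"
  have t: "?v \<in> tangent_space M q" by (rule M.coord_field_in_tangent_space[OF c])
  have vc: "?v c = a" by (rule M.coord_field_self[OF c])
  have "?v \<in> horizontal_space M g N \<pi> q" using assms by (simp add: horizontal_iff[OF t] vc)
  then have "tnorm gN (\<pi> q) (differential M N \<pi> q ?v) = tnorm g q ?v"
    using submersion q_carrier unfolding riemannian_submersion_def by blast
  then have "gN (\<pi> q) (differential M N \<pi> q ?v) (differential M N \<pi> q ?v) = g q ?v ?v"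
    by (simp add: tnorm_def)
  then show ?thesis
    using differential_in[OF q_carrier t]
    by (simp add: M.metric_via_coord[OF c t t] N.metric_via_coord[OF d] differential_component[OF t] vc)
qed

lemma snd_c_q: "snd c q \<in> snd c ` fst c"
  using M.charts_atD(2)[OF c] by blast

lemmas metric_bilinear = M.coord_metric_bilinear[OF M_metric M.charts_atD(1)[OF c] snd_c_q]
lemmas metric_sym = M.coord_metric_sym[OF M_metric M.charts_atD(1)[OF c] snd_c_q]
lemmas metric_pos = M.coord_metric_pos[OF M_metric M.charts_atD(1)[OF c] snd_c_q]

text \<open>Two candidates for the horizontal part differ by a vector that is both vertical and
  horizontal, hence of length 0; this justifies the definite description.\<close>

lemma horizontal_part_eq:
  assumes v: "v \<in> tangent_space M q" and h: "h \<in> horizontal_space M g N \<pi> q" "v - h \<in> vertical_space M N \<pi> q"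
  shows "horizontal_part M g N \<pi> q v = h"
  unfolding horizontal_part_def
proof (rule the_equality)
  fix w assume w: "w \<in> horizontal_space M g N \<pi> q \<and> v - w \<in> vertical_space M N \<pi> q"
  have t: "h \<in> tangent_space M q" "w \<in> tangent_space M q" using h w by (auto simp: horizontal_space_def)
  have tv: "v - h \<in> tangent_space M q" "v - w \<in> tangent_space M q"
    using v t subspace_diff[OF M.tangent_space_subspace] by blast+
  have "Pq (v c - h c) = 0" "Pq (v c - w c) = 0"
    using h(2) w vertical_iff[OF tv(1)] vertical_iff[OF tv(2)] by simp_all
  then have k: "Pq (w c - h c) = 0" by (simp add: linear_diff[OF Pq_linear])
  have "M.coord_metric g c (snd c q) (w c - h c) (w c - h c) = 0"
    using horizontal_iff[OF t(1)] horizontal_iff[OF t(2)] h(1) w k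
    by (simp add: bilinear_expand(3)[OF metric_bilinear])
  then have "w c - h c = 0" using metric_pos[of "w c - h c"] by force
  then show "w = h" by (intro M.tangent_eqI[OF t(2,1) c]) simp
qed (use h in blast)

lemma horizontal_part_coord:
  assumes v: "v \<in> tangent_space M q"
  obtains k where "Pq k = 0" "\<And>l. Pq l = 0 \<Longrightarrow> M.coord_metric g c (snd c q) (v c - k) l = 0"
    "horizontal_part M g N \<pi> q v = coord_field M c (v c - k) q"
proof -
  obtain k where k: "Pq k = 0" "\<And>l. Pq l = 0 \<Longrightarrow> M.coord_metric g c (snd c q) (v c - k) l = 0"
    using exists_orthogonal_projection[OF metric_bilinear metric_pos
        linear_subspace_kernel[OF Pq_linear], of "v c"] by auto
  let ?h = "coord_field M c (v c - k) q"
  have t: "?h \<in> tangent_space M q" by (rule M.coord_field_in_tangent_space[OF c])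
  have hc: "?h c = v c - k" by (rule M.coord_field_self[OF c])
  have "horizontal_part M g N \<pi> q v = ?h"
  proof (rule horizontal_part_eq[OF v])
    show "?h \<in> horizontal_space M g N \<pi> q" using k(2) by (simp add: horizontal_iff[OF t] hc)
    show "v - ?h \<in> vertical_space M N \<pi> q"
      using k(1) vertical_iff[OF subspace_diff[OF M.tangent_space_subspace v t]] by (simp add: hc)
  qed
  with k that show thesis by blast
qed

text \<open>The cosine is the quotient of the lengths of the horizontal part and of the vector, and
  the submersion preserves the former. By Pythagoras the quotient is at most 1, as
  \<open>sin_arccos\<close> requires. For \<open>a = 0\<close> division by zero gives cosine 0 and
  both sides equal 1.\<close>

lemma sin_horizontal_angle:
  "sin (horizontal_angle M g N \<pi> q (coord_field M c a q)) =
    sqrt (1 - N.coord_metric gN d (snd d (\<pi> q)) (Pq a) (Pq a) / M.coord_metric g c (snd c q) a a)"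
proof -
  let ?v = "coord_field M c a q" and ?G = "M.coord_metric g c (snd c q)"
  note Ge = bilinear_expand[OF metric_bilinear]
  have t: "?v \<in> tangent_space M q" by (rule M.coord_field_in_tangent_space[OF c])
  have vc: "?v c = a" by (rule M.coord_field_self[OF c])
  obtain k where k: "Pq k = 0" "\<And>l. Pq l = 0 \<Longrightarrow> ?G (a - k) l = 0"
    "horizontal_part M g N \<pi> q ?v = coord_field M c (a - k) q"
    using horizontal_part_coord[OF t] unfolding vc by metis
  define b where "b = a - k"
  have Pb: "Pq b = Pq a" using k(1) by (simp add: b_def linear_diff[OF Pq_linear])
  have nn: "?G u u \<ge> 0" for u using metric_pos[of u] by (cases "u = 0") (auto simp: Ge)
  have Gb: "N.coord_metric gN d (snd d (\<pi> q)) (Pq a) (Pq a) = ?G b b"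
    using isometry_horizontal[of b] k(2) Pb by (simp add: b_def)
  have "?G a a = ?G b b + ?G k k"
  proof -
    have "a = b + k" by (simp add: b_def)
    then have "?G a a = ?G b b + ?G b k + (?G k b + ?G k k)" by (simp add: Ge)
    then show ?thesis using k(2)[OF k(1)] metric_sym[of k b] by (simp add: b_def)
  qed
  then have le: "?G b b \<le> ?G a a" using nn[of k] by simp
  have n: "tnorm g q (coord_field M c u q) = sqrt (?G u u)" for u
    using M.metric_via_coord[OF c M.coord_field_in_tangent_space[OF c] M.coord_field_in_tangent_space[OF c], of g u u]
    by (simp add: tnorm_def M.coord_field_self[OF c])
  define y where "y = sqrt (?G b b) / sqrt (?G a a)"
  have y2: "y\<^sup>2 = ?G b b / ?G a a" using nn by (simp add: y_def power_divide)
  have "0 \<le> y" using nn by (simp add: y_def)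
  moreover have "y \<le> 1" using le nn[of a] by (auto simp: y_def divide_le_eq_1 order_less_le)
  ultimately have "sin (arccos y) = sqrt (1 - y\<^sup>2)" by (intro sin_arccos) auto
  then show ?thesis by (simp add: horizontal_angle_def k(3) n b_def[symmetric] y_def[symmetric] y2 Gb)
qed

text \<open>\<open>coord_field\<close> at \<open>q\<close> carries the kernel of the coordinate
  derivative injectively onto the vertical space, which lives in a space of functions on charts, so
  the dimension is that of the kernel.\<close>

lemma dim_vertical: "dim (vertical_space M N \<pi> q) + DIM('f) = DIM('e)"
proof -
  note L = M.coord_field_linear[OF c]
  have "vertical_space M N \<pi> q = (\<lambda>k. coord_field M c k q) ` {k. Pq k = 0}"
  proof (intro set_eqI iffI)
    fix v assume v: "v \<in> vertical_space M N \<pi> q"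
    then have "v = coord_field M c (v c) q" "Pq (v c) = 0"
      using M.tangent_eq_coord_field[OF vertical_tangent c] vertical_iff[OF vertical_tangent] by auto
    then show "v \<in> (\<lambda>k. coord_field M c k q) ` {k. Pq k = 0}" by blast
  next
    fix v assume "v \<in> (\<lambda>k. coord_field M c k q) ` {k. Pq k = 0}"
    then obtain k where "v = coord_field M c k q" "Pq k = 0" by blast
    then show "v \<in> vertical_space M N \<pi> q"
      using vertical_iff[OF M.coord_field_in_tangent_space[OF c]] M.coord_field_self[OF c] by simp
  qed
  moreover have "inj_on (\<lambda>k. coord_field M c k q) S" for S
    by (rule inj_onI) (metis M.coord_field_self[OF c])
  ultimately have "dim (vertical_space M N \<pi> q) = dim {k. Pq k = 0}"
    using dim_image_eq[OF L] by metis
  then show ?thesis using dim_kernel_surj[OF Pq_linear Pq_surj] by simp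
qed

end

end

section \<open>Transfer of the hypotheses to the local model\<close>

lemma add_self_eq_0: "v + v = 0 \<Longrightarrow> v = (0 :: 'v::real_vector)"
  using scaleR_2[of v] by simp

locale clairaut_lagrangian =
  submersion_charts M g N gN \<pi>
  for M :: "('a::{t2_space, second_countable_topology}, 'e::euclidean_space) chart set"
    and g :: "('a, 'e) metric"
    and N :: "('b::{t2_space, second_countable_topology}, 'f::euclidean_space) chart set"
    and gN :: "('b, 'f) metric" and \<pi> :: "'a \<Rightarrow> 'b" +
  fixes \<phi> :: "'a \<Rightarrow> ('a, 'e) tvec \<Rightarrow> ('a, 'e) tvec"
    and nabla :: "('a, 'e) connection" and f :: "'a \<Rightarrow> real"
  assumes nearly_kaehler: "nearly_kaehler M \<phi> g nabla"
    and lagrangian: "lagrangian M \<phi> g N \<pi>"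
    and clairaut: "clairaut M g nabla N \<pi> f"
begin

lemma levi_civita: "levi_civita M g nabla"
  using nearly_kaehler by (simp add: nearly_kaehler_def)

lemma affine: "affine_connection M nabla"
  using levi_civita by (simp add: levi_civita_def)

lemma phi_tensor: "tensor_field_11 M \<phi>"
  using nearly_kaehler by (simp add: nearly_kaehler_def almost_hermitian_def)

lemma phi_tangent: "\<lbrakk>q \<in> carrier M; v \<in> tangent_space M q\<rbrakk> \<Longrightarrow> \<phi> q v \<in> tangent_space M q"
  using phi_tensor unfolding tensor_field_11_def by blast

lemma phi_linear: "q \<in> carrier M \<Longrightarrow> linear_map_on (tangent_space M q) (\<phi> q)"
  using phi_tensor unfolding tensor_field_11_def by blast

lemma phi_vector_field:
  assumes "open_in_manifold M U" "vector_field M U X"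
  shows "vector_field M U (\<lambda>q. \<phi> q (X q))"
  by (rule phi_tensor[unfolded tensor_field_11_def, THEN conjunct2, THEN spec, THEN spec, THEN mp, OF conjI[OF assms]])

lemma phi_phi:
  assumes "q \<in> carrier M" "v \<in> tangent_space M q"
  shows "\<phi> q (\<phi> q v) = - v" and "w \<in> tangent_space M q \<Longrightarrow> g q (\<phi> q v) (\<phi> q w) = g q v w"
proof -
  have "\<forall>p\<in>carrier M. \<forall>v\<in>tangent_space M p. \<phi> p (\<phi> p v) = - v \<and>
       (\<forall>w\<in>tangent_space M p. g p (\<phi> p v) (\<phi> p w) = g p v w)"
    using nearly_kaehler unfolding nearly_kaehler_def almost_hermitian_def by (elim conjE)
  then have *: "\<phi> q (\<phi> q v) = - v \<and> (\<forall>w\<in>tangent_space M q. g q (\<phi> q v) (\<phi> q w) = g q v w)"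
    using assms by blast
  show "\<phi> q (\<phi> q v) = - v" using * by (rule conjunct1)
  show "w \<in> tangent_space M q \<Longrightarrow> g q (\<phi> q v) (\<phi> q w) = g q v w" using * by blast
qed

text \<open>The nearly Kaehler condition with both fields equal to \<open>E\<close> says that twice
  (\<nabla>_E \<phi>) E vanishes.\<close>

lemma nabla_phi_self:
  assumes U: "open_in_manifold M U" and E: "vector_field M U E" and q: "q \<in> U"
  shows "nabla q (E q) (\<lambda>q. \<phi> q (E q)) = \<phi> q (nabla q (E q) E)"
proof -
  have "nabla_tensor nabla \<phi> q (E q) E + nabla_tensor nabla \<phi> q (E q) E = 0"
    by (rule nearly_kaehler[unfolded nearly_kaehler_def, THEN conjunct2, THEN conjunct2, THEN spec, THEN spec,
          THEN spec, THEN mp, OF conjI[OF U conjI[OF E E]], THEN bspec, OF q])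
  from add_self_eq_0[OF this] show ?thesis by (simp add: nabla_tensor_def)
qed

lemma f_smooth: "smooth_fun M (carrier M) f"
  using clairaut by (simp add: clairaut_def)

lemma clairaut_constant:
  assumes "geodesic M nabla I h"
  shows "(\<lambda>s. exp (f (h s)) * sin (horizontal_angle M g N \<pi> (h s) (velocity M h s))) constant_on I"
  by (rule clairaut[unfolded clairaut_def, THEN conjunct2, THEN spec, THEN spec, THEN mp, OF assms])

definition coord_phi :: "('a, 'e) chart \<Rightarrow> 'e \<Rightarrow> 'e \<Rightarrow> 'e"
  where "coord_phi c x a = \<phi> (chart_inv c x) (coord_field M c a (chart_inv c x)) c"

context
  fixes c d x
  assumes c: "c \<in> M" and d: "d \<in> N" and x: "x \<in> rep_dom c d"
begin

abbreviation (input) "cf a \<equiv> coord_field M c a (chart_inv c x)"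

lemmas cq = rep_dom_point(1)[OF c d x]
lemmas dq = rep_dom_point(2)[OF c d x]
lemmas sq = rep_dom_point(3)[OF c d x]
lemmas spq = rep_dom_point(4)[OF c d x]

lemma q_in: "(chart_inv c x) \<in> carrier M"
  by (rule M.charts_at_carrier[OF cq])

lemma x_range: "x \<in> snd c ` fst c"
  using x rep_dom_range by blast

lemma cf_tangent: "cf a \<in> tangent_space M (chart_inv c x)"
  by (rule M.coord_field_in_tangent_space[OF cq])

lemma cf_self: "cf a c = a"
  by (rule M.coord_field_self[OF cq])

lemma phi_cf: "\<phi> (chart_inv c x) (cf a) = cf (coord_phi c x a)"
  unfolding coord_phi_def by (rule M.tangent_eq_coord_field[OF phi_tangent[OF q_in cf_tangent] cq, symmetric])

lemma g_cf: "g (chart_inv c x) (cf a) (cf b) = M.coord_metric g c x a b"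
  by (simp add: M.coord_metric_def)

lemma coord_phi_linear: "linear (coord_phi c x)"
proof (rule linearI)
  note lm = phi_linear[OF q_in, unfolded linear_map_on_def]
  show "coord_phi c x (a + b) = coord_phi c x a + coord_phi c x b" for a b
    unfolding coord_phi_def linear_add[OF M.coord_field_linear[OF cq]]
      lm[THEN conjunct1, THEN bspec, OF cf_tangent, THEN bspec, OF cf_tangent] by simp
  show "coord_phi c x (k *\<^sub>R a) = k *\<^sub>R coord_phi c x a" for k a
    unfolding coord_phi_def linear_cmul[OF M.coord_field_linear[OF cq]]
      lm[THEN conjunct2, THEN spec, THEN bspec, OF cf_tangent] by (simp add: scaleR_fun_def)
qed

lemma coord_phi_phi: "coord_phi c x (coord_phi c x a) = - a"
proof -
  have "cf (coord_phi c x (coord_phi c x a)) = - cf a"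
    using phi_phi(1)[OF q_in cf_tangent, of a] by (simp only: phi_cf)
  from fun_cong[OF this, of c] show ?thesis by (simp add: cf_self)
qed

lemma coord_phi_isometry:
  "M.coord_metric g c x (coord_phi c x a) (coord_phi c x b) = M.coord_metric g c x a b"
  using phi_phi(2)[OF q_in cf_tangent cf_tangent, of a b] by (simp only: phi_cf g_cf)

lemma cf_vertical_iff: "cf a \<in> vertical_space M N \<pi> (chart_inv c x) \<longleftrightarrow> frechet_derivative (rep c d) (at x) a = 0"
  using vertical_iff[OF cq dq cf_tangent, of a] by (simp only: sq cf_self)

lemma cf_horizontal_iff: "cf a \<in> horizontal_space M g N \<pi> (chart_inv c x) \<longleftrightarrow>
    (\<forall>k. frechet_derivative (rep c d) (at x) k = 0 \<longrightarrow> M.coord_metric g c x a k = 0)"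
  using horizontal_iff[OF cq dq cf_tangent, of a] by (simp only: sq cf_self)

lemma coord_anti_invariant:
  assumes "frechet_derivative (rep c d) (at x) a = 0" "frechet_derivative (rep c d) (at x) b = 0"
  shows "M.coord_metric g c x (coord_phi c x a) b = 0"
proof -
  have "\<phi> (chart_inv c x) (cf a) \<in> horizontal_space M g N \<pi> (chart_inv c x)"
    using lagrangian q_in assms(1) cf_vertical_iff[of a] unfolding lagrangian_def anti_invariant_def by blast
  then show ?thesis using assms(2) by (simp add: phi_cf cf_horizontal_iff)
qed

lemma coord_lagrangian:
  assumes hor: "\<And>k. frechet_derivative (rep c d) (at x) k = 0 \<Longrightarrow> M.coord_metric g c x a k = 0"
    and mu: "\<And>k. frechet_derivative (rep c d) (at x) k = 0 \<Longrightarrow> M.coord_metric g c x a (coord_phi c x k) = 0"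
  shows "a = 0"
proof -
  have "g (chart_inv c x) (cf a) (\<phi> (chart_inv c x) u) = 0" if u: "u \<in> vertical_space M N \<pi> (chart_inv c x)" for u
  proof -
    have "u \<in> tangent_space M (chart_inv c x)" using u by (simp add: vertical_space_def)
    then have "u = cf (u c)" using M.tangent_eq_coord_field[OF _ cq] by simp
    then show ?thesis using u mu[of "u c"] cf_vertical_iff[of "u c"] by (metis phi_cf g_cf)
  qed
  moreover have "cf a \<in> horizontal_space M g N \<pi> (chart_inv c x)" using hor by (simp add: cf_horizontal_iff)
  ultimately have "cf a \<in> mu_space M \<phi> g N \<pi> (chart_inv c x)" by (auto simp: mu_space_def)
  then have "cf a = 0" using lagrangian q_in unfolding lagrangian_def by blast
  then show "a = 0" using cf_self[of a] by simp
qed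

text \<open>Metric compatibility is applied to \<open>\<phi>\<close> of the coordinate field of
  \<open>a\<close> and to the coordinate field of \<open>b\<close>, in the direction
  \<open>a\<close>; then \<open>nabla_phi_self\<close> moves \<open>\<phi>\<close> out of the
  covariant derivative.\<close>

lemma coord_nearly_kaehler:
  "frechet_derivative (\<lambda>x. M.coord_metric g c x (coord_phi c x a) b) (at x) a =
    M.coord_metric g c x (coord_phi c x (M.christoffel nabla c x a a)) b
    + M.coord_metric g c x (coord_phi c x a) (M.christoffel nabla c x a b)"
proof -
  let ?X = "\<lambda>p. \<phi> p (coord_field M c a p)" and ?Y = "coord_field M c b"
  let ?F = "\<lambda>x. g (chart_inv c x) (?X (chart_inv c x)) (?Y (chart_inv c x))"
  note dom = M.chart_domain_open[OF affine c] and vf = M.coord_field_vector_field_domain[OF affine c]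
  have vX: "vector_field M (fst c) ?X" by (rule phi_vector_field[OF dom vf])
  have qc: "(chart_inv c x) \<in> fst c" by (rule chart_inv_in[OF x_range])
  have e: "\<phi> (chart_inv c y) (coord_field M c a (chart_inv c y)) = coord_field M c (coord_phi c y a) (chart_inv c y)"
    if "y \<in> snd c ` fst c" for y
  proof -
    have cy: "c \<in> charts_at M (chart_inv c y)" by (rule M.chart_inv_charts_at[OF c that])
    show ?thesis unfolding coord_phi_def
      by (rule M.tangent_eq_coord_field[OF _ cy, symmetric])
         (rule phi_tangent[OF M.charts_at_carrier[OF cy] M.coord_field_in_tangent_space[OF cy]])
  qed
  have "smooth_fun M (fst c) (\<lambda>p. g p (?X p) (?Y p))" by (rule M.metric_smooth[OF M_metric dom vX vf])
  then have sF: "smooth_on (snd c ` fst c) ?F" using c unfolding smooth_fun_def by (auto simp: o_def dest: bspec)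
  have "frechet_derivative ?F (at x) = frechet_derivative (\<lambda>x. M.coord_metric g c x (coord_phi c x a) b) (at x)"
    by (rule frechet_derivative_transform_within_open[OF smooth_on_differentiable[OF sF x_range]
          open_chart_range[OF M.is_chart[OF c]] x_range])
       (simp add: M.coord_metric_def e)
  then have "frechet_derivative (\<lambda>x. M.coord_metric g c x (coord_phi c x a) b) (at x) a
      = g (chart_inv c x) (nabla (chart_inv c x) (cf a) ?X) (cf b) + g (chart_inv c x) (\<phi> (chart_inv c x) (cf a)) (nabla (chart_inv c x) (cf a) ?Y)"
    using M.metric_derivative[OF levi_civita c M_metric dom vX vf qc cq cf_tangent, of b a]
    by (simp add: sq cf_self)
  moreover have "nabla (chart_inv c x) (cf a) ?X = \<phi> (chart_inv c x) (nabla (chart_inv c x) (cf a) (coord_field M c a))"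
    by (rule nabla_phi_self[OF dom vf qc])
  moreover have "nabla (chart_inv c x) (cf a) (coord_field M c u) = cf (M.christoffel nabla c x a u)" for u
    using M.tangent_eq_coord_field[OF M.nabla_coord_field_tangent[OF affine cq cf_tangent] cq, of a u]
    by (simp add: M.christoffel_def)
  ultimately show ?thesis by (simp add: phi_cf g_cf)
qed

lemma coord_submersion:
  assumes "\<And>k. frechet_derivative (rep c d) (at x) k = 0 \<Longrightarrow> M.coord_metric g c x a k = 0"
  shows "N.coord_metric gN d (rep c d x) (frechet_derivative (rep c d) (at x) a) (frechet_derivative (rep c d) (at x) a)
    = M.coord_metric g c x a a"
  using isometry_horizontal[OF cq dq, of a, unfolded sq spq] assms by blast

lemma coord_sin_horizontal_angle:
  "sin (horizontal_angle M g N \<pi> (chart_inv c x) (cf a)) =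
    sqrt (1 - N.coord_metric gN d (rep c d x) (frechet_derivative (rep c d) (at x) a) (frechet_derivative (rep c d) (at x) a)
      / M.coord_metric g c x a a)"
  using sin_horizontal_angle[OF cq dq, of a] unfolding sq spq .

end

lemma coord_phi_smooth:
  assumes c: "c \<in> M"
  shows "smooth_on (snd c ` fst c) (\<lambda>x. coord_phi c x a)"
proof -
  have "vector_field M (fst c) (\<lambda>q. \<phi> q (coord_field M c a q))"
    by (intro phi_vector_field M.chart_domain_open[OF affine c] M.coord_field_vector_field_domain[OF affine c])
  then have "\<forall>c'\<in>M. smooth_on (snd c' ` (fst c' \<inter> fst c)) (\<lambda>x. \<phi> (chart_inv c' x) (coord_field M c a (chart_inv c' x)) c')"
    unfolding vector_field_def by (rule conjunct2)
  from bspec[OF this c] show ?thesis by (simp add: coord_phi_def)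
qed

text \<open>By \<open>geodesic_from_chart\<close> the coordinate solution is a geodesic of
  \<open>M\<close>, so the Clairaut hypothesis applies to it; its velocity is known in the chart,
  which makes the sine computable.\<close>

lemma coord_clairaut:
  assumes c: "c \<in> M" and d: "d \<in> N" and "\<delta> > 0" and smX: "smooth_on {-\<delta><..<\<delta>} X"
    and X: "\<And>t. t \<in> {-\<delta><..<\<delta>} \<Longrightarrow> X t \<in> rep_dom c d"
    and dX: "\<And>t. t \<in> {-\<delta><..<\<delta>} \<Longrightarrow> (X has_vector_derivative V t) (at t)"
    and dV: "\<And>t. t \<in> {-\<delta><..<\<delta>} \<Longrightarrow> (V has_vector_derivative - M.christoffel nabla c (X t) (V t) (V t)) (at t)"
  shows "(\<lambda>t. exp ((f \<circ> chart_inv c) (X t)) * sqrt (1 - N.coord_metric gN d (rep c d (X t))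
      (frechet_derivative (rep c d) (at (X t)) (V t)) (frechet_derivative (rep c d) (at (X t)) (V t))
      / M.coord_metric g c (X t) (V t) (V t))) constant_on {-\<delta><..<\<delta>}"
proof -
  let ?I = "{-\<delta><..<\<delta>}" and ?h = "\<lambda>t. chart_inv c (X t)"
  have Xc: "X t \<in> snd c ` fst c" if "t \<in> ?I" for t using X[OF that] rep_dom_range by blast
  note geo = M.geodesic_from_chart[OF affine c open_greaterThanLessThan is_interval_oo smX Xc dX dV]
  have "(\<lambda>s. exp (f (?h s)) * sin (horizontal_angle M g N \<pi> (?h s) (velocity M ?h s))) constant_on ?I"
    by (rule clairaut_constant[OF geo(1)])
  then obtain k where k: "\<And>t. t \<in> ?I \<Longrightarrow> exp (f (?h t)) * sin (horizontal_angle M g N \<pi> (?h t) (velocity M ?h t)) = k"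
    unfolding constant_on_def by blast
  have velocity: "velocity M ?h t = coord_field M c (V t) (?h t)" if "t \<in> ?I" for t
    using geo(2) that by blast
  show ?thesis
    unfolding constant_on_def
  proof (intro exI[of _ k] ballI)
    fix t assume t: "t \<in> ?I"
    show "exp ((f \<circ> chart_inv c) (X t)) * sqrt (1 - N.coord_metric gN d (rep c d (X t))
      (frechet_derivative (rep c d) (at (X t)) (V t)) (frechet_derivative (rep c d) (at (X t)) (V t))
      / M.coord_metric g c (X t) (V t) (V t)) = k"
      using k[OF t] velocity[OF t] coord_sin_horizontal_angle[OF c d X[OF t], of "V t"] by simp
  qed
qed

lemma local_model:
  assumes c: "c \<in> M" and d: "d \<in> N"
  shows "local_model (rep_dom c d) (snd d ` fst d) (M.coord_metric g c) (N.coord_metric gN d)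
    (M.christoffel nabla c) (coord_phi c) (rep c d) (f \<circ> chart_inv c)"
proof (rule local_model.intro)
  have sub: "x \<in> rep_dom c d \<Longrightarrow> x \<in> snd c ` fst c" for x using rep_dom_range by blast
  note restrict = smooth_on_subset[OF _ rep_dom_range]
  show "open (rep_dom c d)" by (rule open_rep_dom[OF c d])
  show "smooth_on (rep_dom c d) (rep c d)" by (rule rep_smooth[OF c d])
  show "smooth_on (rep_dom c d) (f \<circ> chart_inv c)"
  proof (rule restrict)
    have "fst c \<inter> carrier M = fst c" using c by (auto simp: carrier_def)
    then show "smooth_on (snd c ` fst c) (f \<circ> chart_inv c)"
      using bspec[OF f_smooth[unfolded smooth_fun_def] c] by simp
  qed
  show "smooth_on (rep_dom c d) (\<lambda>x. M.coord_metric g c x a b)" for a b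
    by (rule restrict[OF M.coord_metric_smooth[OF M_metric c]])
  show "smooth_on (rep_dom c d) (\<lambda>x. M.christoffel nabla c x a b)" for a b
    by (rule restrict[OF M.christoffel_smooth[OF affine c]])
  show "smooth_on (rep_dom c d) (\<lambda>x. coord_phi c x a)" for a
    by (rule restrict[OF coord_phi_smooth[OF c]])
  show "smooth_on (snd d ` fst d) (\<lambda>y. N.coord_metric gN d y a b)" for a b
    by (rule N.coord_metric_smooth[OF N_metric d])
  show "bilinear (N.coord_metric gN d y)" if "y \<in> snd d ` fst d" for y
    by (rule N.coord_metric_bilinear[OF N_metric d that])
  show "N.coord_metric gN d y a b = N.coord_metric gN d y b a" if "y \<in> snd d ` fst d" for y a b
    by (rule N.coord_metric_sym[OF N_metric d that])
  show "N.coord_metric gN d y a a > 0" if "y \<in> snd d ` fst d" "a \<noteq> 0" for y a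
    by (rule N.coord_metric_pos[OF N_metric d that])
  show "(\<lambda>t. exp ((f \<circ> chart_inv c) (X t)) * sqrt (1 - N.coord_metric gN d (rep c d (X t))
      (frechet_derivative (rep c d) (at (X t)) (V t)) (frechet_derivative (rep c d) (at (X t)) (V t))
      / M.coord_metric g c (X t) (V t) (V t))) constant_on {-\<delta><..<\<delta>}"
    if "\<delta> > 0" "smooth_on {-\<delta><..<\<delta>} X" "\<And>t. t \<in> {-\<delta><..<\<delta>} \<Longrightarrow> X t \<in> rep_dom c d"
      "\<And>t. t \<in> {-\<delta><..<\<delta>} \<Longrightarrow> (X has_vector_derivative V t) (at t)"
      "\<And>t. t \<in> {-\<delta><..<\<delta>} \<Longrightarrow> (V has_vector_derivative - M.christoffel nabla c (X t) (V t) (V t)) (at t)" for \<delta> X V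
    by (rule coord_clairaut[OF c d that])
  fix x assume x: "x \<in> rep_dom c d"
  note xc = sub[OF x]
  show "rep c d x \<in> snd d ` fst d" by (rule rep_dom_point(5)[OF c d x])
  show "bilinear (M.coord_metric g c x)" by (rule M.coord_metric_bilinear[OF M_metric c xc])
  show "M.coord_metric g c x a b = M.coord_metric g c x b a" for a b by (rule M.coord_metric_sym[OF M_metric c xc])
  show "M.coord_metric g c x a a > 0" if "a \<noteq> 0" for a by (rule M.coord_metric_pos[OF M_metric c xc that])
  show "bilinear (M.christoffel nabla c x)" by (rule M.christoffel_bilinear[OF affine c xc])
  show "M.christoffel nabla c x a b = M.christoffel nabla c x b a" for a b
    by (rule M.christoffel_sym[OF levi_civita c M_metric xc])
  show "frechet_derivative (\<lambda>x. M.coord_metric g c x a b) (at x) u =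
    M.coord_metric g c x (M.christoffel nabla c x u a) b + M.coord_metric g c x a (M.christoffel nabla c x u b)" for a b u
    by (rule M.coord_metric_compatible[OF levi_civita c M_metric xc])
  show "surj (frechet_derivative (rep c d) (at x))"
    using Pq_surj[OF rep_dom_point(1,2)[OF c d x]] by (simp add: rep_dom_point(3)[OF c d x])
  show "N.coord_metric gN d (rep c d x) (frechet_derivative (rep c d) (at x) a) (frechet_derivative (rep c d) (at x) a)
    = M.coord_metric g c x a a"
    if "\<And>k. frechet_derivative (rep c d) (at x) k = 0 \<Longrightarrow> M.coord_metric g c x a k = 0" for a
    by (rule coord_submersion[OF c d x that])
  show "linear (coord_phi c x)" by (rule coord_phi_linear[OF c d x])
  show "coord_phi c x (coord_phi c x a) = - a" for a by (rule coord_phi_phi[OF c d x])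
  show "M.coord_metric g c x (coord_phi c x a) (coord_phi c x b) = M.coord_metric g c x a b" for a b
    by (rule coord_phi_isometry[OF c d x])
  show "M.coord_metric g c x (coord_phi c x a) b = 0"
    if "frechet_derivative (rep c d) (at x) a = 0" "frechet_derivative (rep c d) (at x) b = 0" for a b
    by (rule coord_anti_invariant[OF c d x that])
  show "a = 0" if "\<And>k. frechet_derivative (rep c d) (at x) k = 0 \<Longrightarrow> M.coord_metric g c x a k = 0"
    "\<And>k. frechet_derivative (rep c d) (at x) k = 0 \<Longrightarrow> M.coord_metric g c x a (coord_phi c x k) = 0" for a
    by (rule coord_lagrangian[OF c d x that])
  show "frechet_derivative (\<lambda>x. M.coord_metric g c x (coord_phi c x a) b) (at x) a =
    M.coord_metric g c x (coord_phi c x (M.christoffel nabla c x a a)) b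
    + M.coord_metric g c x (coord_phi c x a) (M.christoffel nabla c x a b)" for a b
    by (rule coord_nearly_kaehler[OF c d x])
qed

section \<open>The alternative for the fibres\<close>

lemma fibres_totally_geodesic:
  assumes dim: "DIM('e) \<ge> DIM('f) + 2"
  shows "totally_geodesic_fibre M g nabla N \<pi> y"
  unfolding totally_geodesic_fibre_def
proof (intro allI impI ballI, elim conjE)
  fix U X Y q
  assume U: "open_in_manifold M U" and X: "vector_field M U X" and Y: "vector_field M U Y"
    and vert: "\<forall>p\<in>U \<inter> fibre M \<pi> y. X p \<in> vertical_space M N \<pi> p \<and> Y p \<in> vertical_space M N \<pi> p"
    and q: "q \<in> U \<inter> fibre M \<pi> y"
  have qM: "q \<in> carrier M" and piq: "\<pi> q = y" using q by (auto simp: fibre_def)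
  obtain c where c: "c \<in> charts_at M q" using M.chart_at_in[OF qM] by blast
  have "\<pi> q \<in> carrier N" using qM pi_range by blast
  then obtain d where d: "d \<in> charts_at N (\<pi> q)" using N.chart_at_in by blast
  note cM = M.charts_atD(1)[OF c] and dN = N.charts_atD(1)[OF d]
  interpret L: local_model "rep_dom c d" "snd d ` fst d" "M.coord_metric g c" "N.coord_metric gN d"
    "M.christoffel nabla c" "coord_phi c" "rep c d" "f \<circ> chart_inv c"
    by (rule local_model[OF cM dN])
  let ?x = "snd c q" and ?Yc = "\<lambda>x. Y (chart_inv c x) c"
  let ?W = "snd c ` (fst c \<inter> U)"
  have x: "?x \<in> rep_dom c d" by (rule point_in_rep_dom[OF c d])
  have oU: "open U" using U by (simp add: open_in_manifold_def)
  have oW: "open ?W" by (rule open_chart_image[OF M.is_chart[OF cM] oU])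
  have xW: "?x \<in> ?W" using q M.charts_atD(2)[OF c] by blast
  have Xq: "X q \<in> tangent_space M q" and Xv: "X q \<in> vertical_space M N \<pi> q"
    using X vert q by (auto simp: vector_field_def)
  have Yc: "smooth_on ?W ?Yc" using Y cM by (simp add: vector_field_def)
  have qi: "chart_inv c ?x = q" by (rule chart_inv_snd[OF M.is_chart[OF cM] M.charts_atD(2)[OF c]])
  \<comment> \<open>By \<open>nabla_coord\<close> the argument of \<open>L.P\<close> is the
    \<open>c\<close>-component of \<open>nabla q (X q) Y\<close>, so this says that the covariant
    derivative is vertical.\<close>
  have "L.P ?x (frechet_derivative ?Yc (at ?x) (X q c) + M.christoffel nabla c ?x (X q c) (?Yc ?x)) = 0"
  proof (rule L.totally_geodesic[OF x _ _ oW xW smooth_on_has_derivative[OF Yc xW]])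
    show "dim {k. L.P ?x k = 0} \<ge> 2"
      using dim_kernel_surj[OF Pq_linear[OF c d] Pq_surj[OF c d]] dim by simp
    show "L.P ?x (X q c) = 0" using vertical_iff[OF c d Xq] Xv by simp
    show "L.P z (?Yc z) = 0" if z: "z \<in> ?W" "z \<in> rep_dom c d" "rep c d z = rep c d ?x" for z
    proof -
      let ?p = "chart_inv c z"
      note pt = rep_dom_point[OF cM dN z(2)]
      have pU: "?p \<in> U" using z(1) chart_inv_snd[OF M.is_chart[OF cM]] by auto
      \<comment> \<open>Equal coordinates in \<open>d\<close> mean equal images under
        \<open>\<pi>\<close>; hence the point lies on the given fibre, where verticality of
        \<open>Y\<close> is known.\<close>
      have "\<pi> ?p = \<pi> (chart_inv c ?x)" using pt(6) rep_dom_point(6)[OF cM dN x] z(3) by simp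
      then have "?p \<in> fibre M \<pi> y" using M.charts_at_carrier[OF pt(1)] piq qi by (simp add: fibre_def)
      then have "Y ?p \<in> vertical_space M N \<pi> ?p" using vert pU by blast
      moreover have "Y ?p \<in> tangent_space M ?p" using Y pU by (simp add: vector_field_def)
      ultimately show ?thesis using vertical_iff[OF pt(1,2)] by (simp add: pt(3))
    qed
  qed
  then have 0: "L.P ?x (nabla q (X q) Y c) = 0"
    using M.nabla_coord[OF affine U Y _ c Xq] q M.nabla_coord_field_christoffel[OF affine c Xq] by (simp add: qi)
  have nt: "nabla q (X q) Y \<in> tangent_space M q"
    by (rule M.nabla_tangent[OF affine U Y _ Xq]) (use q in blast)
  have "horizontal_part M g N \<pi> q (nabla q (X q) Y) = 0"
  proof (rule horizontal_part_eq[OF c d nt])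
    show "0 \<in> horizontal_space M g N \<pi> q"
      using horizontal_iff[OF c d subspace_0[OF M.tangent_space_subspace]]
      by (simp add: bilinear_expand[OF metric_bilinear[OF c d]])
    show "nabla q (X q) Y - 0 \<in> vertical_space M N \<pi> q"
      using vertical_iff[OF c d nt] 0 by simp
  qed
  then show "second_fundamental_form M g nabla N \<pi> X Y q = 0"
    by (simp add: second_fundamental_form_def)
qed

lemma fibre_dimension:
  assumes "q \<in> carrier M"
  shows "dim (vertical_space M N \<pi> q) + DIM('f) = DIM('e)"
proof -
  have "\<pi> q \<in> carrier N" using assms pi_range by blast
  then show ?thesis using dim_vertical M.chart_at_in[OF assms] N.chart_at_in by blast
qed

text \<open>Every vertical space has dimension DIM('e) - DIM('f), which is positive. If it is 1, the
  first alternative holds for all fibres; otherwise it is at least 2 and the local argument applies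
  at every point.\<close>

lemma dichotomy:
  "(\<forall>q\<in>carrier N. fibre_has_dim M N \<pi> q 1) \<or> (\<forall>q\<in>carrier N. totally_geodesic_fibre M g nabla N \<pi> q)"
proof (cases "DIM('e) = DIM('f) + 1")
  case True
  then have "fibre_has_dim M N \<pi> q 1" for q
    using fibre_dimension by (auto simp: fibre_has_dim_def fibre_def)
  then show ?thesis by blast
next
  case False
  moreover have "DIM('f) < DIM('e)" using submersion unfolding riemannian_submersion_def by blast
  ultimately show ?thesis using fibres_totally_geodesic by simp
qed

end

theorem corollary3p6:
  fixes M :: "('a::{t2_space, second_countable_topology}, 'e::euclidean_space) chart set"
    and N :: "('b::{t2_space, second_countable_topology}, 'f::euclidean_space) chart set"
    and \<phi> :: "'a \<Rightarrow> ('a, 'e) tvec \<Rightarrow> ('a, 'e) tvec"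
    and g :: "('a, 'e) metric"
    and gN :: "('b, 'f) metric"
    and nabla :: "('a, 'e) connection"
    and \<pi> :: "'a \<Rightarrow> 'b"
    and f :: "'a \<Rightarrow> real"
  assumes "nearly_kaehler M \<phi> g nabla"
    and "riemannian_manifold N gN"
    and "riemannian_submersion M g N gN \<pi>"
    and "lagrangian M \<phi> g N \<pi>"
    and "clairaut M g nabla N \<pi> f"
  shows "(\<forall>q\<in>carrier N. fibre_has_dim M N \<pi> q 1) \<or>
         (\<forall>q\<in>carrier N. totally_geodesic_fibre M g nabla N \<pi> q)"
proof -
  interpret clairaut_lagrangian M g N gN \<pi> \<phi> nabla f
    using assms by unfold_locales
  show ?thesis by (rule dichotomy)
qed

end
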